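(* Let $\psi:\Sigma^k\longrightarrow\overline{M}^{n+2}$ be a parabolic spacelike submanifold in a plane fronted wave $\overline{M}^{n+2}$, with mean curvature vector field $\overrightarrow{H}$, and let $\mu:=u\circ\psi$. If $\langle\overrightarrow{H},\partial_v\rangle\geq 0$ (resp., $\langle\overrightarrow{H},\partial_v\rangle\leq 0$) and $\sup_{\Sigma^k}\mu<+\infty$ (resp., $\inf_{\Sigma^k}\mu>-\infty$), then $\mu=u_0$ on $\Sigma^k$ for some constant $u_0\in\mathbb{R}$. In addition, if $\Sigma^n$ is a simply-connected codimension two submanifold (that is, $k=n$), then the wavefront ($u=u_0$, $v=v_0$, with $v_0\in\mathbb{R}$) is parabolic.
   Context: A plane fronted wave is a Lorentzian manifold $(\overline{M}^{n+2},\langle\ ,\ \rangle)$ with $\overline{M}^{n+2}=\mathbb{R}^2\times M^n$, where $(M^n,g_M)$ is a connected Riemannian manifold, and metric $\langle\ ,\ \rangle=\mathcal{H}(u,x)\,du\otimes du+du\otimes dv+dv\otimes du+g_M$, where $(u,v)$ are the natural coordinates on $\mathbb{R}^2$ and $\mathcal{H}(u,x)$ is a smooth function on $\mathbb{R}^2\times M^n$ independent of $v$. The coordinate vector field $\partial_v=\partial/\partial v$ is lightlike and parallel, and the spacetime is time oriented by $\partial_v$. The wavefronts are the codimension two spacelike submanifolds given by $u=u_0$, $v=v_0$, for $u_0,v_0\in\mathbb{R}$, with the induced metric. A spacelike submanifold $\psi:\Sigma^k\to\overline{M}^{n+2}$ is an immersion of a connected $k$-dimensional manifold whose induced metric (also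 denoted $\langle\ ,\ \rangle$) is Riemannian. Its mean curvature vector field is $\overrightarrow{H}=\frac1k\,\mathrm{trace}_{\langle\ ,\ \rangle}(\mathrm{II})$, where $\mathrm{II}$ is the second fundamental form, defined by $\overline{\nabla}_XY=\nabla_XY+\mathrm{II}(X,Y)$, with $\overline\nabla$, $\nabla$ the Levi-Civita connections of $\overline{M}^{n+2}$ and $\Sigma^k$. A complete (non-compact) Riemannian manifold is parabolic if the only superharmonic functions ($\Delta f\le 0$, $\Delta=\mathrm{div}\,\nabla$) bounded from below that it admits are the constants. A spacelike submanifold is parabolic if it is so with its induced metric.
   Formalization: Parabolic is taken without the requirement "non-compact": read strictly, the last claim fails, since the flat plane covering a flat torus wavefront is a simply-connected parabolic submanifold while the wavefront is compact. *)

theory Defs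
  imports "HOL-Analysis.Analysis"
begin

section \<open>Smooth maps between Euclidean spaces\<close>

text \<open>Only used for open \<open>S\<close>.\<close>

primrec Ck_on :: "nat \<Rightarrow> 'a::euclidean_space set \<Rightarrow> ('a \<Rightarrow> 'b::real_normed_vector) \<Rightarrow> bool" where
  "Ck_on 0 S f \<longleftrightarrow> continuous_on S f"
| "Ck_on (Suc k) S f \<longleftrightarrow>
     (\<forall>x\<in>S. f differentiable (at x)) \<and> (\<forall>v. Ck_on k S (\<lambda>x. frechet_derivative f (at x) v))"

definition smooth_on :: "'a::euclidean_space set \<Rightarrow> ('a \<Rightarrow> 'b::real_normed_vector) \<Rightarrow> bool" where
  "smooth_on S f \<longleftrightarrow> (\<forall>k. Ck_on k S f)"


section \<open>Smooth manifolds\<close>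

text \<open>
  The underlying set of a manifold is a whole type; Hausdorff and second countable are imposed by
  type classes in the theorem. The dimension is that of the model space \<open>'e\<close>. An atlas
  need not be maximal: no notion below changes if compatible charts are added.
\<close>

type_synonym ('m, 'e) chart = "'m set \<times> ('m \<Rightarrow> 'e)"

definition chart_inv :: "('m, 'e) chart \<Rightarrow> 'e \<Rightarrow> 'm" where
  "chart_inv c = inv_into (fst c) (snd c)"

definition chart_image :: "('m, 'e) chart \<Rightarrow> 'e set" where
  "chart_image c = snd c ` fst c"

definition is_chart :: "('m::topological_space, 'e::euclidean_space) chart \<Rightarrow> bool" where
  "is_chart c \<longleftrightarrow> open (fst c) \<and> open (chart_image c) \<and>
     homeomorphism (fst c) (chart_image c) (snd c) (chart_inv c)"

definition smooth_atlas :: "('m::topological_space, 'e::euclidean_space) chart set \<Rightarrow> bool" where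
  "smooth_atlas A \<longleftrightarrow> (\<forall>c\<in>A. is_chart c) \<and> (\<Union>c\<in>A. fst c) = UNIV \<and>
     (\<forall>c\<in>A. \<forall>d\<in>A. smooth_on (snd c ` (fst c \<inter> fst d)) (snd d \<circ> chart_inv c))"

definition chart_at :: "('m, 'e) chart set \<Rightarrow> 'm \<Rightarrow> ('m, 'e) chart" where
  "chart_at A p = (SOME c. c \<in> A \<and> p \<in> fst c)"

definition smooth_scalar_on ::
    "('m, 'e::euclidean_space) chart set \<Rightarrow> 'm set \<Rightarrow> ('m \<Rightarrow> real) \<Rightarrow> bool" where
  "smooth_scalar_on A U f \<longleftrightarrow> (\<forall>c\<in>A. smooth_on (snd c ` (fst c \<inter> U)) (f \<circ> chart_inv c))"

definition smooth_near ::
    "('m::topological_space, 'e::euclidean_space) chart set \<Rightarrow> 'm \<Rightarrow> ('m \<Rightarrow> real) \<Rightarrow> bool" where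
  "smooth_near A p f \<longleftrightarrow> (\<exists>U. open U \<and> p \<in> U \<and> smooth_scalar_on A U f)"

definition smooth_map ::
    "('m::topological_space, 'e::euclidean_space) chart set \<Rightarrow>
     ('n::topological_space, 'f::euclidean_space) chart set \<Rightarrow> ('m \<Rightarrow> 'n) \<Rightarrow> bool" where
  "smooth_map A B F \<longleftrightarrow> continuous_on UNIV F \<and>
     (\<forall>c\<in>A. \<forall>d\<in>B. smooth_on (snd c ` (fst c \<inter> F -` fst d)) (snd d \<circ> F \<circ> chart_inv c))"

definition prod_chart :: "('m, 'e) chart \<Rightarrow> ('n, 'f) chart \<Rightarrow> ('m \<times> 'n, 'e \<times> 'f) chart" where
  "prod_chart c d = (fst c \<times> fst d, map_prod (snd c) (snd d))"

definition prod_atlas ::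
    "('m, 'e) chart set \<Rightarrow> ('n, 'f) chart set \<Rightarrow> ('m \<times> 'n, 'e \<times> 'f) chart set" where
  "prod_atlas A B = {prod_chart c d | c d. c \<in> A \<and> d \<in> B}"

definition euclidean_atlas :: "('e, 'e) chart set" where
  "euclidean_atlas = {(UNIV, id)}"


section \<open>Tangent vectors\<close>

text \<open>
  A tangent vector at \<open>p\<close> is the directional derivative operator it induces on functions that are
  smooth near \<open>p\<close>; on all other functions the operator is set to 0, so that equal vectors are equal
  as HOL functions.
\<close>

type_synonym 'm tangent = "('m \<Rightarrow> real) \<Rightarrow> real"

text \<open>The vector at \<open>p\<close> with components \<open>x\<close> in the chart \<open>c\<close>.\<close>

definition tangent_vec ::
    "('m::topological_space, 'e::euclidean_space) chart set \<Rightarrow> ('m, 'e) chart \<Rightarrow> 'm \<Rightarrow> 'e \<Rightarrow> 'm tangent"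
  where
  "tangent_vec A c p x =
     (\<lambda>f. if smooth_near A p f then frechet_derivative (f \<circ> chart_inv c) (at (snd c p)) x else 0)"

definition tangent_space ::
    "('m::topological_space, 'e::euclidean_space) chart set \<Rightarrow> 'm \<Rightarrow> 'm tangent set" where
  "tangent_space A p = {tangent_vec A c p x | c x. c \<in> A \<and> p \<in> fst c}"

definition velocity ::
    "('m::topological_space, 'e::euclidean_space) chart set \<Rightarrow> (real \<Rightarrow> 'm) \<Rightarrow> real \<Rightarrow> 'm tangent" where
  "velocity A \<gamma> t =
     (\<lambda>f. if smooth_near A (\<gamma> t) f then vector_derivative (f \<circ> \<gamma>) (at t) else 0)"

text \<open>The differential of \<open>F\<close> at \<open>p\<close>; \<open>B\<close> is the atlas of the target.\<close>

definition differential ::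
    "('n::topological_space, 'f::euclidean_space) chart set \<Rightarrow> ('m \<Rightarrow> 'n) \<Rightarrow> 'm \<Rightarrow> 'm tangent \<Rightarrow> 'n tangent"
  where
  "differential B F p X = (\<lambda>h. if smooth_near B (F p) h then X (h \<circ> F) else 0)"

definition immersion ::
    "('m::topological_space, 'e::euclidean_space) chart set \<Rightarrow>
     ('n::topological_space, 'f::euclidean_space) chart set \<Rightarrow> ('m \<Rightarrow> 'n) \<Rightarrow> bool" where
  "immersion A B F \<longleftrightarrow>
     smooth_map A B F \<and> (\<forall>p. inj_on (differential B F p) (tangent_space A p))"


section \<open>Metrics\<close>

type_synonym 'm metric_tensor = "'m \<Rightarrow> 'm tangent \<Rightarrow> 'm tangent \<Rightarrow> real"

definition metric_in_chart ::
    "('m::topological_space, 'e::euclidean_space) chart set \<Rightarrow> 'm metric_tensor \<Rightarrow> ('m, 'e) chart \<Rightarrow>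
     'e \<Rightarrow> 'e \<Rightarrow> 'e \<Rightarrow> real" where
  "metric_in_chart A g c y v w =
     (let p = chart_inv c y in g p (tangent_vec A c p v) (tangent_vec A c p w))"

definition riemannian_metric ::
    "('m::topological_space, 'e::euclidean_space) chart set \<Rightarrow> 'm metric_tensor \<Rightarrow> bool" where
  "riemannian_metric A g \<longleftrightarrow>
     (\<forall>c\<in>A.
        (\<forall>v w. smooth_on (chart_image c) (\<lambda>y. metric_in_chart A g c y v w)) \<and>
        (\<forall>y\<in>chart_image c.
           bilinear (metric_in_chart A g c y) \<and>
           (\<forall>v w. metric_in_chart A g c y v w = metric_in_chart A g c y w v) \<and>
           (\<forall>v. v \<noteq> 0 \<longrightarrow> 0 < metric_in_chart A g c y v v)))"

definition riemannian_manifold ::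
    "('m::topological_space, 'e::euclidean_space) chart set \<Rightarrow> 'm metric_tensor \<Rightarrow> bool" where
  "riemannian_manifold A g \<longleftrightarrow> smooth_atlas A \<and> riemannian_metric A g"

definition pullback_metric ::
    "('n::topological_space, 'f::euclidean_space) chart set \<Rightarrow> 'n metric_tensor \<Rightarrow> ('m \<Rightarrow> 'n) \<Rightarrow>
     'm metric_tensor" where
  "pullback_metric B g F p X Y = g (F p) (differential B F p X) (differential B F p Y)"

definition C1_curve_on ::
    "('m::topological_space, 'e::euclidean_space) chart set \<Rightarrow> (real \<Rightarrow> 'm) \<Rightarrow> real \<Rightarrow> real \<Rightarrow> bool" where
  "C1_curve_on A \<gamma> a b \<longleftrightarrow> continuous_on {a..b} \<gamma> \<and>
     (\<forall>c\<in>A. \<exists>D. continuous_on ({a..b} \<inter> \<gamma> -` fst c) D \<and>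
        (\<forall>t\<in>{a..b} \<inter> \<gamma> -` fst c.
           ((snd c \<circ> \<gamma>) has_vector_derivative D t) (at t within {a..b})))"

definition piecewise_C1_curve ::
    "('m::topological_space, 'e::euclidean_space) chart set \<Rightarrow> (real \<Rightarrow> 'm) \<Rightarrow> bool" where
  "piecewise_C1_curve A \<gamma> \<longleftrightarrow>
     (\<exists>(n::nat) \<tau>. \<tau> 0 = 0 \<and> \<tau> n = 1 \<and>
        (\<forall>i<n. \<tau> i < \<tau> (Suc i) \<and> C1_curve_on A \<gamma> (\<tau> i) (\<tau> (Suc i))))"

text \<open>The integrand is arbitrary at the finitely many break points of the curve.\<close>

definition curve_length ::
    "('m::topological_space, 'e::euclidean_space) chart set \<Rightarrow> 'm metric_tensor \<Rightarrow> (real \<Rightarrow> 'm) \<Rightarrow> real"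
  where
  "curve_length A g \<gamma> =
     integral {0..1} (\<lambda>t. sqrt (g (\<gamma> t) (velocity A \<gamma> t) (velocity A \<gamma> t)))"

definition riemannian_dist ::
    "('m::topological_space, 'e::euclidean_space) chart set \<Rightarrow> 'm metric_tensor \<Rightarrow> 'm \<Rightarrow> 'm \<Rightarrow> real" where
  "riemannian_dist A g p q =
     Inf {curve_length A g \<gamma> | \<gamma>. piecewise_C1_curve A \<gamma> \<and> pathstart \<gamma> = p \<and> pathfinish \<gamma> = q}"

text \<open>Only used for connected manifolds, on which the infimum above is over a nonempty set.\<close>

definition complete_metric ::
    "('m::topological_space, 'e::euclidean_space) chart set \<Rightarrow> 'm metric_tensor \<Rightarrow> bool" where
  "complete_metric A g \<longleftrightarrow> Metric_space.mcomplete UNIV (riemannian_dist A g)"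


section \<open>Levi-Civita connection and Laplacian\<close>

text \<open>
  In this section and the next \<open>G\<close> is a metric in a chart, a field of nondegenerate symmetric
  bilinear forms on an open subset of the model space. A connection is given there by
  \<open>\<nabla>\<^sub>X Y = DY(X) + \<Gamma>(X, Y)\<close> with \<open>\<Gamma>\<close> bilinear at every point; \<open>\<Gamma>\<close> is symmetric iff the connection
  is torsion free, and the last clause below is compatibility with the metric.
\<close>

definition levi_civita ::
    "('e::euclidean_space \<Rightarrow> 'e \<Rightarrow> 'e \<Rightarrow> real) \<Rightarrow> 'e \<Rightarrow> 'e \<Rightarrow> 'e \<Rightarrow> 'e" where
  "levi_civita G y = (THE \<Gamma>. bilinear \<Gamma> \<and> (\<forall>v w. \<Gamma> v w = \<Gamma> w v) \<and>
     (\<forall>x v w. frechet_derivative (\<lambda>z. G z v w) (at y) x = G y (\<Gamma> x v) w + G y v (\<Gamma> x w)))"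

definition covariant_deriv ::
    "('e::euclidean_space \<Rightarrow> 'e \<Rightarrow> 'e \<Rightarrow> real) \<Rightarrow> ('e \<Rightarrow> 'e) \<Rightarrow> ('e \<Rightarrow> 'e) \<Rightarrow> 'e \<Rightarrow> 'e" where
  "covariant_deriv G X Y y = frechet_derivative Y (at y) (X y) + levi_civita G y (X y) (Y y)"

definition gradient ::
    "('e::euclidean_space \<Rightarrow> 'e \<Rightarrow> 'e \<Rightarrow> real) \<Rightarrow> ('e \<Rightarrow> real) \<Rightarrow> 'e \<Rightarrow> 'e" where
  "gradient G f y = (THE z. \<forall>w. G y z w = frechet_derivative f (at y) w)"

text \<open>The trace of the endomorphism \<open>v \<mapsto> \<nabla>\<^sub>v X\<close>.\<close>

definition divergence ::
    "('e::euclidean_space \<Rightarrow> 'e \<Rightarrow> 'e \<Rightarrow> real) \<Rightarrow> ('e \<Rightarrow> 'e) \<Rightarrow> 'e \<Rightarrow> real" where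
  "divergence G X y = (\<Sum>b\<in>Basis. covariant_deriv G (\<lambda>_. b) X y \<bullet> b)"

text \<open>The value does not depend on the chart chosen around \<open>p\<close>.\<close>

definition laplacian ::
    "('m::topological_space, 'e::euclidean_space) chart set \<Rightarrow> 'm metric_tensor \<Rightarrow> ('m \<Rightarrow> real) \<Rightarrow> 'm \<Rightarrow> real"
  where
  "laplacian A g f p =
     (let c = chart_at A p; G = metric_in_chart A g c
      in divergence G (gradient G (f \<circ> chart_inv c)) (snd c p))"

definition superharmonic ::
    "('m::topological_space, 'e::euclidean_space) chart set \<Rightarrow> 'm metric_tensor \<Rightarrow> ('m \<Rightarrow> real) \<Rightarrow> bool"
  where
  "superharmonic A g f \<longleftrightarrow> smooth_scalar_on A UNIV f \<and> (\<forall>p. laplacian A g f p \<le> 0)"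

text \<open>
  Compact manifolds are included (they satisfy the condition trivially): a noncompact parabolic
  submanifold may cover a compact wavefront, as \<open>\<real>\<^sup>2\<close> covers the flat torus.
\<close>

definition parabolic ::
    "('m::topological_space, 'e::euclidean_space) chart set \<Rightarrow> 'm metric_tensor \<Rightarrow> bool" where
  "parabolic A g \<longleftrightarrow> complete_metric A g \<and>
     (\<forall>f. superharmonic A g f \<and> bdd_below (range f) \<longrightarrow> f constant_on UNIV)"


section \<open>Spacelike submanifolds\<close>

text \<open>
  Here \<open>\<Psi>\<close> is an immersion, \<open>G\<close> the metric in its source and \<open>G'\<close> the metric in its target, all in
  charts. The derivative of a vector field \<open>V\<close> along \<open>\<Psi>\<close>:
\<close>

definition covariant_deriv_along ::
    "('n::euclidean_space \<Rightarrow> 'n \<Rightarrow> 'n \<Rightarrow> real) \<Rightarrow> ('e::euclidean_space \<Rightarrow> 'n) \<Rightarrow>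
     ('e \<Rightarrow> 'e) \<Rightarrow> ('e \<Rightarrow> 'n) \<Rightarrow> 'e \<Rightarrow> 'n" where
  "covariant_deriv_along G' \<Psi> X V y = frechet_derivative V (at y) (X y) +
     levi_civita G' (\<Psi> y) (frechet_derivative \<Psi> (at y) (X y)) (V y)"

text \<open>Gauss formula, with tangent fields of the source identified with their images.\<close>

definition second_fundamental_form ::
    "('e::euclidean_space \<Rightarrow> 'e \<Rightarrow> 'e \<Rightarrow> real) \<Rightarrow> ('n::euclidean_space \<Rightarrow> 'n \<Rightarrow> 'n \<Rightarrow> real) \<Rightarrow>
     ('e \<Rightarrow> 'n) \<Rightarrow> ('e \<Rightarrow> 'e) \<Rightarrow> ('e \<Rightarrow> 'e) \<Rightarrow> 'e \<Rightarrow> 'n" where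
  "second_fundamental_form G G' \<Psi> X Y y =
     covariant_deriv_along G' \<Psi> X (\<lambda>z. frechet_derivative \<Psi> (at z) (Y z)) y
     - frechet_derivative \<Psi> (at y) (covariant_deriv G X Y y)"

definition orthonormal_frame :: "('e::euclidean_space \<Rightarrow> 'e \<Rightarrow> real) \<Rightarrow> 'e set \<Rightarrow> bool" where
  "orthonormal_frame B E \<longleftrightarrow> card E = DIM('e) \<and>
     (\<forall>e\<in>E. \<forall>e'\<in>E. B e e' = (if e = e' then 1 else 0))"

text \<open>For positive definite \<open>B\<close> and bilinear \<open>T\<close> the sum does not depend on the frame.\<close>

definition metric_trace ::
    "('e::euclidean_space \<Rightarrow> 'e \<Rightarrow> real) \<Rightarrow> ('e \<Rightarrow> 'e \<Rightarrow> 'n::real_vector) \<Rightarrow> 'n" where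
  "metric_trace B T = (\<Sum>e\<in>(SOME E. orthonormal_frame B E). T e e)"

text \<open>
  The second fundamental form is tensorial, so its value on two vectors is computed by extending
  them constantly in the chart. The result does not depend on the charts chosen.
\<close>

definition mean_curvature ::
    "('s::topological_space, 'f::euclidean_space) chart set \<Rightarrow>
     ('n::topological_space, 'g::euclidean_space) chart set \<Rightarrow> 'n metric_tensor \<Rightarrow> ('s \<Rightarrow> 'n) \<Rightarrow>
     's \<Rightarrow> 'n tangent" where
  "mean_curvature S B g \<psi> p =
     (let c = chart_at S p; d = chart_at B (\<psi> p);
          G = metric_in_chart S (pullback_metric B g \<psi>) c; G' = metric_in_chart B g d;
          \<Psi> = snd d \<circ> \<psi> \<circ> chart_inv c; y = snd c p
      in tangent_vec B d (\<psi> p)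
           ((1 / real DIM('f)) *\<^sub>R
             metric_trace (G y) (\<lambda>v w. second_fundamental_form G G' \<Psi> (\<lambda>_. v) (\<lambda>_. w) y)))"

definition spacelike_submanifold ::
    "('s::topological_space, 'f::euclidean_space) chart set \<Rightarrow>
     ('n::topological_space, 'g::euclidean_space) chart set \<Rightarrow> 'n metric_tensor \<Rightarrow> ('s \<Rightarrow> 'n) \<Rightarrow> bool"
  where
  "spacelike_submanifold S B g \<psi> \<longleftrightarrow> smooth_atlas S \<and> connected (UNIV :: 's set) \<and>
     immersion S B \<psi> \<and> riemannian_metric S (pullback_metric B g \<psi>)"

definition parabolic_spacelike_submanifold ::
    "('s::topological_space, 'f::euclidean_space) chart set \<Rightarrow>
     ('n::topological_space, 'g::euclidean_space) chart set \<Rightarrow> 'n metric_tensor \<Rightarrow> ('s \<Rightarrow> 'n) \<Rightarrow> bool"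
  where
  "parabolic_spacelike_submanifold S B g \<psi> \<longleftrightarrow>
     spacelike_submanifold S B g \<psi> \<and> parabolic S (pullback_metric B g \<psi>)"


section \<open>Plane fronted waves\<close>

text \<open>Points of \<open>\<real>\<^sup>2 \<times> M\<close> are written \<open>((u, v), x)\<close>.\<close>

type_synonym 'm pfw = "(real \<times> real) \<times> 'm"

definition coord_u :: "'m pfw \<Rightarrow> real" where "coord_u p = fst (fst p)"

definition coord_v :: "'m pfw \<Rightarrow> real" where "coord_v p = snd (fst p)"

definition pfw_atlas :: "('m, 'e) chart set \<Rightarrow> ('m pfw, (real \<times> real) \<times> 'e) chart set" where
  "pfw_atlas A = prod_atlas euclidean_atlas A"

text \<open>Since tangent vectors act on functions, \<open>du(X) = X u\<close> and \<open>dv(X) = X v\<close>.\<close>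

definition pfw_metric ::
    "('m::topological_space, 'e::euclidean_space) chart set \<Rightarrow> 'm metric_tensor \<Rightarrow>
     (real \<Rightarrow> 'm \<Rightarrow> real) \<Rightarrow> 'm pfw metric_tensor" where
  "pfw_metric A g H p X Y =
     H (coord_u p) (snd p) * X coord_u * Y coord_u + X coord_u * Y coord_v + X coord_v * Y coord_u
     + pullback_metric A g snd p X Y"

definition plane_fronted_wave ::
    "('m::topological_space, 'e::euclidean_space) chart set \<Rightarrow> 'm metric_tensor \<Rightarrow>
     (real \<Rightarrow> 'm \<Rightarrow> real) \<Rightarrow> bool" where
  "plane_fronted_wave A g H \<longleftrightarrow> riemannian_manifold A g \<and> connected (UNIV :: 'm set) \<and>
     smooth_scalar_on (pfw_atlas A) UNIV (\<lambda>p. H (coord_u p) (snd p))"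

definition partial_v ::
    "('m::topological_space, 'e::euclidean_space) chart set \<Rightarrow> 'm pfw \<Rightarrow> 'm pfw tangent" where
  "partial_v A p = velocity (pfw_atlas A) (\<lambda>t. ((coord_u p, t), snd p)) (coord_v p)"

text \<open>The submanifold \<open>u = u0\<close>, \<open>v = v0\<close>, given by its inclusion.\<close>

definition wavefront :: "real \<Rightarrow> real \<Rightarrow> 'm \<Rightarrow> 'm pfw" where
  "wavefront u0 v0 x = ((u0, v0), x)"

end

theory Submission
  imports Defs
begin

text \<open>
  The field \<open>\<partial>\<^sub>v\<close> is parallel and \<open>du = \<langle>\<cdot>, \<partial>\<^sub>v\<rangle>\<close>. Taking the product of the Gauss formula of a spacelike
  submanifold with \<open>\<partial>\<^sub>v\<close> therefore shows that the Hessian of \<open>\<mu> = u \<circ> \<psi>\<close> is \<open>\<langle>II, \<partial>\<^sub>v\<rangle>\<close>, and its trace is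
  \<open>\<Delta>\<mu> = k \<langle>H, \<partial>\<^sub>v\<rangle>\<close> with \<open>H\<close> the mean curvature vector
  (\<open>levi_civita_pfw_u\<close>, \<open>laplacian_u_eq_mean_curvature\<close>). The sign condition makes \<open>\<mu>\<close> or \<open>-\<mu>\<close> a
  superharmonic function bounded from below, so parabolicity forces \<open>\<mu>\<close> to be constant.

  Where \<open>\<mu>\<close> is constant, the terms of the ambient metric that contain \<open>du\<close> vanish on the submanifold,
  whose metric is then the pullback of \<open>g\<close> by its projection \<open>\<pi>\<close> to \<open>M\<close>, that is, of the metric of a
  wavefront. In equal dimensions \<open>\<pi>\<close> is a local isometry (\<open>projection_local_isometry\<close>), and it remains
  to see that parabolicity descends along a local isometry \<open>\<pi>\<close> (\<open>parabolic_target\<close>). A superharmonic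
  function on \<open>M\<close> bounded from below pulls back to one on the submanifold, since Laplacians commute with
  local isometries (\<open>laplacian_image\<close>); there it is constant, so it is constant on the image of \<open>\<pi>\<close>.
  Surjectivity of \<open>\<pi>\<close> and completeness of \<open>M\<close> both follow from the lifting of curves: every piecewise
  \<open>C\<^sup>1\<close> curve of \<open>M\<close> starting at \<open>\<pi>(p)\<close> ends at some \<open>\<pi>(q)\<close> with \<open>d(p, q)\<close> at most its length
  (\<open>lift_segment\<close>, \<open>lift_chain\<close>). The inverse function theorem lifts short pieces, and completeness of
  the source prevents the process from stopping early. Consequently curves of \<open>M\<close> joining two points
  lift, which gives surjectivity because \<open>M\<close> is connected, and rapidly converging sequences of \<open>M\<close> lift
  to Cauchy sequences, which gives completeness (\<open>complete_target\<close>).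
\<close>

section \<open>Calculus of smooth maps\<close>

lemma Ck_on_cong:
  assumes "open S" "Ck_on k S f" "\<And>x. x \<in> S \<Longrightarrow> f x = g x"
  shows "Ck_on k S g"
  using assms
proof (induction k arbitrary: f g)
  case 0
  then show ?case using continuous_on_cong[of S S f g] by simp
next
  case (Suc k)
  have d: "(g has_derivative frechet_derivative f (at x)) (at x)" if x: "x \<in> S" for x
  proof (rule has_derivative_transform_within_open[OF _ Suc.prems(1) x Suc.prems(3)])
    show "(f has_derivative frechet_derivative f (at x)) (at x)"
      using Suc.prems(2) x by (simp add: frechet_derivative_works)
  qed
  have "Ck_on k S (\<lambda>x. frechet_derivative g (at x) v)" for v
  proof (rule Suc.IH[OF Suc.prems(1)])
    show "Ck_on k S (\<lambda>x. frechet_derivative f (at x) v)" using Suc.prems(2) by simp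
    show "frechet_derivative f (at x) v = frechet_derivative g (at x) v" if "x \<in> S" for x
      using frechet_derivative_at[OF d[OF that]] by simp
  qed
  then show ?case using d unfolding Ck_on.simps differentiable_def by blast
qed

lemma Ck_on_subset: "Ck_on k T f \<Longrightarrow> S \<subseteq> T \<Longrightarrow> Ck_on k S f"
  by (induction k arbitrary: f) (auto intro: continuous_on_subset)

lemma Ck_on_local:
  assumes "\<And>x. x \<in> S \<Longrightarrow> \<exists>T. open T \<and> x \<in> T \<and> Ck_on k T f"
  shows "Ck_on k S f"
  using assms
proof (induction k arbitrary: f)
  case 0
  have "isCont f x" if "x \<in> S" for x
    using 0 that continuous_on_eq_continuous_at unfolding Ck_on.simps by blast
  then show ?case by (simp add: continuous_at_imp_continuous_on)
next
  case (Suc k)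
  show ?case
    unfolding Ck_on.simps
  proof (intro conjI ballI allI)
    fix x assume "x \<in> S"
    then show "f differentiable (at x)" using Suc.prems by fastforce
  next
    fix v
    show "Ck_on k S (\<lambda>x. frechet_derivative f (at x) v)"
      using Suc.prems by (intro Suc.IH) fastforce
  qed
qed

lemma Ck_on_Suc_imp: "Ck_on (Suc k) S f \<Longrightarrow> Ck_on k S f"
proof (induction k arbitrary: f)
  case 0
  then show ?case
    by (auto intro!: continuous_at_imp_continuous_on differentiable_imp_continuous_within)
next
  case (Suc k)
  from Suc.prems have "\<And>v. Ck_on (Suc k) S (\<lambda>x. frechet_derivative f (at x) v)" by simp
  then have "\<And>v. Ck_on k S (\<lambda>x. frechet_derivative f (at x) v)" by (rule Suc.IH)
  with Suc.prems show ?case by simp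
qed

lemma Ck_on_const: "Ck_on k S (\<lambda>x. c)"
  by (induction k arbitrary: c) auto

lemma Ck_on_bounded_linear:
  assumes "bounded_linear L" "open S" "Ck_on k S f"
  shows "Ck_on k S (\<lambda>x. L (f x))"
  using assms(3)
proof (induction k arbitrary: f)
  case 0
  then show ?case using assms(1) by (simp add: bounded_linear.continuous_on)
next
  case (Suc k)
  have d: "((\<lambda>x. L (f x)) has_derivative (\<lambda>v. L (frechet_derivative f (at x) v))) (at x)" if "x \<in> S" for x
    using Suc.prems that
    by (intro bounded_linear.has_derivative[OF assms(1)]) (auto simp: frechet_derivative_works)
  have "Ck_on k S (\<lambda>x. L (frechet_derivative f (at x) v))" for v
    by (rule Suc.IH) (use Suc.prems in simp_all)
  then have "Ck_on k S (\<lambda>x. frechet_derivative (\<lambda>x. L (f x)) (at x) v)" for v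
    by (rule Ck_on_cong[OF assms(2)]) (simp add: frechet_derivative_at[OF d, symmetric])
  then show ?case using d unfolding Ck_on.simps differentiable_def by blast
qed

lemma Ck_on_add:
  assumes "open S" "Ck_on k S f" "Ck_on k S g"
  shows "Ck_on k S (\<lambda>x. f x + g x)"
  using assms(2,3)
proof (induction k arbitrary: f g)
  case 0
  then show ?case by (simp add: continuous_on_add)
next
  case (Suc k)
  have d: "((\<lambda>x. f x + g x) has_derivative
      (\<lambda>v. frechet_derivative f (at x) v + frechet_derivative g (at x) v)) (at x)" if "x \<in> S" for x
    using Suc.prems that
    by (intro has_derivative_add) (auto simp: frechet_derivative_works)
  have "Ck_on k S (\<lambda>x. frechet_derivative f (at x) v + frechet_derivative g (at x) v)" for v
    by (rule Suc.IH) (use Suc.prems in simp_all)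
  then have "Ck_on k S (\<lambda>x. frechet_derivative (\<lambda>x. f x + g x) (at x) v)" for v
    by (rule Ck_on_cong[OF assms(1)]) (simp add: frechet_derivative_at[OF d, symmetric])
  then show ?case using d unfolding Ck_on.simps differentiable_def by blast
qed

lemma Ck_on_sum:
  assumes "open S" "finite I" "\<And>i. i \<in> I \<Longrightarrow> Ck_on k S (f i)"
  shows "Ck_on k S (\<lambda>x. \<Sum>i\<in>I. f i x)"
  using assms(2,3)
proof (induction I rule: finite_induct)
  case empty
  then show ?case by (simp add: Ck_on_const)
next
  case (insert i I)
  have "Ck_on k S (\<lambda>x. f i x + (\<Sum>i\<in>I. f i x))"
    by (rule Ck_on_add[OF assms(1)]) (use insert in simp_all)
  with insert show ?case by simp
qed

lemma Ck_on_bilinear: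
  assumes "bounded_bilinear pr" "open S" "Ck_on k S f" "Ck_on k S g"
  shows "Ck_on k S (\<lambda>x. pr (f x) (g x))"
  using assms(3,4)
proof (induction k arbitrary: f g)
  case 0
  then show ?case using assms(1) by (simp add: bounded_bilinear.continuous_on)
next
  case (Suc k)
  have d: "((\<lambda>x. pr (f x) (g x)) has_derivative
      (\<lambda>v. pr (f x) (frechet_derivative g (at x) v) + pr (frechet_derivative f (at x) v) (g x))) (at x)"
    if "x \<in> S" for x
    using Suc.prems that
    by (intro bounded_bilinear.FDERIV[OF assms(1)]) (auto simp: frechet_derivative_works)
  have fg: "Ck_on k S f" "Ck_on k S g" using Suc.prems Ck_on_Suc_imp by blast+
  have "Ck_on k S (\<lambda>x. pr (f x) (frechet_derivative g (at x) v) + pr (frechet_derivative f (at x) v) (g x))" for v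
    by (rule Ck_on_add[OF assms(2)]; rule Suc.IH) (use Suc.prems fg in simp_all)
  then have "Ck_on k S (\<lambda>x. frechet_derivative (\<lambda>x. pr (f x) (g x)) (at x) v)" for v
    by (rule Ck_on_cong[OF assms(2)]) (simp add: frechet_derivative_at[OF d, symmetric])
  then show ?case using d unfolding Ck_on.simps differentiable_def by blast
qed

lemma linear_basis_expansion:
  fixes L :: "'a::euclidean_space \<Rightarrow> 'b::real_vector"
  assumes "linear L"
  shows "L v = (\<Sum>b\<in>Basis. (v \<bullet> b) *\<^sub>R L b)"
proof -
  have "L v = L (\<Sum>b\<in>Basis. (v \<bullet> b) *\<^sub>R b)" by (simp add: euclidean_representation)
  also have "\<dots> = (\<Sum>b\<in>Basis. (v \<bullet> b) *\<^sub>R L b)"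
    using assms by (simp add: linear_sum linear_cmul)
  finally show ?thesis .
qed

text \<open>
  The chain rule expresses a derivative of \<open>g \<circ> f\<close> by the partial derivatives of \<open>g\<close> along a basis.
  Their composites with \<open>f\<close> fall under the induction hypothesis.
\<close>

lemma Ck_on_compose:
  fixes f :: "'a::euclidean_space \<Rightarrow> 'b::euclidean_space"
  assumes "open S" "Ck_on k S f" "Ck_on k T g" "f ` S \<subseteq> T"
  shows "Ck_on k S (\<lambda>x. g (f x))"
  using assms(2,3)
proof (induction k arbitrary: g)
  case 0
  then show ?case using assms(4) by (auto intro: continuous_on_compose2)
next
  case (Suc k)
  have lin: "linear (frechet_derivative g (at (f x)))" if "x \<in> S" for x
    using Suc.prems that assms(4) by (intro linear_frechet_derivative) auto
  have d: "((\<lambda>x. g (f x)) has_derivative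
      (\<lambda>v. frechet_derivative g (at (f x)) (frechet_derivative f (at x) v))) (at x)" if "x \<in> S" for x
    using Suc.prems that assms(4)
    by (intro has_derivative_compose[where f = f and g = g]) (auto simp: frechet_derivative_works)
  have f: "Ck_on k S f" using Suc.prems Ck_on_Suc_imp by blast
  have "Ck_on k S (\<lambda>x. \<Sum>b\<in>Basis. (frechet_derivative f (at x) v \<bullet> b) *\<^sub>R frechet_derivative g (at (f x)) b)" for v
  proof (rule Ck_on_sum[OF assms(1) finite_Basis], rule Ck_on_bilinear[OF bounded_bilinear_scaleR assms(1)])
    fix b :: 'b
    have "Ck_on k S (\<lambda>x. frechet_derivative f (at x) v)" using Suc.prems(1) by simp
    then show "Ck_on k S (\<lambda>x. frechet_derivative f (at x) v \<bullet> b)"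
      by (rule Ck_on_bounded_linear[OF bounded_linear_inner_left assms(1)])
    have "Ck_on k T (\<lambda>x. frechet_derivative g (at x) b)" using Suc.prems(2) by simp
    then show "Ck_on k S (\<lambda>x. frechet_derivative g (at (f x)) b)"
      by (rule Suc.IH[OF f])
  qed
  then have "Ck_on k S (\<lambda>x. frechet_derivative (\<lambda>x. g (f x)) (at x) v)" for v
  proof (rule Ck_on_cong[OF assms(1)])
    fix x assume x: "x \<in> S"
    show "(\<Sum>b\<in>Basis. (frechet_derivative f (at x) v \<bullet> b) *\<^sub>R frechet_derivative g (at (f x)) b)
        = frechet_derivative (\<lambda>x. g (f x)) (at x) v"
      using frechet_derivative_at[OF d[OF x]]
        linear_basis_expansion[OF lin[OF x], of "frechet_derivative f (at x) v"] by metis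
  qed
  then show ?case using d unfolding Ck_on.simps differentiable_def by blast
qed

lemma smooth_on_cong:
  "open S \<Longrightarrow> smooth_on S f \<Longrightarrow> (\<And>x. x \<in> S \<Longrightarrow> f x = g x) \<Longrightarrow> smooth_on S g"
  unfolding smooth_on_def using Ck_on_cong by blast

lemma smooth_on_subset: "smooth_on T f \<Longrightarrow> S \<subseteq> T \<Longrightarrow> smooth_on S f"
  unfolding smooth_on_def using Ck_on_subset by blast

lemma smooth_on_local:
  assumes "\<And>x. x \<in> S \<Longrightarrow> \<exists>T. open T \<and> x \<in> T \<and> smooth_on T f"
  shows "smooth_on S f"
  unfolding smooth_on_def
proof
  fix k show "Ck_on k S f"
    by (rule Ck_on_local) (use assms in \<open>auto simp: smooth_on_def\<close>)
qed

lemma smooth_on_const: "smooth_on S (\<lambda>x. c)"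
  by (simp add: smooth_on_def Ck_on_const)

lemma smooth_on_bounded_linear:
  "bounded_linear L \<Longrightarrow> open S \<Longrightarrow> smooth_on S f \<Longrightarrow> smooth_on S (\<lambda>x. L (f x))"
  by (simp add: smooth_on_def Ck_on_bounded_linear)

lemma smooth_on_add:
  "open S \<Longrightarrow> smooth_on S f \<Longrightarrow> smooth_on S g \<Longrightarrow> smooth_on S (\<lambda>x. f x + g x)"
  by (simp add: smooth_on_def Ck_on_add)

lemma smooth_on_compose:
  fixes f :: "'a::euclidean_space \<Rightarrow> 'b::euclidean_space"
  shows "open S \<Longrightarrow> smooth_on S f \<Longrightarrow> smooth_on T g \<Longrightarrow> f ` S \<subseteq> T \<Longrightarrow> smooth_on S (\<lambda>x. g (f x))"
  unfolding smooth_on_def using Ck_on_compose by blast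

lemma smooth_on_differentiable: "smooth_on S f \<Longrightarrow> x \<in> S \<Longrightarrow> f differentiable (at x)"
  unfolding smooth_on_def by (metis Ck_on.simps(2))

lemma smooth_on_has_derivative:
  "smooth_on S f \<Longrightarrow> x \<in> S \<Longrightarrow> (f has_derivative frechet_derivative f (at x)) (at x)"
  using smooth_on_differentiable frechet_derivative_works by blast

lemma smooth_on_frechet: "smooth_on S f \<Longrightarrow> smooth_on S (\<lambda>x. frechet_derivative f (at x) v)"
  unfolding smooth_on_def by (metis Ck_on.simps(2))

lemma smooth_on_continuous_on: "smooth_on S f \<Longrightarrow> continuous_on S f"
  unfolding smooth_on_def by (metis Ck_on.simps(1))

lemma smooth_on_id: "smooth_on S (\<lambda>x. x)"
proof -
  have "Ck_on k S (\<lambda>x. x)" for k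
    by (cases k) (auto intro: Ck_on_const simp: frechet_derivative_ident)
  then show ?thesis by (simp add: smooth_on_def)
qed

text \<open>
  The second difference is the increment over \<open>[0, 1]\<close> of \<open>t \<mapsto> f (y + tsv + sw) - f (y + tsv)\<close>. By the
  mean value theorem it equals \<open>s\<close> times an increment of the derivative of \<open>f\<close> along \<open>v\<close>, to which
  differentiability at \<open>y\<close> applies. The left-hand side is symmetric in \<open>v\<close> and \<open>w\<close>, which yields the
  symmetry of second derivatives.
\<close>

lemma second_difference_tendsto:
  fixes f :: "'a::real_normed_vector \<Rightarrow> real"
  assumes S: "open S" "y \<in> S" and df: "\<And>x. x \<in> S \<Longrightarrow> f differentiable (at x)"
    and d2: "(\<lambda>z. frechet_derivative f (at z) v) differentiable (at y)"
  shows "((\<lambda>s. (f (y + s *\<^sub>R v + s *\<^sub>R w) - f (y + s *\<^sub>R v) - f (y + s *\<^sub>R w) + f y) / s\<^sup>2)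
      \<longlongrightarrow> frechet_derivative (\<lambda>z. frechet_derivative f (at z) v) (at y) w) (at_right 0)"
proof (rule tendstoI)
  define g where "g = (\<lambda>z. frechet_derivative f (at z) v)"
  define g' where "g' = frechet_derivative g (at y)"
  have g: "(g has_derivative g') (at y)"
    using d2 unfolding g_def g'_def by (simp add: frechet_derivative_works)
  then have lin: "linear g'" by (simp add: has_derivative_linear)
  fix e :: real assume "e > 0"
  \<comment> \<open>for \<open>0 \<le> t \<le> 1\<close> both points \<open>tsv + sw\<close> and \<open>tsv\<close> have norm at most \<open>sN\<close>\<close>
  define N where "N = 2 * norm v + norm w + 1"
  have N: "N > 0" "norm v + norm w < N" "norm v < N"
    using norm_ge_zero[of v] norm_ge_zero[of w] unfolding N_def by linarith+
  define e' where "e' = e / (4 * N)"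
  have e': "e' > 0" "2 * (e' * N) = e / 2" using \<open>e > 0\<close> N by (auto simp: e'_def)
  obtain d where d: "d > 0" "\<And>h. norm h < d \<Longrightarrow> \<bar>g (y + h) - g y - g' h\<bar> \<le> e' * norm h"
  proof -
    from g e' obtain d where d: "d > 0" "\<And>z. norm (z - y) < d \<Longrightarrow> norm (g z - g y - g' (z - y)) \<le> e' * norm (z - y)"
      unfolding has_derivative_at_alt by blast
    have "\<bar>g (y + h) - g y - g' h\<bar> \<le> e' * norm h" if "norm h < d" for h
      using d(2)[of "y + h"] that by simp
    with d(1) show ?thesis using that by blast
  qed
  obtain r where r: "r > 0" "ball y r \<subseteq> S" using S openE by blast
  define s0 where "s0 = min d r / N"
  have s0: "s0 > 0" using d r N by (simp add: s0_def)
  have main: "dist ((f (y + s *\<^sub>R v + s *\<^sub>R w) - f (y + s *\<^sub>R v) - f (y + s *\<^sub>R w) + f y) / s\<^sup>2) (g' w) < e"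
    if s: "0 < s" "s < s0" for s
  proof -
    have sN: "s * N < min d r" using s N by (simp add: s0_def pos_less_divide_eq)
    have small: "norm ((t * s) *\<^sub>R v + s *\<^sub>R w) \<le> s * N" "norm ((t * s) *\<^sub>R v) \<le> s * N" if "0 \<le> t" "t \<le> 1" for t
    proof -
      have "t * s \<le> s" using that s by (simp add: mult_left_le_one_le)
      then have 1: "norm ((t * s) *\<^sub>R v) \<le> s * norm v"
        using that s by (simp add: mult_right_mono)
      moreover have "norm (s *\<^sub>R w) = s * norm w" using s by simp
      ultimately have "norm ((t * s) *\<^sub>R v + s *\<^sub>R w) \<le> s * (norm v + norm w)"
        using norm_triangle_ineq[of "(t * s) *\<^sub>R v" "s *\<^sub>R w"] unfolding distrib_left by linarith
      moreover have "s * (norm v + norm w) \<le> s * N" "s * norm v \<le> s * N"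
        using s N by (auto intro: mult_left_mono)
      ultimately show "norm ((t * s) *\<^sub>R v + s *\<^sub>R w) \<le> s * N" "norm ((t * s) *\<^sub>R v) \<le> s * N"
        using 1 by linarith+
    qed
    have inS: "y + ((t * s) *\<^sub>R v + s *\<^sub>R w) \<in> S" "y + (t * s) *\<^sub>R v \<in> S" if "0 \<le> t" "t \<le> 1" for t
    proof -
      have "norm ((t * s) *\<^sub>R v + s *\<^sub>R w) < r" "norm ((t * s) *\<^sub>R v) < r"
        using small[OF that] sN by linarith+
      then have "y + ((t * s) *\<^sub>R v + s *\<^sub>R w) \<in> ball y r" "y + (t * s) *\<^sub>R v \<in> ball y r"
        by (simp_all only: mem_ball dist_norm norm_minus_commute[of y] add_diff_cancel_left')
      then show "y + ((t * s) *\<^sub>R v + s *\<^sub>R w) \<in> S" "y + (t * s) *\<^sub>R v \<in> S" using r(2) by blast+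
    qed
    define \<psi> where "\<psi> = (\<lambda>t. f (y + ((t * s) *\<^sub>R v + s *\<^sub>R w)) - f (y + (t * s) *\<^sub>R v))"
    have der: "(\<psi> has_real_derivative s * (g (y + ((t * s) *\<^sub>R v + s *\<^sub>R w)) - g (y + (t * s) *\<^sub>R v))) (at t)"
      if "0 \<le> t" "t \<le> 1" for t
    proof -
      have a: "((\<lambda>t. f (y + ((t * s) *\<^sub>R v + c))) has_derivative (\<lambda>h. (s * g (y + ((t * s) *\<^sub>R v + c))) * h)) (at t)"
        if "y + ((t * s) *\<^sub>R v + c) \<in> S" for c
      proof -
        let ?z = "y + ((t * s) *\<^sub>R v + c)"
        have fd: "(f has_derivative frechet_derivative f (at ?z)) (at ?z)"
          using df that by (simp add: frechet_derivative_works)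
        have "((\<lambda>t. y + ((t * s) *\<^sub>R v + c)) has_derivative (\<lambda>h. (h * s) *\<^sub>R v)) (at t)"
          by (auto intro!: derivative_eq_intros)
        from has_derivative_compose[OF this fd]
        have "((\<lambda>t. f (y + ((t * s) *\<^sub>R v + c))) has_derivative (\<lambda>h. frechet_derivative f (at ?z) ((h * s) *\<^sub>R v))) (at t)" .
        moreover have "frechet_derivative f (at ?z) ((h * s) *\<^sub>R v) = (s * g ?z) * h" for h
          using has_derivative_linear[OF fd] by (simp add: linear_cmul g_def)
        ultimately show ?thesis by simp
      qed
      have "((\<lambda>t. f (y + ((t * s) *\<^sub>R v + s *\<^sub>R w)) - f (y + ((t * s) *\<^sub>R v + 0))) has_derivative
        (\<lambda>h. (s * g (y + ((t * s) *\<^sub>R v + s *\<^sub>R w))) * h - (s * g (y + ((t * s) *\<^sub>R v + 0))) * h)) (at t)"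
        by (rule has_derivative_diff[OF a a]) (use inS[OF that] in simp_all)
      then show ?thesis unfolding \<psi>_def has_field_derivative_def add_0_right
        by (rule has_derivative_eq_rhs) (simp add: fun_eq_iff algebra_simps)
    qed
    obtain t where t: "0 < t" "t < 1"
      "\<psi> 1 - \<psi> 0 = s * (g (y + ((t * s) *\<^sub>R v + s *\<^sub>R w)) - g (y + (t * s) *\<^sub>R v))"
      using MVT2[of 0 1 \<psi> "\<lambda>t. s * (g (y + ((t * s) *\<^sub>R v + s *\<^sub>R w)) - g (y + (t * s) *\<^sub>R v))"] der by auto
    let ?h1 = "(t * s) *\<^sub>R v + s *\<^sub>R w" and ?h2 = "(t * s) *\<^sub>R v"
    have sm: "norm ?h1 \<le> s * N" "norm ?h2 \<le> s * N" using small[of t] t by auto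
    have "\<bar>g (y + ?h1) - g y - g' ?h1\<bar> \<le> e' * norm ?h1" "\<bar>g (y + ?h2) - g y - g' ?h2\<bar> \<le> e' * norm ?h2"
      using d(2)[of ?h1] d(2)[of ?h2] sm sN by linarith+
    moreover have "e' * norm ?h1 \<le> e' * (s * N)" "e' * norm ?h2 \<le> e' * (s * N)"
      using sm e'(1) by (auto intro: mult_left_mono)
    moreover have "g' ?h1 - g' ?h2 = s * g' w"
      using lin by (simp add: linear_add linear_cmul)
    ultimately have "\<bar>(g (y + ?h1) - g (y + ?h2)) - s * g' w\<bar> \<le> 2 * (e' * (s * N))" by linarith
    also have "2 * (e' * (s * N)) = s * (2 * (e' * N))" by (simp add: algebra_simps)
    finally have 1: "\<bar>(g (y + ?h1) - g (y + ?h2)) - s * g' w\<bar> \<le> s * (e / 2)" unfolding e'(2) .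
    have eq: "f (y + s *\<^sub>R v + s *\<^sub>R w) - f (y + s *\<^sub>R v) - f (y + s *\<^sub>R w) + f y = \<psi> 1 - \<psi> 0"
      by (simp add: \<psi>_def add.assoc)
    have "(\<psi> 1 - \<psi> 0) / s\<^sup>2 - g' w = ((g (y + ?h1) - g (y + ?h2)) - s * g' w) / s"
      using s unfolding t(3) by (simp add: power2_eq_square field_simps)
    also have "\<bar>\<dots>\<bar> \<le> e / 2" using 1 s by (simp add: pos_divide_le_eq mult.commute)
    finally show ?thesis using eq \<open>e > 0\<close> by (simp add: dist_real_def)
  qed
  show "\<forall>\<^sub>F s in at_right 0. dist ((f (y + s *\<^sub>R v + s *\<^sub>R w) - f (y + s *\<^sub>R v) - f (y + s *\<^sub>R w) + f y) / s\<^sup>2)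
      (frechet_derivative (\<lambda>z. frechet_derivative f (at z) v) (at y) w) < e"
    using main s0 unfolding g'_def g_def eventually_at_right_field by blast
qed

lemma second_derivative_symmetric_real:
  fixes f :: "'a::real_normed_vector \<Rightarrow> real"
  assumes "open S" "y \<in> S" "\<And>x. x \<in> S \<Longrightarrow> f differentiable (at x)"
    and "\<And>v. (\<lambda>z. frechet_derivative f (at z) v) differentiable (at y)"
  shows "frechet_derivative (\<lambda>z. frechet_derivative f (at z) v) (at y) w =
         frechet_derivative (\<lambda>z. frechet_derivative f (at z) w) (at y) v"
proof (rule tendsto_unique)
  show "\<not> trivial_limit (at_right (0::real))" by simp
  show "((\<lambda>s. (f (y + s *\<^sub>R v + s *\<^sub>R w) - f (y + s *\<^sub>R v) - f (y + s *\<^sub>R w) + f y) / s\<^sup>2)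
      \<longlongrightarrow> frechet_derivative (\<lambda>z. frechet_derivative f (at z) v) (at y) w) (at_right 0)"
    by (rule second_difference_tendsto[OF assms(1-3) assms(4)])
  have "((\<lambda>s. (f (y + s *\<^sub>R w + s *\<^sub>R v) - f (y + s *\<^sub>R w) - f (y + s *\<^sub>R v) + f y) / s\<^sup>2)
      \<longlongrightarrow> frechet_derivative (\<lambda>z. frechet_derivative f (at z) w) (at y) v) (at_right 0)"
    by (rule second_difference_tendsto[OF assms(1-3) assms(4)])
  moreover have "f (y + s *\<^sub>R w + s *\<^sub>R v) - f (y + s *\<^sub>R w) - f (y + s *\<^sub>R v) + f y
     = f (y + s *\<^sub>R v + s *\<^sub>R w) - f (y + s *\<^sub>R v) - f (y + s *\<^sub>R w) + f y" for s
    by (simp add: add.assoc add.commute[of "s *\<^sub>R w"])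
  ultimately show "((\<lambda>s. (f (y + s *\<^sub>R v + s *\<^sub>R w) - f (y + s *\<^sub>R v) - f (y + s *\<^sub>R w) + f y) / s\<^sup>2)
      \<longlongrightarrow> frechet_derivative (\<lambda>z. frechet_derivative f (at z) w) (at y) v) (at_right 0)" by simp
qed

lemma second_derivative_symmetric:
  fixes f :: "'a::real_normed_vector \<Rightarrow> 'b::euclidean_space"
  assumes "open S" "y \<in> S" "\<And>x. x \<in> S \<Longrightarrow> f differentiable (at x)"
    and "\<And>v. (\<lambda>z. frechet_derivative f (at z) v) differentiable (at y)"
  shows "frechet_derivative (\<lambda>z. frechet_derivative f (at z) v) (at y) w =
         frechet_derivative (\<lambda>z. frechet_derivative f (at z) w) (at y) v"
proof (rule euclidean_eqI)
  fix b :: 'b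
  have 1: "((\<lambda>z. f z \<bullet> b) has_derivative (\<lambda>v. frechet_derivative f (at x) v \<bullet> b)) (at x)" if "x \<in> S" for x
    using assms(3)[OF that]
    by (intro has_derivative_inner_left) (simp add: frechet_derivative_works)
  have 2: "frechet_derivative (\<lambda>z. f z \<bullet> b) (at x) v = frechet_derivative f (at x) v \<bullet> b" if "x \<in> S" for x v
    using frechet_derivative_at[OF 1[OF that]] by metis
  have "((\<lambda>z. frechet_derivative f (at z) v \<bullet> b) has_derivative
      (\<lambda>w. frechet_derivative (\<lambda>z. frechet_derivative f (at z) v) (at y) w \<bullet> b)) (at y)" for v
    using assms(4) by (intro has_derivative_inner_left) (simp add: frechet_derivative_works)
  then have 3: "((\<lambda>z. frechet_derivative (\<lambda>z. f z \<bullet> b) (at z) v) has_derivative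
      (\<lambda>w. frechet_derivative (\<lambda>z. frechet_derivative f (at z) v) (at y) w \<bullet> b)) (at y)" for v
    by (rule has_derivative_transform_within_open[OF _ assms(1,2)]) (simp add: 2)
  have "frechet_derivative (\<lambda>z. frechet_derivative (\<lambda>z. f z \<bullet> b) (at z) v) (at y) w =
         frechet_derivative (\<lambda>z. frechet_derivative (\<lambda>z. f z \<bullet> b) (at z) w) (at y) v"
  proof (rule second_derivative_symmetric_real[OF assms(1,2)])
    show "(\<lambda>z. f z \<bullet> b) differentiable (at x)" if "x \<in> S" for x
      using 1[OF that] unfolding differentiable_def by blast
    show "(\<lambda>z. frechet_derivative (\<lambda>z. f z \<bullet> b) (at z) v) differentiable (at y)" for v
      using 3[of v] unfolding differentiable_def by blast
  qed
  then show "frechet_derivative (\<lambda>z. frechet_derivative f (at z) v) (at y) w \<bullet> b =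
         frechet_derivative (\<lambda>z. frechet_derivative f (at z) w) (at y) v \<bullet> b"
    using frechet_derivative_at[OF 3] by metis
qed

section \<open>Linear maps and linear systems depending on a parameter\<close>

text \<open>
  A linear map is determined by its values on a basis. This reduces statements about a linear or
  bilinear map that varies with a parameter, such as a metric in a chart, to its values at fixed vectors.
\<close>

lemma linear_family_continuous_on:
  fixes A :: "'z::topological_space \<Rightarrow> 'a::euclidean_space \<Rightarrow> 'b::real_normed_vector"
  assumes "\<And>z. z \<in> S \<Longrightarrow> linear (A z)" "\<And>v. continuous_on S (\<lambda>z. A z v)"
    "continuous_on S D"
  shows "continuous_on S (\<lambda>z. A z (D z))"
proof -
  have "continuous_on S (\<lambda>z. \<Sum>b\<in>Basis. (D z \<bullet> b) *\<^sub>R A z b)"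
    using assms(2,3) by (intro continuous_intros)
  then show ?thesis
    by (rule continuous_on_eq) (metis linear_basis_expansion[OF assms(1)])
qed

lemma linear_family_has_derivative:
  fixes A :: "'z::real_normed_vector \<Rightarrow> 'a::euclidean_space \<Rightarrow> 'b::real_normed_vector"
  assumes U: "open U" "y \<in> U" and lin: "\<And>z. z \<in> U \<Longrightarrow> linear (A z)"
    and A: "\<And>v. ((\<lambda>z. A z v) has_derivative (\<lambda>x. A' x v)) (at y)"
    and D: "(D has_derivative D') (at y)"
  shows "((\<lambda>z. A z (D z)) has_derivative (\<lambda>x. A' x (D y) + A y (D' x))) (at y)"
proof -
  have A': "A' x v = (\<Sum>b\<in>Basis. (v \<bullet> b) *\<^sub>R A' x b)" for x v
  proof -
    have "((\<lambda>z. \<Sum>b\<in>Basis. (v \<bullet> b) *\<^sub>R A z b) has_derivative (\<lambda>x. \<Sum>b\<in>Basis. (v \<bullet> b) *\<^sub>R A' x b)) (at y)"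
      by (intro has_derivative_sum has_derivative_scaleR_right A)
    then have "((\<lambda>z. A z v) has_derivative (\<lambda>x. \<Sum>b\<in>Basis. (v \<bullet> b) *\<^sub>R A' x b)) (at y)"
      by (rule has_derivative_transform_within_open[OF _ U]) (metis linear_basis_expansion[OF lin])
    with A have "(\<lambda>x. A' x v) = (\<lambda>x. \<Sum>b\<in>Basis. (v \<bullet> b) *\<^sub>R A' x b)" by (rule has_derivative_unique)
    then show ?thesis by metis
  qed
  have "((\<lambda>z. \<Sum>b\<in>Basis. (D z \<bullet> b) *\<^sub>R A z b) has_derivative
      (\<lambda>x. \<Sum>b\<in>Basis. (D y \<bullet> b) *\<^sub>R A' x b + (D' x \<bullet> b) *\<^sub>R A y b)) (at y)"
    using A D
    by (intro has_derivative_sum has_derivative_scaleR has_derivative_inner_left)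
  moreover have "(\<Sum>b\<in>Basis. (D y \<bullet> b) *\<^sub>R A' x b + (D' x \<bullet> b) *\<^sub>R A y b) = A' x (D y) + A y (D' x)" for x
    unfolding sum.distrib using A'[of x "D y"] linear_basis_expansion[OF lin[OF U(2)], of "D' x"] by metis
  ultimately have "((\<lambda>z. \<Sum>b\<in>Basis. (D z \<bullet> b) *\<^sub>R A z b) has_derivative
      (\<lambda>x. A' x (D y) + A y (D' x))) (at y)" by simp
  then show ?thesis
    by (rule has_derivative_transform_within_open[OF _ U]) (metis linear_basis_expansion[OF lin])
qed

lemma bilinear_family_has_derivative:
  fixes G :: "'z::real_normed_vector \<Rightarrow> 'a::euclidean_space \<Rightarrow> 'c::euclidean_space \<Rightarrow> 'b::real_normed_vector"
  assumes U: "open U" "y \<in> U" and bil: "\<And>z. z \<in> U \<Longrightarrow> bilinear (G z)"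
    and G: "\<And>v w. ((\<lambda>z. G z v w) has_derivative (\<lambda>x. G' x v w)) (at y)"
    and P: "(P has_derivative P') (at y)" and Q: "(Q has_derivative Q') (at y)"
  shows "((\<lambda>z. G z (P z) (Q z)) has_derivative
      (\<lambda>x. G' x (P y) (Q y) + G y (P' x) (Q y) + G y (P y) (Q' x))) (at y)"
proof -
  have 1: "((\<lambda>z. G z (P z) w) has_derivative (\<lambda>x. G' x (P y) w + G y (P' x) w)) (at y)" for w
    using bil unfolding bilinear_def
    by (intro linear_family_has_derivative[where A = "\<lambda>z v. G z v w" and A' = "\<lambda>x v. G' x v w", OF U _ G P]) auto
  show ?thesis
    by (rule linear_family_has_derivative[where A = "\<lambda>z w. G z (P z) w"
        and A' = "\<lambda>x w. G' x (P y) w + G y (P' x) w", OF U _ 1 Q])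
      (use bil in \<open>auto simp: bilinear_def\<close>)
qed

lemma bilinear_family_continuous_on:
  fixes G :: "'z::topological_space \<Rightarrow> 'a::euclidean_space \<Rightarrow> 'c::euclidean_space \<Rightarrow> 'b::real_normed_vector"
  assumes bil: "\<And>z. z \<in> S \<Longrightarrow> bilinear (G z)"
    and G: "\<And>v w. continuous_on S (\<lambda>z. G z v w)"
    and P: "continuous_on S P" "continuous_on S Q"
  shows "continuous_on S (\<lambda>z. G z (P z) (Q z))"
proof -
  have 1: "continuous_on S (\<lambda>z. G z (P z) w)" for w
    using bil unfolding bilinear_def
    by (intro linear_family_continuous_on[where A = "\<lambda>z v. G z v w", OF _ G P(1)]) auto
  show ?thesis
    by (rule linear_family_continuous_on[where A = "\<lambda>z w. G z (P z) w", OF _ 1 P(2)])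
      (use bil in \<open>auto simp: bilinear_def\<close>)
qed

text \<open>
  In finite dimension pointwise convergence of linear maps is uniform on the unit ball, so that half of a
  lower bound for the limit survives nearby.
\<close>

lemma injective_linear_family_bounded_below:
  fixes A :: "'z \<Rightarrow> 'a::euclidean_space \<Rightarrow> 'b::euclidean_space"
  assumes lin0: "linear A0" and inj0: "inj A0"
    and lin: "\<forall>\<^sub>F z in F. linear (A z)"
    and lim: "\<And>b. ((\<lambda>z. A z b) \<longlongrightarrow> A0 b) F"
  obtains m where "m > 0" "\<forall>\<^sub>F z in F. \<forall>v. m * norm v \<le> norm (A z v)"
proof -
  obtain B where B: "B > 0" "\<And>v. B * norm v \<le> norm (A0 v)"
    using linear_inj_bounded_below_pos[OF lin0 inj0] by metis
  have "((\<lambda>z. \<Sum>b\<in>Basis. norm (A z b - A0 b)) \<longlongrightarrow> (\<Sum>b\<in>Basis. norm (A0 b - A0 b))) F"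
    by (intro tendsto_sum tendsto_norm tendsto_diff lim tendsto_const)
  then have "((\<lambda>z. \<Sum>b\<in>Basis. norm (A z b - A0 b)) \<longlongrightarrow> 0) F" by simp
  then have "\<forall>\<^sub>F z in F. (\<Sum>b\<in>Basis. norm (A z b - A0 b)) < B / 2"
    using B(1) by (intro order_tendstoD(2)) auto
  then have "\<forall>\<^sub>F z in F. \<forall>v. (B / 2) * norm v \<le> norm (A z v)"
    using lin
  proof eventually_elim
    case (elim z)
    show ?case
    proof
      fix v
      have "linear (\<lambda>v. A z v - A0 v)" using elim(2) lin0 by (rule linear_compose_sub)
      then have "A z v - A0 v = (\<Sum>b\<in>Basis. (v \<bullet> b) *\<^sub>R (A z b - A0 b))"
        by (rule linear_basis_expansion)
      also have "norm \<dots> \<le> (\<Sum>b\<in>Basis. norm v * norm (A z b - A0 b))"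
        by (rule sum_norm_le) (auto intro!: mult_right_mono Basis_le_norm)
      also have "\<dots> = norm v * (\<Sum>b\<in>Basis. norm (A z b - A0 b))" by (simp add: sum_distrib_left)
      also have "\<dots> \<le> norm v * (B / 2)" using elim(1) by (intro mult_left_mono) auto
      finally have "norm (A z v - A0 v) \<le> norm v * (B / 2)" .
      moreover have "norm (A0 v) \<le> norm (A z v) + norm (A z v - A0 v)"
        using norm_triangle_ineq4[of "A z v" "A z v - A0 v"] by simp
      ultimately have "B * norm v \<le> norm (A z v) + norm v * (B / 2)" using B(2)[of v] by linarith
      then show "(B / 2) * norm v \<le> norm (A z v)" by (simp add: algebra_simps)
    qed
  qed
  with B(1) show ?thesis by (intro that[of "B / 2"]) auto
qed

text \<open>
  Applied to the differential of a local isometry \<open>\<pi>\<close>: the velocity of a lifted curve is the solution of a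
  linear system whose right-hand side is the velocity of the given curve.
\<close>

lemma linear_system_solution_continuous_on:
  fixes A :: "'z::topological_space \<Rightarrow> 'a::euclidean_space \<Rightarrow> 'b::euclidean_space"
  assumes lin: "\<And>t. t \<in> T \<Longrightarrow> linear (A t)" and inj: "\<And>t. t \<in> T \<Longrightarrow> inj (A t)"
    and A: "\<And>v. continuous_on T (\<lambda>t. A t v)" and rhs: "continuous_on T h"
    and X: "\<And>t. t \<in> T \<Longrightarrow> A t (X t) = h t"
  shows "continuous_on T X"
  unfolding continuous_on_def
proof
  fix s assume s: "s \<in> T"
  let ?F = "at s within T"
  have lim: "((\<lambda>t. A t v) \<longlongrightarrow> A s v) ?F" "(h \<longlongrightarrow> h s) ?F" for v
    using A[of v] rhs s unfolding continuous_on_def by auto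
  have inT: "\<forall>\<^sub>F t in ?F. t \<in> T" by (simp add: eventually_at_filter)
  then have "\<forall>\<^sub>F t in ?F. linear (A t)" by eventually_elim (rule lin)
  then obtain m where m: "m > 0" "\<forall>\<^sub>F t in ?F. \<forall>v. m * norm v \<le> norm (A t v)"
    using injective_linear_family_bounded_below[OF lin[OF s] inj[OF s] _ lim(1)] by blast
  have "((\<lambda>t. norm (h t - A t (X s)) / m) \<longlongrightarrow> norm (h s - A s (X s)) / m) ?F"
    using m(1) by (intro tendsto_intros lim) auto
  then have z: "((\<lambda>t. norm (h t - A t (X s)) / m) \<longlongrightarrow> 0) ?F" using X[OF s] by simp
  have "\<forall>\<^sub>F t in ?F. norm (X t - X s) \<le> norm (h t - A t (X s)) / m"
    using m(2) inT
  proof eventually_elim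
    case (elim t)
    have "A t (X t - X s) = h t - A t (X s)" using lin[OF elim(2)] X[OF elim(2)] by (simp add: linear_diff)
    with elim(1) have "m * norm (X t - X s) \<le> norm (h t - A t (X s))" by metis
    with m(1) show ?case by (simp add: pos_le_divide_eq mult.commute)
  qed
  with z have "((\<lambda>t. X t - X s) \<longlongrightarrow> 0) ?F" by (rule Lim_null_comparison[rotated])
  then show "(X \<longlongrightarrow> X s) ?F" using Lim_null by blast
qed

text \<open>
  Applied to the gradient, which the metric defines implicitly. Writing \<open>\<delta> z = X z - X y\<close> and
  \<open>\<zeta> z = h z - A z (X y)\<close> we have \<open>A y (\<delta> z) = \<zeta> z - (A z - A y) (\<delta> z)\<close>. Here \<open>\<zeta>\<close> is differentiable with
  \<open>\<zeta> y = 0\<close>, hence \<open>\<delta> z = O(|z - y|)\<close> by the uniform lower bound for \<open>A z\<close>, and the last term is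
  \<open>o(|z - y|)\<close>.
\<close>

lemma linear_system_solution_differentiable:
  fixes A :: "'z::real_normed_vector \<Rightarrow> 'a::euclidean_space \<Rightarrow> 'b::euclidean_space"
  assumes U: "open U" "y \<in> U" and lin: "\<And>z. z \<in> U \<Longrightarrow> linear (A z)" and inj: "inj (A y)"
    and A: "\<And>v. (\<lambda>z. A z v) differentiable (at y)" and rhs: "h differentiable (at y)"
    and X: "\<And>z. z \<in> U \<Longrightarrow> A z (X z) = h z"
  shows "X differentiable (at y)"
proof -
  have linA: "linear (A y)" using lin U by blast
  have inU: "\<forall>\<^sub>F z in nhds y. z \<in> U" using U by (rule eventually_nhds_in_open)
  have contA: "((\<lambda>z. A z v) \<longlongrightarrow> A y v) (nhds y)" for v
    using A[THEN differentiable_imp_continuous_within] unfolding isCont_def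
    by (rule tendsto_at_iff_tendsto_nhds[THEN iffD1])
  have "\<forall>\<^sub>F z in nhds y. linear (A z)" using inU by eventually_elim (rule lin)
  then obtain m where m: "m > 0" "\<forall>\<^sub>F z in nhds y. \<forall>v. m * norm v \<le> norm (A z v)"
    using injective_linear_family_bounded_below[OF linA inj _ contA] by blast
  define \<delta> where "\<delta> = (\<lambda>z. X z - X y)"
  define \<zeta> where "\<zeta> = (\<lambda>z. h z - A z (X y))"
  have \<zeta>y: "\<zeta> y = 0" using X U by (simp add: \<zeta>_def)
  have "\<zeta> differentiable (at y)" unfolding \<zeta>_def using rhs A by (rule differentiable_diff)
  then obtain \<zeta>' where \<zeta>': "(\<zeta> has_derivative \<zeta>') (at y)" unfolding differentiable_def by blast
  obtain B where B: "B > 0" "\<And>x. norm (\<zeta>' x) \<le> norm x * B"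
    using bounded_linear.pos_bounded[OF has_derivative_bounded_linear[OF \<zeta>']] by blast
  from \<zeta>' have "\<forall>e>0. \<exists>d>0. \<forall>z. norm (z - y) < d \<longrightarrow> norm (\<zeta> z - \<zeta> y - \<zeta>' (z - y)) \<le> e * norm (z - y)"
    unfolding has_derivative_at_alt by (rule conjunct2)
  from this[rule_format, OF zero_less_one]
  obtain d0 where d0: "d0 > 0" "\<And>z. norm (z - y) < d0 \<Longrightarrow> norm (\<zeta> z - \<zeta> y - \<zeta>' (z - y)) \<le> 1 * norm (z - y)"
    by blast
  define K where "K = (B + 1) / m"
  have K: "K > 0" unfolding K_def using B(1) m(1) by (intro divide_pos_pos add_pos_pos) auto
  have A\<delta>: "A z (\<delta> z) = \<zeta> z" if "z \<in> U" for z
    using lin[OF that] X[OF that] by (simp add: \<delta>_def \<zeta>_def linear_diff)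
  have near: "\<forall>\<^sub>F z in nhds y. z \<in> U \<and> norm (\<delta> z) \<le> K * norm (z - y)"
  proof -
    have "\<forall>\<^sub>F z in nhds y. norm (z - y) < d0"
      using d0(1) unfolding eventually_nhds_metric dist_norm by blast
    then show ?thesis using inU m(2)
    proof eventually_elim
      case (elim z)
      have "norm (\<zeta> z) \<le> norm (\<zeta>' (z - y)) + norm (\<zeta> z - \<zeta>' (z - y))" by (rule norm_triangle_sub)
      also have "\<dots> \<le> (B + 1) * norm (z - y)"
        using B(2)[of "z - y"] d0(2)[OF elim(1)] \<zeta>y by (simp add: algebra_simps)
      finally have "m * norm (\<delta> z) \<le> (B + 1) * norm (z - y)"
        using elim(3) A\<delta>[OF elim(2)] by (metis order_trans)
      then show ?case using m(1) elim(2) by (simp add: K_def field_simps)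
    qed
  qed
  define \<rho> where "\<rho> = (\<lambda>z. A z (\<delta> z) - A y (\<delta> z))"
  have "(\<rho> has_derivative (\<lambda>_. 0)) (at y)"
    unfolding has_derivative_at_alt
  proof (intro conjI allI impI bounded_linear_zero)
    fix e :: real assume e: "e > 0"
    have "((\<lambda>z. \<Sum>b\<in>Basis. norm (A z b - A y b)) \<longlongrightarrow> (\<Sum>b\<in>Basis. norm (A y b - A y b))) (nhds y)"
      by (intro tendsto_sum tendsto_norm tendsto_diff contA tendsto_const)
    then have "\<forall>\<^sub>F z in nhds y. (\<Sum>b\<in>Basis. norm (A z b - A y b)) < e / K"
      using e K by (intro order_tendstoD(2)) auto
    then have "\<forall>\<^sub>F z in nhds y. norm (\<rho> z - \<rho> y - 0) \<le> e * norm (z - y)"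
      using near
    proof eventually_elim
      case (elim z)
      have \<delta>y: "\<delta> y = 0" by (simp add: \<delta>_def)
      have "linear (\<lambda>v. A z v - A y v)" using lin elim(2) linA by (intro linear_compose_sub) auto
      then have "\<rho> z = (\<Sum>b\<in>Basis. (\<delta> z \<bullet> b) *\<^sub>R (A z b - A y b))"
        unfolding \<rho>_def by (rule linear_basis_expansion)
      also have "norm \<dots> \<le> (\<Sum>b\<in>Basis. norm (\<delta> z) * norm (A z b - A y b))"
        by (rule sum_norm_le) (auto intro!: mult_right_mono Basis_le_norm)
      also have "\<dots> = norm (\<delta> z) * (\<Sum>b\<in>Basis. norm (A z b - A y b))" by (simp add: sum_distrib_left)
      also have "\<dots> \<le> (K * norm (z - y)) * (e / K)"
        using elim K by (intro mult_mono) (auto intro: sum_nonneg)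
      also have "\<dots> = e * norm (z - y)" using K by simp
      finally show ?case using \<delta>y linA by (simp add: \<rho>_def linear_0)
    qed
    then show "\<exists>d>0. \<forall>z. norm (z - y) < d \<longrightarrow> norm (\<rho> z - \<rho> y - 0) \<le> e * norm (z - y)"
      unfolding eventually_nhds_metric dist_norm by blast
  qed
  then have d: "((\<lambda>z. \<zeta> z - \<rho> z) has_derivative (\<lambda>x. \<zeta>' x - 0)) (at y)"
    by (rule has_derivative_diff[OF \<zeta>'])
  obtain R where R: "linear R" "R \<circ> A y = id"
    using linear_injective_left_inverse[OF linA inj] by blast
  have "((\<lambda>z. R (\<zeta> z - \<rho> z) + X y) has_derivative (\<lambda>x. R (\<zeta>' x - 0) + 0)) (at y)"
    by (rule has_derivative_add[OF bounded_linear.has_derivative[OF _ d] has_derivative_const])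
      (use R(1) in \<open>simp add: linear_conv_bounded_linear\<close>)
  then have "(X has_derivative (\<lambda>x. R (\<zeta>' x - 0) + 0)) (at y)"
  proof (rule has_derivative_transform_within_open[OF _ U])
    fix z assume z: "z \<in> U"
    have "\<zeta> z - \<rho> z = A y (\<delta> z)" using A\<delta>[OF z] by (simp add: \<rho>_def)
    then show "R (\<zeta> z - \<rho> z) + X y = X z" using R(2) by (simp add: \<delta>_def o_def id_def fun_eq_iff)
  qed
  then show ?thesis unfolding differentiable_def by blast
qed

section \<open>The Levi-Civita connection of a nondegenerate metric\<close>

text \<open>
  A nondegenerate form induces an injective linear map into the dual space, which has the same dimension.
\<close>

lemma bilinear_representation:
  fixes B :: "'a::euclidean_space \<Rightarrow> 'a \<Rightarrow> real"
  assumes bil: "bilinear B" and nondeg: "\<And>v. (\<And>w. B v w = 0) \<Longrightarrow> v = 0" and l: "linear l"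
  shows "\<exists>!z. \<forall>w. B z w = l w"
proof -
  define T where "T = (\<lambda>z. \<Sum>b\<in>Basis. B z b *\<^sub>R b)"
  have lin1: "linear (\<lambda>z. B z w)" and lin2: "linear (B z)" for z w
    using bil by (auto simp: bilinear_def)
  have "linear T" unfolding T_def
    by (intro linear_compose_sum ballI linearI) (simp_all add: linear_add[OF lin1] linear_cmul[OF lin1] algebra_simps)
  have Tb: "T z \<bullet> b = B z b" if "b \<in> Basis" for z b
    using that by (simp add: T_def)
  have "inj T"
    unfolding linear_injective_0[OF \<open>linear T\<close>]
  proof (intro allI impI)
    fix z assume "T z = 0"
    then have "B z b = 0" if "b \<in> Basis" for b using Tb[OF that] by (metis inner_zero_left)
    then have "B z w = 0" for w by (subst linear_basis_expansion[OF lin2]) simp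
    then show "z = 0" by (rule nondeg)
  qed
  then have "surj T" using \<open>linear T\<close> by (intro linear_injective_imp_surjective) auto
  then obtain z where z: "T z = (\<Sum>b\<in>Basis. l b *\<^sub>R b)" by (metis surjD)
  have "B z b = l b" if "b \<in> Basis" for b
    using Tb[OF that, of z] z that by simp
  then have ex: "B z w = l w" for w
    by (subst linear_basis_expansion[OF lin2], subst linear_basis_expansion[OF l]) simp
  have "z' = z" if "\<forall>w. B z' w = l w" for z'
  proof -
    have "B (z' - z) w = 0" for w using that ex linear_diff[OF lin1] by auto
    then show ?thesis using nondeg[of "z' - z"] by simp
  qed
  with ex show ?thesis by metis
qed

text \<open>
  Nondegeneracy in place of positivity: the locale has to cover the Lorentzian metric of the wave as well
  as the Riemannian metrics of its submanifolds.
\<close>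

locale metric_field =
  fixes U :: "'a::euclidean_space set" and G :: "'a \<Rightarrow> 'a \<Rightarrow> 'a \<Rightarrow> real"
  assumes open_U: "open U"
    and bil: "z \<in> U \<Longrightarrow> bilinear (G z)"
    and symm: "z \<in> U \<Longrightarrow> G z v w = G z w v"
    and nondeg: "z \<in> U \<Longrightarrow> (\<And>w. G z v w = 0) \<Longrightarrow> v = 0"
    and diff: "z \<in> U \<Longrightarrow> (\<lambda>z. G z v w) differentiable (at z)"
begin

lemma linear_left: "z \<in> U \<Longrightarrow> linear (\<lambda>v. G z v w)"
  and linear_right: "z \<in> U \<Longrightarrow> linear (G z v)"
  using bil by (auto simp: bilinear_def)

lemmas add_left = linear_add[OF linear_left] and add_right = linear_add[OF linear_right]
  and scale_left = linear_cmul[OF linear_left] and scale_right = linear_cmul[OF linear_right]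
  and diff_left = linear_diff[OF linear_left]

lemma eqI_metric:
  assumes "z \<in> U" "\<And>w. G z a w = G z b w"
  shows "a = b"
  using nondeg[OF assms(1), of "a - b"] assms diff_left by simp

abbreviation dG where "dG z x v w \<equiv> frechet_derivative (\<lambda>z. G z v w) (at z) x"

lemma dG: "z \<in> U \<Longrightarrow> ((\<lambda>z. G z v w) has_derivative (\<lambda>x. dG z x v w)) (at z)"
  using diff frechet_derivative_works by blast

lemma dG_unique:
  assumes "z \<in> U" "((\<lambda>z. G z v w) has_derivative D) (at z)"
  shows "dG z x v w = D x"
  using frechet_derivative_at[OF assms(2)] by simp

lemma dG_sym:
  assumes z: "z \<in> U"
  shows "dG z x v w = dG z x w v"
proof (rule dG_unique[OF z])
  show "((\<lambda>z. G z v w) has_derivative (\<lambda>x. dG z x w v)) (at z)"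
    by (rule has_derivative_transform_within_open[OF dG[OF z] open_U z]) (rule symm)
qed

lemma dG_linear: "z \<in> U \<Longrightarrow> linear (\<lambda>x. dG z x v w)"
  by (rule has_derivative_linear[OF dG])

lemma dG_linear_mid:
  assumes z: "z \<in> U"
  shows "linear (\<lambda>v. dG z x v w)"
proof (rule linearI)
  fix a b
  have "((\<lambda>z. G z a w + G z b w) has_derivative (\<lambda>x. dG z x a w + dG z x b w)) (at z)"
    by (intro has_derivative_add dG z)
  then have "((\<lambda>z. G z (a + b) w) has_derivative (\<lambda>x. dG z x a w + dG z x b w)) (at z)"
    by (rule has_derivative_transform_within_open[OF _ open_U z]) (rule add_left[symmetric])
  then show "dG z x (a + b) w = dG z x a w + dG z x b w" by (rule dG_unique[OF z])
next
  fix r a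
  have "((\<lambda>z. r *\<^sub>R G z a w) has_derivative (\<lambda>x. r *\<^sub>R dG z x a w)) (at z)"
    by (intro has_derivative_scaleR_right dG z)
  then have "((\<lambda>z. G z (r *\<^sub>R a) w) has_derivative (\<lambda>x. r *\<^sub>R dG z x a w)) (at z)"
    by (rule has_derivative_transform_within_open[OF _ open_U z]) (rule scale_left[symmetric])
  then show "dG z x (r *\<^sub>R a) w = r *\<^sub>R dG z x a w" by (rule dG_unique[OF z])
qed

lemma dG_linear_right:
  assumes z: "z \<in> U"
  shows "linear (\<lambda>w. dG z x v w)"
proof -
  have "(\<lambda>w. dG z x v w) = (\<lambda>w. dG z x w v)" by (intro ext dG_sym[OF z])
  with dG_linear_mid[OF z, where w = v and x = x] show ?thesis by simp
qed

definition is_levi_civita :: "'a \<Rightarrow> ('a \<Rightarrow> 'a \<Rightarrow> 'a) \<Rightarrow> bool" where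
  "is_levi_civita y \<Gamma> \<longleftrightarrow> bilinear \<Gamma> \<and> (\<forall>v w. \<Gamma> v w = \<Gamma> w v) \<and>
     (\<forall>x v w. dG y x v w = G y (\<Gamma> x v) w + G y v (\<Gamma> x w))"

text \<open>
  In the alternating sum of the three cyclic compatibility equations everything else cancels by symmetry.
  The formula determines the connection, and read as a definition it also provides one.
\<close>

lemma koszul_formula:
  assumes y: "y \<in> U" and "is_levi_civita y \<Gamma>"
  shows "2 * G y (\<Gamma> v w) x = dG y v w x + dG y w v x - dG y x v w"
proof -
  have s: "\<Gamma> a b = \<Gamma> b a" and c: "dG y a b e = G y (\<Gamma> a b) e + G y b (\<Gamma> a e)" for a b e
    using assms(2) by (auto simp: is_levi_civita_def)
  have "G y w (\<Gamma> v x) = G y (\<Gamma> x v) w" "G y v (\<Gamma> w x) = G y (\<Gamma> x w) v"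
    using s[of v x] s[of w x] symm[OF y] by metis+
  moreover have "G y v (\<Gamma> x w) = G y (\<Gamma> x w) v" using symm[OF y] by metis
  moreover have "G y (\<Gamma> w v) x = G y (\<Gamma> v w) x" using s[of w v] by simp
  ultimately show ?thesis unfolding c by linarith
qed

lemma levi_civita_exists:
  assumes y: "y \<in> U"
  shows "\<exists>\<Gamma>. is_levi_civita y \<Gamma>"
proof -
  let ?K = "\<lambda>v w x. (dG y v w x + dG y w v x - dG y x v w) / 2"
  note l = linear_add[OF dG_linear[OF y]] linear_add[OF dG_linear_mid[OF y]] linear_add[OF dG_linear_right[OF y]]
    linear_cmul[OF dG_linear[OF y]] linear_cmul[OF dG_linear_mid[OF y]] linear_cmul[OF dG_linear_right[OF y]]
  have K: "linear (?K v w)" for v w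
    by (rule linearI) (simp_all add: l diff_divide_distrib add_divide_distrib right_diff_distrib distrib_left)
  have "\<exists>z. \<forall>x. G y z x = ?K v w x" for v w
    by (rule ex1_implies_ex) (rule bilinear_representation[OF bil[OF y] nondeg[OF y] K])
  then have "\<forall>v w. \<exists>z. \<forall>x. G y z x = ?K v w x" by blast
  then obtain \<Gamma> where "\<forall>v w x. G y (\<Gamma> v w) x = ?K v w x"
    unfolding choice_iff by blast
  then have \<Gamma>: "G y (\<Gamma> v w) x = ?K v w x" for v w x by blast
  have s: "\<Gamma> v w = \<Gamma> w v" for v w
    by (rule eqI_metric[OF y]) (simp add: \<Gamma> dG_sym[OF y, where v = v and w = w])
  have lin: "linear (\<Gamma> v)" for v
  proof (rule linearI; rule eqI_metric[OF y])
    show "G y (\<Gamma> v (a + b)) w = G y (\<Gamma> v a + \<Gamma> v b) w" for a b w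
      by (simp add: add_left[OF y] \<Gamma> l field_simps)
    show "G y (\<Gamma> v (r *\<^sub>R a)) w = G y (r *\<^sub>R \<Gamma> v a) w" for r a w
      by (simp add: scale_left[OF y] \<Gamma> l field_simps)
  qed
  have "(\<lambda>v. \<Gamma> v w) = \<Gamma> w" for w by (intro ext s)
  then have "linear (\<lambda>v. \<Gamma> v w)" for w using lin[of w] by simp
  with lin have "bilinear \<Gamma>" by (simp add: bilinear_def)
  moreover have "dG y x v w = G y (\<Gamma> x v) w + G y v (\<Gamma> x w)" for x v w
    unfolding symm[OF y, of v] \<Gamma>
    using dG_sym[OF y, where x = x and v = v and w = w] by (simp add: field_simps)
  ultimately show ?thesis using s unfolding is_levi_civita_def by blast
qed

lemma levi_civita_unique:
  assumes y: "y \<in> U" and "is_levi_civita y \<Gamma>" "is_levi_civita y \<Gamma>'"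
  shows "\<Gamma> = \<Gamma>'"
proof (intro ext eqI_metric[OF y])
  show "G y (\<Gamma> v w) x = G y (\<Gamma>' v w) x" for v w x
    using koszul_formula[OF y assms(2)] koszul_formula[OF y assms(3)] by (metis mult_cancel_left zero_neq_numeral)
qed

lemma levi_civita_eq: "y \<in> U \<Longrightarrow> is_levi_civita y \<Gamma> \<Longrightarrow> levi_civita G y = \<Gamma>"
  unfolding levi_civita_def is_levi_civita_def[symmetric] using levi_civita_unique by blast

lemma is_levi_civita: "y \<in> U \<Longrightarrow> is_levi_civita y (levi_civita G y)"
  using levi_civita_exists levi_civita_eq by metis

lemma levi_civita_bilinear: "y \<in> U \<Longrightarrow> bilinear (levi_civita G y)"
  and levi_civita_sym: "y \<in> U \<Longrightarrow> levi_civita G y v w = levi_civita G y w v"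
  and levi_civita_compat: "y \<in> U \<Longrightarrow> dG y x v w = G y (levi_civita G y x v) w + G y v (levi_civita G y x w)"
  using is_levi_civita[of y] unfolding is_levi_civita_def by auto

lemma gradient_eq:
  assumes y: "y \<in> U" and "F differentiable (at y)"
  shows "G y (gradient G F y) w = frechet_derivative F (at y) w"
proof -
  have "linear (frechet_derivative F (at y))" using assms(2) by (rule linear_frechet_derivative)
  from bilinear_representation[OF bil[OF y] nondeg[OF y] this]
  have "\<exists>!z. \<forall>w. G y z w = frechet_derivative F (at y) w" by blast
  from theI'[OF this] show ?thesis unfolding gradient_def by blast
qed

text \<open>
  In terms of a basis the gradient solves a linear system with differentiable coefficients.
\<close>

lemma gradient_differentiable:
  assumes y: "y \<in> U" and F: "\<And>z. z \<in> U \<Longrightarrow> F differentiable (at z)"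
    and F2: "\<And>w. (\<lambda>z. frechet_derivative F (at z) w) differentiable (at y)"
  shows "gradient G F differentiable (at y)"
proof -
  define A where "A = (\<lambda>z v. \<Sum>b\<in>Basis. G z v b *\<^sub>R b)"
  show ?thesis
  proof (rule linear_system_solution_differentiable[OF open_U y])
    show lin: "linear (A z)" if "z \<in> U" for z
      unfolding A_def
      by (intro linear_compose_sum ballI linearI) (simp_all add: add_left[OF that] scale_left[OF that] algebra_simps)
    show "inj (A y)"
      unfolding linear_injective_0[OF lin[OF y]]
    proof (intro allI impI)
      fix v assume v: "A y v = 0"
      have "G y v b = 0" if "b \<in> Basis" for b
      proof -
        have "A y v \<bullet> b = G y v b" using that by (simp add: A_def)
        then show ?thesis using v by simp
      qed
      then have "G y v w = 0" for w by (subst linear_basis_expansion[OF linear_right[OF y]]) simp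
      then show "v = 0" by (rule nondeg[OF y])
    qed
    show "(\<lambda>z. A z v) differentiable (at y)" for v
      unfolding A_def using diff[OF y] by (intro differentiable_sum differentiable_scaleR) auto
    show "(\<lambda>z. \<Sum>b\<in>Basis. frechet_derivative F (at z) b *\<^sub>R b) differentiable (at y)"
      using F2 by (intro differentiable_sum differentiable_scaleR) auto
    show "A z (gradient G F z) = (\<Sum>b\<in>Basis. frechet_derivative F (at z) b *\<^sub>R b)" if "z \<in> U" for z
      unfolding A_def using gradient_eq[OF that F[OF that]] by simp
  qed
qed

end

text \<open>
  The covariant Hessian \<open>\<nabla>dF\<close>.
\<close>

definition hessian ::
    "('a::euclidean_space \<Rightarrow> 'a \<Rightarrow> 'a \<Rightarrow> real) \<Rightarrow> ('a \<Rightarrow> real) \<Rightarrow> 'a \<Rightarrow> 'a \<Rightarrow> 'a \<Rightarrow> real" where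
  "hessian G F y v w = frechet_derivative (\<lambda>z. frechet_derivative F (at z) w) (at y) v
     - frechet_derivative F (at y) (levi_civita G y v w)"

context metric_field
begin

text \<open>
  Differentiating the equation \<open>G(grad F, w) = dF(w)\<close> gives the ordinary second derivative of \<open>F\<close>;
  compatibility trades the derivative of \<open>G\<close> for Christoffel terms, of which one completes the covariant
  derivative of the gradient and the other one the Hessian.
\<close>

lemma covariant_derivative_gradient:
  assumes y: "y \<in> U" and F: "\<And>z. z \<in> U \<Longrightarrow> F differentiable (at z)"
    and F2: "\<And>w. (\<lambda>z. frechet_derivative F (at z) w) differentiable (at y)"
  shows "G y (covariant_deriv G (\<lambda>_. v) (gradient G F) y) w = hessian G F y v w"
proof -
  let ?X = "gradient G F"
  have X: "(?X has_derivative frechet_derivative ?X (at y)) (at y)"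
    using gradient_differentiable[OF y F F2] frechet_derivative_works by blast
  have "((\<lambda>z. G z (?X z) w) has_derivative
      (\<lambda>x. dG y x (?X y) w + G y (frechet_derivative ?X (at y) x) w + G y (?X y) 0)) (at y)"
    by (rule bilinear_family_has_derivative[OF open_U y bil dG[OF y] X has_derivative_const])
  then have "((\<lambda>z. frechet_derivative F (at z) w) has_derivative
      (\<lambda>x. dG y x (?X y) w + G y (frechet_derivative ?X (at y) x) w + G y (?X y) 0)) (at y)"
    by (rule has_derivative_transform_within_open[OF _ open_U y]) (simp add: gradient_eq F)
  from fun_cong[OF frechet_derivative_at[OF this], of v]
  have "frechet_derivative (\<lambda>z. frechet_derivative F (at z) w) (at y) v
      = dG y v (?X y) w + G y (frechet_derivative ?X (at y) v) w"
    unfolding linear_0[OF linear_right[OF y]] by linarith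
  also have "dG y v (?X y) w = G y (levi_civita G y v (?X y)) w + frechet_derivative F (at y) (levi_civita G y v w)"
    by (simp add: levi_civita_compat[OF y] gradient_eq[OF y F[OF y]])
  finally show ?thesis
    unfolding hessian_def covariant_deriv_def add_left[OF y] by linarith
qed

end

section \<open>Orthonormal frames and the Laplacian\<close>

definition orthonormal :: "('a::euclidean_space \<Rightarrow> 'a \<Rightarrow> real) \<Rightarrow> 'a set \<Rightarrow> bool" where
  "orthonormal B E \<longleftrightarrow> (\<forall>e\<in>E. \<forall>e'\<in>E. B e e' = (if e = e' then 1 else 0))"

locale inner_form =
  fixes B :: "'a::euclidean_space \<Rightarrow> 'a \<Rightarrow> real"
  assumes bilB: "bilinear B" and symB: "B v w = B w v" and posB: "v \<noteq> 0 \<Longrightarrow> 0 < B v v"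
begin

lemma linB: "linear (\<lambda>v. B v w)" "linear (B v)"
  using bilB by (auto simp: bilinear_def)

lemma orthonormal_independent:
  assumes "orthonormal B E"
  shows "independent E"
  unfolding independent_explicit_module
proof (intro allI impI)
  fix t u v
  assume t: "finite t" "t \<subseteq> E" and 0: "(\<Sum>v\<in>t. u v *\<^sub>R v) = 0" and v: "v \<in> t"
  have "0 = B (\<Sum>v\<in>t. u v *\<^sub>R v) v" using 0 linear_0[OF linB(1)] by simp
  also have "\<dots> = (\<Sum>e\<in>t. u e * B e v)" by (simp add: linear_sum[OF linB(1)] linear_cmul[OF linB(1)])
  also have "\<dots> = (\<Sum>e\<in>t. if e = v then u e else 0)"
  proof (rule sum.cong[OF refl])
    fix e assume "e \<in> t"
    then have "B e v = (if e = v then 1 else 0)" using assms t(2) v unfolding orthonormal_def by blast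
    then show "u e * B e v = (if e = v then u e else 0)" by simp
  qed
  also have "\<dots> = u v" using t v by simp
  finally show "u v = 0" by simp
qed

lemma orthonormal_insert:
  assumes E: "orthonormal B E" and w: "w \<noteq> 0" "\<And>e. e \<in> E \<Longrightarrow> B w e = 0"
  defines "n \<equiv> (1 / sqrt (B w w)) *\<^sub>R w"
  shows "orthonormal B (insert n E)" "n \<notin> E"
proof -
  have nn: "B n n = 1" using posB[OF w(1)]
    by (simp add: n_def linear_cmul[OF linB(1)] linear_cmul[OF linB(2)])
  have ne: "B n e = 0" "B e n = 0" if "e \<in> E" for e
    using w(2)[OF that] symB[of e] by (simp_all add: n_def linear_cmul[OF linB(1)])
  show "n \<notin> E" using nn ne by force
  then show "orthonormal B (insert n E)"
    using E nn ne unfolding orthonormal_def by auto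
qed

lemma orthonormal_residual:
  assumes E: "orthonormal B E" "finite E" and e: "e \<in> E"
  shows "B (v - (\<Sum>e\<in>E. B v e *\<^sub>R e)) e = 0"
proof -
  have "B (\<Sum>e\<in>E. B v e *\<^sub>R e) e = (\<Sum>e'\<in>E. B v e' * B e' e)"
    by (simp add: linear_sum[OF linB(1)] linear_cmul[OF linB(1)])
  also have "\<dots> = (\<Sum>e'\<in>E. if e' = e then B v e' else 0)"
  proof (rule sum.cong[OF refl])
    fix e' assume "e' \<in> E"
    then have "B e' e = (if e' = e then 1 else 0)" using E(1) e unfolding orthonormal_def by blast
    then show "B v e' * B e' e = (if e' = e then B v e' else 0)" by simp
  qed
  finally show ?thesis using E e by (simp add: linear_diff[OF linB(1)])
qed

lemma orthonormal_card: "orthonormal B E \<Longrightarrow> finite E \<and> card E \<le> DIM('a)"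
  using independent_bound[OF orthonormal_independent] by blast

text \<open>
  Gram-Schmidt: as long as a set is too small to span, subtracting from an outside vector its projection
  leaves a nonzero vector that can be normalised and added.
\<close>

lemma orthonormal_frame_exists: "\<exists>E. orthonormal_frame B E"
proof -
  have "\<exists>E. orthonormal B E \<and> card E = n" if "n \<le> DIM('a)" for n
    using that
  proof (induction n)
    case 0
    show ?case by (rule exI[of _ "{}"]) (simp add: orthonormal_def)
  next
    case (Suc n)
    then obtain E where E: "orthonormal B E" "card E = n" by auto
    then have fin: "finite E" using orthonormal_card by blast
    have "\<exists>v. v \<notin> span E"
    proof (rule ccontr)
      assume "\<nexists>v. v \<notin> span E"
      then have "DIM('a) \<le> card E" using dim_le_card[of UNIV E] fin by (auto simp: dim_UNIV)
      with E Suc.prems show False by simp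
    qed
    then obtain v where v: "v \<notin> span E" by blast
    define w where "w = v - (\<Sum>e\<in>E. B v e *\<^sub>R e)"
    have "w \<noteq> 0"
    proof
      assume "w = 0"
      then have "v = (\<Sum>e\<in>E. B v e *\<^sub>R e)" by (simp add: w_def)
      moreover have "(\<Sum>e\<in>E. B v e *\<^sub>R e) \<in> span E" by (intro span_sum span_scale span_base)
      ultimately show False using v by simp
    qed
    moreover have "B w e = 0" if "e \<in> E" for e
      unfolding w_def by (rule orthonormal_residual[OF E(1) fin that])
    ultimately have "\<exists>n. orthonormal B (insert n E) \<and> n \<notin> E" using orthonormal_insert[OF E(1), of w] by blast
    then obtain n where "orthonormal B (insert n E)" "n \<notin> E" by blast
    with E(2) fin show ?case by (intro exI[of _ "insert n E"]) simp
  qed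
  from this[OF order_refl] show ?thesis unfolding orthonormal_frame_def orthonormal_def by blast
qed

text \<open>
  Otherwise the residual could be normalised and added to the frame, giving more independent vectors than
  the dimension allows.
\<close>

lemma frame_expansion:
  assumes "orthonormal_frame B E"
  shows "v = (\<Sum>e\<in>E. B v e *\<^sub>R e)"
proof (rule ccontr)
  assume neq: "v \<noteq> (\<Sum>e\<in>E. B v e *\<^sub>R e)"
  define w where "w = v - (\<Sum>e\<in>E. B v e *\<^sub>R e)"
  have E: "orthonormal B E" "card E = DIM('a)"
    using assms by (auto simp: orthonormal_frame_def orthonormal_def)
  then have fin: "finite E" using orthonormal_card by blast
  have "w \<noteq> 0" using neq by (simp add: w_def)
  moreover have "B w e = 0" if "e \<in> E" for e
    unfolding w_def by (rule orthonormal_residual[OF E(1) fin that])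
  ultimately have "\<exists>n. orthonormal B (insert n E) \<and> n \<notin> E" using orthonormal_insert[OF E(1), of w] by blast
  then obtain n where "orthonormal B (insert n E)" "n \<notin> E" by blast
  then show False using orthonormal_card[of "insert n E"] E(2) fin by simp
qed

text \<open>
  The divergence is a trace in the standard basis of the model space, while the mean curvature and the
  behaviour under isometries are expressed by frames that are orthonormal for the metric.
\<close>

lemma trace_eq_frame_sum:
  assumes E: "orthonormal_frame B E" and L: "linear L"
  shows "(\<Sum>b\<in>Basis. L b \<bullet> b) = (\<Sum>e\<in>E. B (L e) e)"
proof -
  have "(\<Sum>b\<in>Basis. L b \<bullet> b) = (\<Sum>b\<in>Basis. \<Sum>e\<in>E. B b e * (L e \<bullet> b))"
  proof (rule sum.cong[OF refl])
    fix b :: 'a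
    have "L b = (\<Sum>e\<in>E. B b e *\<^sub>R L e)"
      using arg_cong[OF frame_expansion[OF E, of b], of L] by (simp add: linear_sum[OF L] linear_cmul[OF L])
    then show "L b \<bullet> b = (\<Sum>e\<in>E. B b e * (L e \<bullet> b))"
      by (simp add: inner_sum_left)
  qed
  also have "\<dots> = (\<Sum>e\<in>E. \<Sum>b\<in>Basis. B b e * (L e \<bullet> b))"
    by (rule sum.swap)
  also have "\<dots> = (\<Sum>e\<in>E. B (L e) e)"
  proof (rule sum.cong[OF refl])
    fix e
    show "(\<Sum>b\<in>Basis. B b e * (L e \<bullet> b)) = B (L e) e"
      using linear_basis_expansion[OF linB(1), of "L e" e] by (simp add: mult.commute)
  qed
  finally show ?thesis .
qed

end

locale riemannian_field = metric_field U G for U :: "'a::euclidean_space set" and G +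
  assumes pos: "z \<in> U \<Longrightarrow> v \<noteq> 0 \<Longrightarrow> 0 < G z v v"
begin

lemma inner_form:
  assumes z: "z \<in> U"
  shows "inner_form (G z)"
  by (rule inner_form.intro[OF bil[OF z] symm[OF z] pos[OF z]])

lemma laplacian_eq_frame_sum:
  assumes y: "y \<in> U" and E: "orthonormal_frame (G y) E"
    and F: "\<And>z. z \<in> U \<Longrightarrow> F differentiable (at z)"
    and F2: "\<And>w. (\<lambda>z. frechet_derivative F (at z) w) differentiable (at y)"
  shows "divergence G (gradient G F) y = (\<Sum>e\<in>E. hessian G F y e e)"
proof -
  have "linear (frechet_derivative (gradient G F) (at y))"
    using gradient_differentiable[OF y F F2] by (rule linear_frechet_derivative)
  moreover have "linear (\<lambda>v. levi_civita G y v (gradient G F y))"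
    using levi_civita_bilinear[OF y] by (simp add: bilinear_def)
  ultimately have "linear (\<lambda>v. covariant_deriv G (\<lambda>_. v) (gradient G F) y)"
    unfolding covariant_deriv_def by (rule linear_compose_add)
  from inner_form.trace_eq_frame_sum[OF inner_form[OF y] E this] show ?thesis
    unfolding divergence_def by (simp add: covariant_derivative_gradient[OF y F F2])
qed

end

text \<open>
  Needed for functions read in a chart, whose values outside the image of the chart are arbitrary.
\<close>

lemma (in riemannian_field) laplacian_cong:
  assumes y: "y \<in> U" and F: "smooth_on U F" and eq: "\<And>z. z \<in> U \<Longrightarrow> F z = F' z"
  shows "divergence G (gradient G F) y = divergence G (gradient G F') y"
proof -
  have F': "smooth_on U F'" by (rule smooth_on_cong[OF open_U F eq])
  have d1: "frechet_derivative F (at z) w = frechet_derivative F' (at z) w" if "z \<in> U" for z w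
    using frechet_derivative_transform_within_open[OF smooth_on_differentiable[OF F that] open_U that eq] by simp
  have d2: "frechet_derivative (\<lambda>z. frechet_derivative F (at z) w) (at y) v
      = frechet_derivative (\<lambda>z. frechet_derivative F' (at z) w) (at y) v" for v w
    using frechet_derivative_transform_within_open[OF smooth_on_differentiable[OF smooth_on_frechet[OF F] y] open_U y d1] by simp
  obtain E where E: "orthonormal_frame (G y) E"
    using inner_form.orthonormal_frame_exists[OF inner_form[OF y]] by blast
  have "divergence G (gradient G h) y = (\<Sum>e\<in>E. hessian G h y e e)" if "smooth_on U h" for h
    by (rule laplacian_eq_frame_sum[OF y E smooth_on_differentiable[OF that]
          smooth_on_differentiable[OF smooth_on_frechet[OF that] y]])
  from this[OF F] this[OF F'] show ?thesis by (simp add: hessian_def d1[OF y] d2)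
qed

section \<open>Isometries between open subsets of Euclidean spaces\<close>

locale local_isometry_field = src: riemannian_field U G + tgt: riemannian_field U' G'
  for U :: "'a::euclidean_space set" and G and U' :: "'b::euclidean_space set" and G' +
  fixes \<Phi> :: "'a \<Rightarrow> 'b"
  assumes smooth: "smooth_on U \<Phi>" and maps: "z \<in> U \<Longrightarrow> \<Phi> z \<in> U'"
    and isometric: "z \<in> U \<Longrightarrow> G z v w = G' (\<Phi> z) (frechet_derivative \<Phi> (at z) v) (frechet_derivative \<Phi> (at z) w)"
    and dims: "DIM('a) = DIM('b)"
begin

abbreviation d\<Phi> where "d\<Phi> z \<equiv> frechet_derivative \<Phi> (at z)"
abbreviation d2\<Phi> where "d2\<Phi> z v w \<equiv> frechet_derivative (\<lambda>z. frechet_derivative \<Phi> (at z) w) (at z) v"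

lemma d\<Phi>: "z \<in> U \<Longrightarrow> (\<Phi> has_derivative d\<Phi> z) (at z)"
  by (rule smooth_on_has_derivative[OF smooth])

lemma linear_d\<Phi>: "z \<in> U \<Longrightarrow> linear (d\<Phi> z)"
  by (rule has_derivative_linear[OF d\<Phi>])

lemma d2\<Phi>: "z \<in> U \<Longrightarrow> ((\<lambda>z. d\<Phi> z w) has_derivative (\<lambda>v. d2\<Phi> z v w)) (at z)"
  by (rule smooth_on_has_derivative[OF smooth_on_frechet[OF smooth]])

lemma inj_d\<Phi>:
  assumes z: "z \<in> U"
  shows "inj (d\<Phi> z)"
  unfolding linear_injective_0[OF linear_d\<Phi>[OF z]]
proof (intro allI impI)
  fix v assume v: "d\<Phi> z v = 0"
  have "G z v v = G' (\<Phi> z) 0 0" unfolding isometric[OF z] v ..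
  also have "\<dots> = 0" by (rule linear_0[OF tgt.linear_right[OF maps[OF z]]])
  finally show "v = 0" using src.pos[OF z, of v] by (cases "v = 0") auto
qed

lemma surj_d\<Phi>: "z \<in> U \<Longrightarrow> surj (d\<Phi> z)"
  by (rule linear_injective_imp_surjective[OF linear_d\<Phi> inj_d\<Phi>]) (simp_all add: dims dim_UNIV)

lemma second_derivative_sym:
  assumes z: "z \<in> U"
  shows "d2\<Phi> z v w = d2\<Phi> z w v"
  by (rule second_derivative_symmetric[OF src.open_U z smooth_on_differentiable[OF smooth]
        smooth_on_differentiable[OF smooth_on_frechet[OF smooth] z]])

text \<open>
  By uniqueness it suffices that the connection pulled back from the target is torsion free, which is the
  symmetry of the second derivative of \<open>\<Phi>\<close>, and metric, which is the derivative of the isometry equation.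
\<close>

lemma levi_civita_transform:
  assumes y: "y \<in> U"
  shows "d\<Phi> y (levi_civita G y v w) = d2\<Phi> y v w + levi_civita G' (\<Phi> y) (d\<Phi> y v) (d\<Phi> y w)"
proof -
  note \<Phi>y = maps[OF y]
  obtain R where linR: "linear R" and "R \<circ> d\<Phi> y = id"
    using linear_injective_left_inverse[OF linear_d\<Phi>[OF y] inj_d\<Phi>[OF y]] by blast
  then have R: "d\<Phi> y (R a) = a" for a
    using surj_d\<Phi>[OF y] unfolding surj_def by (metis comp_apply id_apply)
  define S where "S = (\<lambda>v w. d2\<Phi> y v w + levi_civita G' (\<Phi> y) (d\<Phi> y v) (d\<Phi> y w))"
  have Ssym: "S v w = S w v" for v w
    unfolding S_def
    by (rule arg_cong2[where f = "(+)", OF second_derivative_sym[OF y] tgt.levi_civita_sym[OF \<Phi>y]])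
  have lin1: "linear (\<lambda>v. S v w)" for w
  proof -
    have "linear (\<lambda>v. d2\<Phi> y v w)" by (rule has_derivative_linear[OF d2\<Phi>[OF y]])
    moreover have "linear (\<lambda>v. levi_civita G' (\<Phi> y) v (d\<Phi> y w))"
      using tgt.levi_civita_bilinear[OF \<Phi>y] by (simp add: bilinear_def)
    then have "linear (\<lambda>v. levi_civita G' (\<Phi> y) (d\<Phi> y v) (d\<Phi> y w))"
      using linear_compose[OF linear_d\<Phi>[OF y]] by (simp add: o_def)
    ultimately show ?thesis unfolding S_def by (rule linear_compose_add)
  qed
  have lin2: "linear (S v)" for v
  proof -
    have "S v = (\<lambda>w. S w v)" by (intro ext Ssym)
    then show ?thesis using lin1[of v] by simp
  qed
  have "src.is_levi_civita y (\<lambda>v w. R (S v w))"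
    unfolding src.is_levi_civita_def
  proof (intro conjI allI)
    show "bilinear (\<lambda>v w. R (S v w))"
      unfolding bilinear_def using linear_compose[OF lin1 linR] linear_compose[OF lin2 linR] by (auto simp: o_def)
    show "R (S v w) = R (S w v)" for v w using Ssym by simp
    fix x v w
    have "((\<lambda>z. G' (\<Phi> z) a b) has_derivative (\<lambda>x. tgt.dG (\<Phi> y) (d\<Phi> y x) a b)) (at y)" for a b
      by (rule has_derivative_compose[OF d\<Phi>[OF y] tgt.dG[OF \<Phi>y]])
    from bilinear_family_has_derivative[where G = "\<lambda>z. G' (\<Phi> z)", OF src.open_U y tgt.bil[OF maps] this d2\<Phi>[OF y] d2\<Phi>[OF y]]
    have "((\<lambda>z. G' (\<Phi> z) (d\<Phi> z v) (d\<Phi> z w)) has_derivative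
       (\<lambda>x. tgt.dG (\<Phi> y) (d\<Phi> y x) (d\<Phi> y v) (d\<Phi> y w) + G' (\<Phi> y) (d2\<Phi> y x v) (d\<Phi> y w)
          + G' (\<Phi> y) (d\<Phi> y v) (d2\<Phi> y x w))) (at y)" .
    then have "((\<lambda>z. G z v w) has_derivative
       (\<lambda>x. tgt.dG (\<Phi> y) (d\<Phi> y x) (d\<Phi> y v) (d\<Phi> y w) + G' (\<Phi> y) (d2\<Phi> y x v) (d\<Phi> y w)
          + G' (\<Phi> y) (d\<Phi> y v) (d2\<Phi> y x w))) (at y)"
      by (rule has_derivative_transform_within_open[OF _ src.open_U y]) (simp add: isometric)
    from src.dG_unique[OF y this, of x]
    show "src.dG y x v w = G y (R (S x v)) w + G y v (R (S x w))"
      unfolding isometric[OF y] R S_def tgt.levi_civita_compat[OF \<Phi>y] tgt.add_left[OF \<Phi>y] tgt.add_right[OF \<Phi>y]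
      by linarith
  qed
  from src.levi_civita_eq[OF y this] show ?thesis by (simp add: R S_def)
qed

lemma hessian_pullback:
  assumes y: "y \<in> U" and F: "smooth_on U' F"
  shows "hessian G (\<lambda>z. F (\<Phi> z)) y v w = hessian G' F (\<Phi> y) (d\<Phi> y v) (d\<Phi> y w)"
proof -
  let ?dF = "\<lambda>z. frechet_derivative F (at z)"
  note \<Phi>y = maps[OF y]
  have 1: "((\<lambda>z. F (\<Phi> z)) has_derivative (\<lambda>v. ?dF (\<Phi> z) (d\<Phi> z v))) (at z)" if "z \<in> U" for z
    by (rule has_derivative_compose[OF d\<Phi>[OF that] smooth_on_has_derivative[OF F maps[OF that]]])
  have d1: "frechet_derivative (\<lambda>z. F (\<Phi> z)) (at z) v = ?dF (\<Phi> z) (d\<Phi> z v)" if "z \<in> U" for z v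
    using frechet_derivative_at[OF 1[OF that]] by metis
  have "((\<lambda>z. ?dF (\<Phi> z) a) has_derivative (\<lambda>v. frechet_derivative (\<lambda>z. ?dF z a) (at (\<Phi> y)) (d\<Phi> y v))) (at y)" for a
    by (rule has_derivative_compose[OF d\<Phi>[OF y] smooth_on_has_derivative[OF smooth_on_frechet[OF F] \<Phi>y]])
  from linear_family_has_derivative[where A = "\<lambda>z. ?dF (\<Phi> z)", OF src.open_U y _ this d2\<Phi>[OF y]]
  have "((\<lambda>z. ?dF (\<Phi> z) (d\<Phi> z w)) has_derivative
     (\<lambda>v. frechet_derivative (\<lambda>z. ?dF z (d\<Phi> y w)) (at (\<Phi> y)) (d\<Phi> y v) + ?dF (\<Phi> y) (d2\<Phi> y v w))) (at y)"
    using has_derivative_linear[OF smooth_on_has_derivative[OF F maps]] by this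
  then have "((\<lambda>z. frechet_derivative (\<lambda>z. F (\<Phi> z)) (at z) w) has_derivative
     (\<lambda>v. frechet_derivative (\<lambda>z. ?dF z (d\<Phi> y w)) (at (\<Phi> y)) (d\<Phi> y v) + ?dF (\<Phi> y) (d2\<Phi> y v w))) (at y)"
    by (rule has_derivative_transform_within_open[OF _ src.open_U y]) (simp add: d1)
  from fun_cong[OF frechet_derivative_at[OF this], of v] show ?thesis
    using linear_add[OF has_derivative_linear[OF smooth_on_has_derivative[OF F \<Phi>y]]]
    by (simp add: hessian_def d1[OF y] levi_civita_transform[OF y])
qed

text \<open>
  An isometry carries orthonormal frames to orthonormal frames and Hessians to Hessians.
\<close>

lemma laplacian_pullback:
  assumes y: "y \<in> U" and F: "smooth_on U' F"
  shows "divergence G (gradient G (\<lambda>z. F (\<Phi> z))) y = divergence G' (gradient G' F) (\<Phi> y)"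
proof -
  obtain E where E: "orthonormal_frame (G y) E"
    using inner_form.orthonormal_frame_exists[OF src.inner_form[OF y]] by blast
  have inj: "inj_on (d\<Phi> y) E" using inj_d\<Phi>[OF y] by (rule inj_on_subset) simp
  have E': "orthonormal_frame (G' (\<Phi> y)) (d\<Phi> y ` E)"
    using E inj_d\<Phi>[OF y] unfolding orthonormal_frame_def
    by (auto simp: card_image[OF inj] dims isometric[OF y, symmetric] inj_eq)
  have F': "smooth_on U (\<lambda>z. F (\<Phi> z))"
    using smooth_on_compose[OF src.open_U smooth F] maps by blast
  have "divergence G (gradient G (\<lambda>z. F (\<Phi> z))) y = (\<Sum>e\<in>E. hessian G (\<lambda>z. F (\<Phi> z)) y e e)"
    using y F' smooth_on_frechet[OF F']
    by (intro src.laplacian_eq_frame_sum[OF y E]) (auto intro: smooth_on_differentiable)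
  also have "\<dots> = (\<Sum>e\<in>d\<Phi> y ` E. hessian G' F (\<Phi> y) e e)"
    by (simp add: sum.reindex[OF inj] hessian_pullback[OF y F])
  also have "\<dots> = divergence G' (gradient G' F) (\<Phi> y)"
    using maps[OF y] F smooth_on_frechet[OF F]
    by (intro tgt.laplacian_eq_frame_sum[OF maps[OF y] E', symmetric]) (auto intro: smooth_on_differentiable)
  finally show ?thesis .
qed

end

section \<open>Charts and tangent vectors\<close>

text \<open>
  This is all that calculus along a map already known to be smooth asks of an atlas, and it is easier to
  establish for the atlas of the wave than \<open>smooth_atlas\<close>.
\<close>

definition chart_cover :: "('m::topological_space, 'e::euclidean_space) chart set \<Rightarrow> bool" where
  "chart_cover A \<longleftrightarrow> (\<forall>c\<in>A. is_chart c) \<and> (\<Union>c\<in>A. fst c) = UNIV"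

lemma smooth_atlas_chart_cover: "smooth_atlas A \<Longrightarrow> chart_cover A"
  by (simp add: smooth_atlas_def chart_cover_def)

lemma chart_cover_is_chart: "chart_cover A \<Longrightarrow> c \<in> A \<Longrightarrow> is_chart c"
  by (simp add: chart_cover_def)

lemma chart_coverE:
  assumes "chart_cover A"
  obtains c where "c \<in> A" "p \<in> fst c"
  using assms unfolding chart_cover_def by blast

lemma chart_at_props:
  assumes "chart_cover A"
  shows "chart_at A p \<in> A" "p \<in> fst (chart_at A p)"
proof -
  have "\<exists>c. c \<in> A \<and> p \<in> fst c" using chart_coverE[OF assms, of p] by blast
  from someI_ex[OF this] show "chart_at A p \<in> A" "p \<in> fst (chart_at A p)"
    unfolding chart_at_def by auto
qed

lemma is_chart_props:
  assumes "is_chart c"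
  shows chart_open: "open (fst c)" and chart_image_open: "open (chart_image c)"
    and chart_inv_left: "\<And>p. p \<in> fst c \<Longrightarrow> chart_inv c (snd c p) = p"
    and chart_inv_right: "\<And>y. y \<in> chart_image c \<Longrightarrow> snd c (chart_inv c y) = y"
    and chart_inv_mem: "\<And>y. y \<in> chart_image c \<Longrightarrow> chart_inv c y \<in> fst c"
    and chart_continuous: "continuous_on (fst c) (snd c)"
    and chart_inv_continuous: "continuous_on (chart_image c) (chart_inv c)"
  using assms unfolding is_chart_def homeomorphism_def by auto

lemma chart_image_mem: "p \<in> fst c \<Longrightarrow> snd c p \<in> chart_image c"
  by (simp add: chart_image_def)

lemma chart_dom_eq:
  assumes "is_chart c"
  shows "snd c ` (fst c \<inter> W) = chart_image c \<inter> chart_inv c -` W"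
proof
  show "snd c ` (fst c \<inter> W) \<subseteq> chart_image c \<inter> chart_inv c -` W"
    using chart_inv_left[OF assms] by (auto simp: chart_image_mem)
  show "chart_image c \<inter> chart_inv c -` W \<subseteq> snd c ` (fst c \<inter> W)"
  proof
    fix y assume "y \<in> chart_image c \<inter> chart_inv c -` W"
    then have "y = snd c (chart_inv c y)" "chart_inv c y \<in> fst c \<inter> W"
      using chart_inv_right[OF assms] chart_inv_mem[OF assms] by auto
    then show "y \<in> snd c ` (fst c \<inter> W)" by (rule image_eqI)
  qed
qed

lemma chart_dom_open:
  assumes "is_chart c" "open W"
  shows "open (snd c ` (fst c \<inter> W))"
  unfolding chart_dom_eq[OF assms(1)]
  using chart_inv_continuous[OF assms(1)] chart_image_open[OF assms(1)] assms(2)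
  by (rule continuous_open_preimage)

lemma smooth_scalar_compose:
  assumes S: "chart_cover S" and B: "chart_cover B" and F: "smooth_map S B F"
    and U: "open U" and h: "smooth_scalar_on B U h"
  shows "smooth_scalar_on S (F -` U) (h \<circ> F)"
  unfolding smooth_scalar_on_def
proof (intro ballI smooth_on_local)
  fix c y assume c: "c \<in> S" and y: "y \<in> snd c ` (fst c \<inter> F -` U)"
  note ch = chart_cover_is_chart[OF S c]
  have contF: "continuous_on UNIV F" using F by (simp add: smooth_map_def)
  obtain p where p: "p \<in> fst c" "F p \<in> U" "y = snd c p" using y by blast
  obtain d where d: "d \<in> B" "F p \<in> fst d" using chart_coverE[OF B] by blast
  note chd = chart_cover_is_chart[OF B d(1)]
  define T where "T = snd c ` (fst c \<inter> F -` (fst d \<inter> U))"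
  have "open (F -` (fst d \<inter> U))"
    using contF chart_open[OF chd] U by (intro open_vimage open_Int) auto
  then have T: "open T" unfolding T_def by (rule chart_dom_open[OF ch])
  have "smooth_on (snd c ` (fst c \<inter> F -` fst d)) (snd d \<circ> F \<circ> chart_inv c)"
    using F c d(1) by (simp add: smooth_map_def)
  then have 1: "smooth_on T (snd d \<circ> F \<circ> chart_inv c)"
    by (rule smooth_on_subset) (auto simp: T_def)
  have 2: "smooth_on (snd d ` (fst d \<inter> U)) (h \<circ> chart_inv d)"
    using h d(1) by (simp add: smooth_scalar_on_def)
  have "(snd d \<circ> F \<circ> chart_inv c) ` T \<subseteq> snd d ` (fst d \<inter> U)"
    unfolding T_def using chart_inv_left[OF ch] by auto
  from smooth_on_compose[OF T 1 2 this]
  have "smooth_on T (\<lambda>x. (h \<circ> chart_inv d) ((snd d \<circ> F \<circ> chart_inv c) x))" .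
  then have "smooth_on T (h \<circ> F \<circ> chart_inv c)"
  proof (rule smooth_on_cong[OF T])
    fix x assume "x \<in> T"
    then show "(h \<circ> chart_inv d) ((snd d \<circ> F \<circ> chart_inv c) x) = (h \<circ> F \<circ> chart_inv c) x"
      unfolding T_def using chart_inv_left[OF ch] chart_inv_left[OF chd] by auto
  qed
  moreover have "y \<in> T" using p d by (auto simp: T_def)
  ultimately show "\<exists>T. open T \<and> y \<in> T \<and> smooth_on T (h \<circ> F \<circ> chart_inv c)" using T by blast
qed

lemma smooth_near_compose:
  assumes "chart_cover S" "chart_cover B" "smooth_map S B F" "smooth_near B (F p) h"
  shows "smooth_near S p (h \<circ> F)"
proof -
  obtain U where U: "open U" "F p \<in> U" "smooth_scalar_on B U h"
    using assms(4) unfolding smooth_near_def by blast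
  have "continuous_on UNIV F" using assms(3) by (simp add: smooth_map_def)
  then have "open (F -` U)" using U(1) open_vimage by blast
  with U(2) smooth_scalar_compose[OF assms(1-3) U(1,3)] show ?thesis
    unfolding smooth_near_def by blast
qed

lemma smooth_near_has_derivative:
  assumes h: "smooth_near A p h" and c: "c \<in> A" "p \<in> fst c"
  shows "((h \<circ> chart_inv c) has_derivative frechet_derivative (h \<circ> chart_inv c) (at (snd c p))) (at (snd c p))"
proof -
  obtain U where U: "p \<in> U" "smooth_scalar_on A U h"
    using h unfolding smooth_near_def by blast
  then have "smooth_on (snd c ` (fst c \<inter> U)) (h \<circ> chart_inv c)"
    using c by (simp add: smooth_scalar_on_def)
  then show ?thesis by (rule smooth_on_has_derivative) (use U c in blast)
qed

lemma smooth_map_chart: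
  assumes S: "chart_cover S" and B: "chart_cover B" and F: "smooth_map S B F"
    and c: "c \<in> S" and d: "d \<in> B"
  shows "open (snd c ` (fst c \<inter> F -` fst d))"
    "smooth_on (snd c ` (fst c \<inter> F -` fst d)) (snd d \<circ> F \<circ> chart_inv c)"
proof -
  have "continuous_on UNIV F" using F by (simp add: smooth_map_def)
  then have "open (F -` fst d)"
    using chart_open[OF chart_cover_is_chart[OF B d]] by (intro open_vimage) auto
  then show "open (snd c ` (fst c \<inter> F -` fst d))"
    by (rule chart_dom_open[OF chart_cover_is_chart[OF S c]])
  show "smooth_on (snd c ` (fst c \<inter> F -` fst d)) (snd d \<circ> F \<circ> chart_inv c)"
    using F c d by (simp add: smooth_map_def)
qed

lemma differential_tangent_vec:
  assumes S: "chart_cover S" and B: "chart_cover B" and F: "smooth_map S B F"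
    and c: "c \<in> S" "p \<in> fst c" and d: "d \<in> B" "F p \<in> fst d"
  shows "differential B F p (tangent_vec S c p v) =
    tangent_vec B d (F p) (frechet_derivative (snd d \<circ> F \<circ> chart_inv c) (at (snd c p)) v)"
proof (rule ext)
  fix h
  note ch = chart_cover_is_chart[OF S c(1)] and chd = chart_cover_is_chart[OF B d(1)]
  let ?\<Phi> = "snd d \<circ> F \<circ> chart_inv c" and ?y = "snd c p"
  show "differential B F p (tangent_vec S c p v) h =
    tangent_vec B d (F p) (frechet_derivative ?\<Phi> (at ?y) v) h"
  proof (cases "smooth_near B (F p) h")
    case True
    let ?T = "snd c ` (fst c \<inter> F -` fst d)"
    have y: "?y \<in> ?T" using c d by blast
    have \<Phi>: "(?\<Phi> has_derivative frechet_derivative ?\<Phi> (at ?y)) (at ?y)"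
      by (rule smooth_on_has_derivative[OF smooth_map_chart(2)[OF S B F c(1) d(1)] y])
    have \<Phi>y: "?\<Phi> ?y = snd d (F p)" using chart_inv_left[OF ch c(2)] by simp
    have "((h \<circ> chart_inv d) has_derivative frechet_derivative (h \<circ> chart_inv d) (at (snd d (F p)))) (at (?\<Phi> ?y))"
      unfolding \<Phi>y by (rule smooth_near_has_derivative[OF True d])
    from has_derivative_compose[OF \<Phi> this]
    have "((\<lambda>x. (h \<circ> chart_inv d) (?\<Phi> x)) has_derivative
      (\<lambda>v. frechet_derivative (h \<circ> chart_inv d) (at (snd d (F p))) (frechet_derivative ?\<Phi> (at ?y) v))) (at ?y)" .
    then have "((h \<circ> F \<circ> chart_inv c) has_derivative
      (\<lambda>v. frechet_derivative (h \<circ> chart_inv d) (at (snd d (F p))) (frechet_derivative ?\<Phi> (at ?y) v))) (at ?y)"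
    proof (rule has_derivative_transform_within_open[OF _ smooth_map_chart(1)[OF S B F c(1) d(1)] y])
      fix x assume "x \<in> ?T"
      then show "(h \<circ> chart_inv d) (?\<Phi> x) = (h \<circ> F \<circ> chart_inv c) x"
        using chart_inv_left[OF ch] chart_inv_left[OF chd] by auto
    qed
    from fun_cong[OF frechet_derivative_at[OF this], of v] show ?thesis
      using True smooth_near_compose[OF S B F True] by (simp add: differential_def tangent_vec_def)
  qed (simp add: differential_def tangent_vec_def)
qed

lemma metric_in_chart_pullback:
  assumes S: "chart_cover S" and B: "chart_cover B" and F: "smooth_map S B F"
    and c: "c \<in> S" and d: "d \<in> B" and y: "y \<in> snd c ` (fst c \<inter> F -` fst d)"
  defines "\<Phi> \<equiv> snd d \<circ> F \<circ> chart_inv c"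
  shows "metric_in_chart S (pullback_metric B g F) c y v w =
    metric_in_chart B g d (\<Phi> y) (frechet_derivative \<Phi> (at y) v) (frechet_derivative \<Phi> (at y) w)"
proof -
  note ch = chart_cover_is_chart[OF S c(1)] and chd = chart_cover_is_chart[OF B d(1)]
  obtain p where p: "p \<in> fst c" "F p \<in> fst d" "y = snd c p" using y by blast
  have "chart_inv c y = p" using p chart_inv_left[OF ch] by simp
  moreover have "chart_inv d (\<Phi> y) = F p"
    using p chart_inv_left[OF ch] chart_inv_left[OF chd] by (simp add: \<Phi>_def)
  ultimately show ?thesis
    using differential_tangent_vec[OF S B F c p(1) d p(2)] p(3)
    by (simp add: metric_in_chart_def pullback_metric_def \<Phi>_def Let_def)
qed

lemma riemannian_field_chart:
  assumes "riemannian_metric A g" "c \<in> A" "is_chart c" "open U" "U \<subseteq> chart_image c"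
  shows "riemannian_field U (metric_in_chart A g c)"
proof -
  let ?G = "metric_in_chart A g c"
  have r: "smooth_on (chart_image c) (\<lambda>y. ?G y v w)"
    "y \<in> chart_image c \<Longrightarrow> bilinear (?G y)" "y \<in> chart_image c \<Longrightarrow> ?G y v w = ?G y w v"
    "y \<in> chart_image c \<Longrightarrow> v \<noteq> 0 \<Longrightarrow> 0 < ?G y v v" for y v w
    using assms(1,2) unfolding riemannian_metric_def by blast+
  show ?thesis
  proof
    fix z v w
    assume "z \<in> U"
    then have z: "z \<in> chart_image c" using assms(5) by blast
    show "bilinear (?G z)" "?G z v w = ?G z w v" using r(2,3) z by blast+
    show "v = 0" if "\<And>w. ?G z v w = 0"
      using that[of v] r(4)[OF z, of v] by (cases "v = 0") auto
    show "(\<lambda>z. ?G z v w) differentiable (at z)" by (rule smooth_on_differentiable[OF r(1) z])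
    show "0 < ?G z v v" if "v \<noteq> 0" using r(4)[OF z that] .
  qed (rule assms(4))
qed

text \<open>
  Continuity keeps the curve in the domain of the chart for a while, which the chain rule needs.
\<close>

lemma velocity_eq_tangent_vec:
  assumes c: "c \<in> A" "is_chart c" "\<gamma> t \<in> fst c" and cont: "isCont \<gamma> t"
    and D: "((snd c \<circ> \<gamma>) has_vector_derivative D) (at t)"
  shows "velocity A \<gamma> t = tangent_vec A c (\<gamma> t) D"
proof (rule ext)
  fix h
  show "velocity A \<gamma> t h = tangent_vec A c (\<gamma> t) D h"
  proof (cases "smooth_near A (\<gamma> t) h")
    case True
    let ?h = "h \<circ> chart_inv c"
    let ?h' = "frechet_derivative ?h (at (snd c (\<gamma> t)))"
    have h: "(?h has_derivative ?h') (at ((snd c \<circ> \<gamma>) t))"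
      using smooth_near_has_derivative[OF True c(1,3)] by simp
    have "((\<lambda>s. ?h ((snd c \<circ> \<gamma>) s)) has_derivative (\<lambda>s. ?h' (s *\<^sub>R D))) (at t)"
      using has_derivative_compose[OF D[unfolded has_vector_derivative_def] h] .
    then have "((\<lambda>s. ?h ((snd c \<circ> \<gamma>) s)) has_derivative (\<lambda>s. s *\<^sub>R ?h' D)) (at t)"
      by (simp only: linear_cmul[OF has_derivative_linear[OF h]])
    then have "((h \<circ> \<gamma>) has_derivative (\<lambda>s. s *\<^sub>R ?h' D)) (at t)"
    proof (rule has_derivative_transform_eventually)
      have "\<forall>\<^sub>F s in at t. \<gamma> s \<in> fst c"
        using cont c(3) chart_open[OF c(2)] unfolding isCont_def by (metis topological_tendstoD)
      then show "\<forall>\<^sub>F s in at t. ?h ((snd c \<circ> \<gamma>) s) = (h \<circ> \<gamma>) s"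
        by eventually_elim (simp add: chart_inv_left[OF c(2)])
      show "?h ((snd c \<circ> \<gamma>) t) = (h \<circ> \<gamma>) t" by (simp add: chart_inv_left[OF c(2,3)])
    qed simp
    then have "((h \<circ> \<gamma>) has_vector_derivative ?h' D) (at t)"
      by (simp add: has_vector_derivative_def)
    then have "vector_derivative (h \<circ> \<gamma>) (at t) = ?h' D" by (rule vector_derivative_at)
    with True show ?thesis by (simp add: velocity_def tangent_vec_def)
  qed (simp add: velocity_def tangent_vec_def)
qed

section \<open>The connection of a plane fronted wave\<close>

definition pfw_chart :: "('m, 'e) chart \<Rightarrow> ('m pfw, (real \<times> real) \<times> 'e) chart" where
  "pfw_chart a = prod_chart (UNIV, id) a"

lemma pfw_atlas_eq: "pfw_atlas A = pfw_chart ` A"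
  unfolding pfw_atlas_def prod_atlas_def euclidean_atlas_def pfw_chart_def by auto

lemma pfw_chart_simps:
  "fst (pfw_chart a) = UNIV \<times> fst a" "snd (pfw_chart a) p = (fst p, snd a (snd p))"
  "chart_image (pfw_chart a) = UNIV \<times> chart_image a"
  unfolding pfw_chart_def prod_chart_def chart_image_def by (auto simp: map_prod_def split: prod.splits)

lemma pfw_chart_inv:
  assumes "is_chart a" "snd y \<in> chart_image a"
  shows "chart_inv (pfw_chart a) y = (fst y, chart_inv a (snd y))"
proof -
  let ?p = "(fst y, chart_inv a (snd y))"
  have inj: "inj_on (snd (pfw_chart a)) (fst (pfw_chart a))"
  proof (rule inj_onI)
    fix p q assume "p \<in> fst (pfw_chart a)" "q \<in> fst (pfw_chart a)" "snd (pfw_chart a) p = snd (pfw_chart a) q"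
    then have "fst p = fst q" "snd a (snd p) = snd a (snd q)" "snd p \<in> fst a" "snd q \<in> fst a"
      by (auto simp: pfw_chart_simps)
    then show "p = q" using chart_inv_left[OF assms(1)] by (metis prod_eqI)
  qed
  have 1: "?p \<in> fst (pfw_chart a)" using chart_inv_mem[OF assms] by (simp add: pfw_chart_simps)
  have "snd (pfw_chart a) ?p = y" using chart_inv_right[OF assms] by (simp add: pfw_chart_simps)
  then show ?thesis unfolding chart_inv_def[of "pfw_chart a"] using inv_into_f_f[OF inj 1] by simp
qed

lemma is_chart_pfw_chart:
  assumes a: "is_chart a"
  shows "is_chart (pfw_chart a)"
  unfolding is_chart_def homeomorphism_def
proof (intro conjI ballI)
  let ?c = "pfw_chart a"
  show "open (fst ?c)" "open (chart_image ?c)"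
    using chart_open[OF a] chart_image_open[OF a] by (auto simp: pfw_chart_simps open_Times)
  show "snd ?c ` fst ?c = chart_image ?c" by (simp add: chart_image_def)
  show l: "chart_inv ?c (snd ?c p) = p" if "p \<in> fst ?c" for p
  proof -
    have p: "snd p \<in> fst a" using that by (auto simp: pfw_chart_simps)
    then have "chart_inv ?c (snd ?c p) = (fst p, chart_inv a (snd a (snd p)))"
      by (subst pfw_chart_inv[OF a]) (simp_all add: pfw_chart_simps chart_image_mem)
    also have "\<dots> = p" using chart_inv_left[OF a p] by simp
    finally show ?thesis .
  qed
  show r: "snd ?c (chart_inv ?c y) = y" if "y \<in> chart_image ?c" for y
  proof -
    have "snd y \<in> chart_image a" using that by (auto simp: pfw_chart_simps)
    then show ?thesis using chart_inv_right[OF a] by (simp add: pfw_chart_inv[OF a] pfw_chart_simps)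
  qed
  show "chart_inv ?c ` chart_image ?c = fst ?c"
  proof
    show "chart_inv ?c ` chart_image ?c \<subseteq> fst ?c"
      using chart_inv_mem[OF a] by (auto simp: pfw_chart_inv[OF a] pfw_chart_simps)
    show "fst ?c \<subseteq> chart_inv ?c ` chart_image ?c"
    proof
      fix p assume p: "p \<in> fst ?c"
      show "p \<in> chart_inv ?c ` chart_image ?c"
        using l[OF p] chart_image_mem[OF p] by (rule subst[where P = "\<lambda>q. q \<in> _", OF _ imageI])
    qed
  qed
  have "continuous_on (UNIV \<times> fst a) (\<lambda>p. (fst p, snd a (snd p)))"
    by (intro continuous_on_Pair continuous_on_fst continuous_on_id
        continuous_on_compose2[OF chart_continuous[OF a] continuous_on_snd[OF continuous_on_id]]) auto
  then show "continuous_on (fst ?c) (snd ?c)"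
    unfolding pfw_chart_simps(1) by (rule continuous_on_eq) (simp add: pfw_chart_simps)
  have "continuous_on (UNIV \<times> chart_image a) (\<lambda>p. (fst p, chart_inv a (snd p)))"
    by (intro continuous_on_Pair continuous_on_fst continuous_on_id
        continuous_on_compose2[OF chart_inv_continuous[OF a] continuous_on_snd[OF continuous_on_id]]) auto
  then show "continuous_on (chart_image ?c) (chart_inv ?c)"
    unfolding pfw_chart_simps(3) by (rule continuous_on_eq) (auto simp: pfw_chart_inv[OF a])
qed

lemma chart_cover_pfw:
  assumes "chart_cover A"
  shows "chart_cover (pfw_atlas A)"
  unfolding chart_cover_def
proof
  show "\<forall>c\<in>pfw_atlas A. is_chart c"
    using is_chart_pfw_chart chart_cover_is_chart[OF assms] by (auto simp: pfw_atlas_eq)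
  show "(\<Union>c\<in>pfw_atlas A. fst c) = UNIV"
  proof (intro UNIV_eq_I[symmetric])
    fix p :: "'a pfw"
    obtain a where "a \<in> A" "snd p \<in> fst a" using chart_coverE[OF assms] by blast
    then have "pfw_chart a \<in> pfw_atlas A" "p \<in> fst (pfw_chart a)"
      by (cases p; simp add: pfw_atlas_eq pfw_chart_simps)+
    then show "p \<in> (\<Union>c\<in>pfw_atlas A. fst c)" by blast
  qed
qed

lemma smooth_scalar_on_linear_coordinate:
  assumes A: "chart_cover A" and L: "bounded_linear L"
  shows "smooth_scalar_on (pfw_atlas A) UNIV (\<lambda>p. L (fst p))"
  unfolding smooth_scalar_on_def
proof
  fix c assume "c \<in> pfw_atlas A"
  then obtain a where a: "a \<in> A" "c = pfw_chart a" by (auto simp: pfw_atlas_eq)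
  note ch = chart_cover_is_chart[OF A a(1)]
  have o: "open (snd c ` (fst c \<inter> UNIV))"
    by (rule chart_dom_open) (simp_all add: a(2) is_chart_pfw_chart[OF ch])
  have "smooth_on (snd c ` (fst c \<inter> UNIV)) (\<lambda>y. L (fst y))"
    by (rule smooth_on_bounded_linear[OF bounded_linear_compose[OF L bounded_linear_fst] o smooth_on_id, unfolded o_def])
  then show "smooth_on (snd c ` (fst c \<inter> UNIV)) ((\<lambda>p. L (fst p)) \<circ> chart_inv c)"
  proof (rule smooth_on_cong[OF o])
    fix y assume "y \<in> snd c ` (fst c \<inter> UNIV)"
    then have "snd y \<in> chart_image a" by (auto simp: a(2) pfw_chart_simps chart_image_mem)
    then show "L (fst y) = ((\<lambda>p. L (fst p)) \<circ> chart_inv c) y"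
      by (simp add: a(2) pfw_chart_inv[OF ch])
  qed
qed

lemma tangent_vec_linear_coordinate:
  assumes A: "chart_cover A" and L: "bounded_linear L" and a: "a \<in> A" "snd p \<in> fst a"
  shows "tangent_vec (pfw_atlas A) (pfw_chart a) p X (\<lambda>p. L (fst p)) = L (fst X)"
proof -
  note ch = chart_cover_is_chart[OF A a(1)]
  have near: "smooth_near (pfw_atlas A) p (\<lambda>p. L (fst p))"
    unfolding smooth_near_def using smooth_scalar_on_linear_coordinate[OF A L] by blast
  have "((\<lambda>y. L (fst y)) has_derivative (\<lambda>y. L (fst y))) (at (snd (pfw_chart a) p))"
    by (rule bounded_linear_imp_has_derivative[OF bounded_linear_compose[OF L bounded_linear_fst]])
  then have "(((\<lambda>p. L (fst p)) \<circ> chart_inv (pfw_chart a)) has_derivative (\<lambda>y. L (fst y))) (at (snd (pfw_chart a) p))"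
  proof (rule has_derivative_transform_within_open)
    show "open (chart_image (pfw_chart a))" by (rule chart_image_open[OF is_chart_pfw_chart[OF ch]])
    show "snd (pfw_chart a) p \<in> chart_image (pfw_chart a)"
      using a by (simp add: pfw_chart_simps chart_image_mem)
    fix y assume "y \<in> chart_image (pfw_chart a)"
    then have "snd y \<in> chart_image a" by (auto simp: pfw_chart_simps)
    then show "L (fst y) = ((\<lambda>p. L (fst p)) \<circ> chart_inv (pfw_chart a)) y"
      by (simp add: pfw_chart_inv[OF ch])
  qed
  from fun_cong[OF frechet_derivative_at[OF this], of X] near show ?thesis
    by (simp add: tangent_vec_def)
qed

lemma coord_eq: "coord_u = (\<lambda>p. fst (fst p))" "coord_v = (\<lambda>p. snd (fst p))"
  by (auto simp: coord_u_def coord_v_def)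

lemma smooth_map_pfw_snd:
  assumes A: "smooth_atlas A"
  shows "smooth_map (pfw_atlas A) A snd"
  unfolding smooth_map_def
proof (intro conjI ballI)
  show "continuous_on UNIV (snd :: 'a pfw \<Rightarrow> 'a)" by (intro continuous_intros)
  fix c b assume "c \<in> pfw_atlas A" and b: "b \<in> A"
  then obtain a where a: "a \<in> A" "c = pfw_chart a" by (auto simp: pfw_atlas_eq)
  note cov = smooth_atlas_chart_cover[OF A]
  note ch = chart_cover_is_chart[OF cov a(1)] and chb = chart_cover_is_chart[OF cov b]
  let ?T = "snd c ` (fst c \<inter> snd -` fst b)"
  have o: "open ?T"
    by (rule chart_dom_open) (simp_all add: a(2) is_chart_pfw_chart[OF ch] open_vimage_snd chart_open[OF chb])
  have 1: "smooth_on ?T (\<lambda>y. snd y)"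
    by (rule smooth_on_bounded_linear[OF bounded_linear_snd o smooth_on_id])
  have 2: "smooth_on (snd a ` (fst a \<inter> fst b)) (snd b \<circ> chart_inv a)"
    using A a b by (simp add: smooth_atlas_def)
  have "smooth_on ?T (\<lambda>y. (snd b \<circ> chart_inv a) (snd y))"
    by (rule smooth_on_compose[OF o 1 2]) (auto simp: a(2) pfw_chart_simps)
  then show "smooth_on ?T (snd b \<circ> snd \<circ> chart_inv c)"
  proof (rule smooth_on_cong[OF o])
    fix y assume "y \<in> ?T"
    then have "snd y \<in> chart_image a" by (auto simp: a(2) pfw_chart_simps chart_image_mem)
    then show "(snd b \<circ> chart_inv a) (snd y) = (snd b \<circ> snd \<circ> chart_inv c) y"
      by (simp add: a(2) pfw_chart_inv[OF ch])
  qed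
qed

lemma differential_snd_tangent_vec:
  assumes A: "smooth_atlas A" and a: "a \<in> A" "snd p \<in> fst a"
  shows "differential A snd p (tangent_vec (pfw_atlas A) (pfw_chart a) p X) = tangent_vec A a (snd p) (snd X)"
proof -
  note cov = smooth_atlas_chart_cover[OF A]
  note ch = chart_cover_is_chart[OF cov a(1)]
  let ?c = "pfw_chart a"
  have c: "?c \<in> pfw_atlas A" "p \<in> fst ?c"
    using a by (cases p; simp add: pfw_atlas_eq pfw_chart_simps)+
  have "(snd has_derivative (snd :: (real \<times> real) \<times> 'b \<Rightarrow> 'b)) (at (snd ?c p))"
    by (rule bounded_linear_imp_has_derivative[OF bounded_linear_snd])
  then have "((snd a \<circ> snd \<circ> chart_inv ?c) has_derivative snd) (at (snd ?c p))"
  proof (rule has_derivative_transform_within_open)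
    show "open (chart_image ?c)" by (rule chart_image_open[OF is_chart_pfw_chart[OF ch]])
    show "snd ?c p \<in> chart_image ?c" by (rule chart_image_mem[OF c(2)])
    fix y assume "y \<in> chart_image ?c"
    then have "snd y \<in> chart_image a" by (auto simp: pfw_chart_simps)
    then show "snd y = (snd a \<circ> snd \<circ> chart_inv ?c) y"
      by (simp add: pfw_chart_inv[OF ch] chart_inv_right[OF ch])
  qed
  from fun_cong[OF frechet_derivative_at[OF this], of X] show ?thesis
    using differential_tangent_vec[OF chart_cover_pfw[OF cov] cov smooth_map_pfw_snd[OF A] c a] by simp
qed

lemma pfw_metric_tangent_vec:
  assumes A: "smooth_atlas A" and a: "a \<in> A" "snd p \<in> fst a"
  shows "pfw_metric A g H p (tangent_vec (pfw_atlas A) (pfw_chart a) p X) (tangent_vec (pfw_atlas A) (pfw_chart a) p Y)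
    = H (fst (fst p)) (snd p) * fst (fst X) * fst (fst Y) + fst (fst X) * snd (fst Y) + snd (fst X) * fst (fst Y)
      + g (snd p) (tangent_vec A a (snd p) (snd X)) (tangent_vec A a (snd p) (snd Y))"
  using tangent_vec_linear_coordinate[OF smooth_atlas_chart_cover[OF A] bounded_linear_fst a]
    tangent_vec_linear_coordinate[OF smooth_atlas_chart_cover[OF A] bounded_linear_snd a]
    differential_snd_tangent_vec[OF A a]
  by (simp add: pfw_metric_def pullback_metric_def coord_eq)

lemma metric_in_chart_pfw:
  assumes A: "smooth_atlas A" and a: "a \<in> A" and y: "snd y \<in> chart_image a"
  shows "metric_in_chart (pfw_atlas A) (pfw_metric A g H) (pfw_chart a) y X Y
    = H (fst (fst y)) (chart_inv a (snd y)) * fst (fst X) * fst (fst Y) + fst (fst X) * snd (fst Y) + snd (fst X) * fst (fst Y)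
      + metric_in_chart A g a (snd y) (snd X) (snd Y)"
proof -
  note ch = chart_cover_is_chart[OF smooth_atlas_chart_cover[OF A] a]
  have p: "chart_inv (pfw_chart a) y = (fst y, chart_inv a (snd y))" by (rule pfw_chart_inv[OF ch y])
  have "snd (fst y, chart_inv a (snd y)) \<in> fst a" using chart_inv_mem[OF ch y] by simp
  from pfw_metric_tangent_vec[OF A a this, where g = g and H = H] show ?thesis
    unfolding metric_in_chart_def Let_def p by simp
qed

text \<open>
  Nondegeneracy is tested on \<open>\<partial>\<^sub>v\<close>, then on \<open>\<partial>\<^sub>u\<close>, then on vectors tangent to \<open>M\<close>: the \<open>u\<close>, \<open>v\<close> and \<open>M\<close>
  components of a degenerate vector vanish in this order.
\<close>

lemma metric_field_pfw:
  assumes pfw: "plane_fronted_wave A g H" and a: "a \<in> A"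
  shows "metric_field (UNIV \<times> chart_image a) (metric_in_chart (pfw_atlas A) (pfw_metric A g H) (pfw_chart a))"
proof -
  have A: "smooth_atlas A" and g: "riemannian_metric A g"
    and H: "smooth_scalar_on (pfw_atlas A) UNIV (\<lambda>p. H (coord_u p) (snd p))"
    using pfw by (auto simp: plane_fronted_wave_def riemannian_manifold_def)
  note ch = chart_cover_is_chart[OF smooth_atlas_chart_cover[OF A] a]
  interpret g: riemannian_field "chart_image a" "metric_in_chart A g a"
    by (rule riemannian_field_chart[OF g a ch chart_image_open[OF ch]]) simp
  let ?G = "metric_in_chart (pfw_atlas A) (pfw_metric A g H) (pfw_chart a)"
  let ?U = "(UNIV :: (real \<times> real) set) \<times> chart_image a"
  note G = metric_in_chart_pfw[OF A a, where g = g and H = H]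
  show ?thesis
  proof
    show o: "open ?U" using chart_image_open[OF ch] by (intro open_Times) auto
    fix y v w
    assume yU: "y \<in> ?U"
    then have y: "snd y \<in> chart_image a" by auto
    show "?G y v w = ?G y w v" unfolding G[OF y] using g.symm[OF y, of "snd v" "snd w"] by (simp add: mult_ac)
    show "bilinear (?G y)"
      unfolding bilinear_def
      by (intro conjI allI linearI)
        (simp_all add: G[OF y] g.add_left[OF y] g.add_right[OF y] g.scale_left[OF y] g.scale_right[OF y] algebra_simps)
    show "v = 0" if v: "\<And>w. ?G y v w = 0"
    proof -
      note z = linear_0[OF g.linear_left[OF y]] linear_0[OF g.linear_right[OF y]]
      have 1: "fst (fst v) = 0" using v[of "((0, 1), 0)"] by (simp add: G[OF y] z)
      have 2: "snd (fst v) = 0" using v[of "((1, 0), 0)"] 1 by (simp add: G[OF y] z)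
      have "metric_in_chart A g a (snd y) (snd v) w = 0" for w
        using v[of "((0, 0), w)"] 1 2 by (simp add: G[OF y])
      then have "snd v = 0" by (rule g.nondeg[OF y])
      with 1 2 show ?thesis by (simp add: prod_eq_iff)
    qed
    have "smooth_on (snd (pfw_chart a) ` (fst (pfw_chart a) \<inter> UNIV)) ((\<lambda>p. H (coord_u p) (snd p)) \<circ> chart_inv (pfw_chart a))"
      using H a by (simp add: smooth_scalar_on_def pfw_atlas_eq)
    then have "smooth_on ?U ((\<lambda>p. H (coord_u p) (snd p)) \<circ> chart_inv (pfw_chart a))"
      using pfw_chart_simps(3)[of a] by (simp add: chart_image_def)
    then have "smooth_on ?U (\<lambda>y. H (fst (fst y)) (chart_inv a (snd y)))"
      by (rule smooth_on_cong[OF o]) (auto simp: pfw_chart_inv[OF ch] coord_u_def)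
    then have 1: "(\<lambda>y. H (fst (fst y)) (chart_inv a (snd y))) differentiable (at y)"
      using yU by (rule smooth_on_differentiable)
    have "((\<lambda>y. metric_in_chart A g a (snd y) (snd v) (snd w)) has_derivative
        (\<lambda>x. g.dG (snd y) (snd x) (snd v) (snd w))) (at y)"
      by (rule has_derivative_compose[OF bounded_linear_imp_has_derivative[OF bounded_linear_snd] g.dG[OF y]])
    then have 2: "(\<lambda>y. metric_in_chart A g a (snd y) (snd v) (snd w)) differentiable (at y)"
      unfolding differentiable_def by blast
    have "(\<lambda>y. H (fst (fst y)) (chart_inv a (snd y)) * fst (fst v) * fst (fst w) + fst (fst v) * snd (fst w) + snd (fst v) * fst (fst w)
      + metric_in_chart A g a (snd y) (snd v) (snd w)) differentiable (at y)"
      using 1 2 by (intro differentiable_add differentiable_mult differentiable_const)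
    then obtain D where "((\<lambda>y. H (fst (fst y)) (chart_inv a (snd y)) * fst (fst v) * fst (fst w) + fst (fst v) * snd (fst w) + snd (fst v) * fst (fst w)
      + metric_in_chart A g a (snd y) (snd v) (snd w)) has_derivative D) (at y)" unfolding differentiable_def by blast
    then have "((\<lambda>y. ?G y v w) has_derivative D) (at y)"
      by (rule has_derivative_transform_within_open[OF _ o yU]) (auto simp: G)
    then show "(\<lambda>y. ?G y v w) differentiable (at y)" unfolding differentiable_def by blast
  qed
qed

text \<open>
  This is the parallelism of \<open>\<partial>\<^sub>v\<close>. In Koszul's formula with last argument \<open>\<partial>\<^sub>v\<close> every term vanishes, because
  \<open>\<langle>\<cdot>, \<partial>\<^sub>v\<rangle> = du\<close> has constant coefficients and the metric does not depend on \<open>v\<close>.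
\<close>

lemma levi_civita_pfw_u:
  assumes pfw: "plane_fronted_wave A g H" and a: "a \<in> A" and y: "snd y \<in> chart_image a"
  shows "fst (fst (levi_civita (metric_in_chart (pfw_atlas A) (pfw_metric A g H) (pfw_chart a)) y X Y)) = 0"
proof -
  have A: "smooth_atlas A" and g: "riemannian_metric A g"
    using pfw by (auto simp: plane_fronted_wave_def riemannian_manifold_def)
  note ch = chart_cover_is_chart[OF smooth_atlas_chart_cover[OF A] a]
  interpret g: riemannian_field "chart_image a" "metric_in_chart A g a"
    by (rule riemannian_field_chart[OF g a ch chart_image_open[OF ch]]) simp
  interpret G: metric_field "UNIV \<times> chart_image a" "metric_in_chart (pfw_atlas A) (pfw_metric A g H) (pfw_chart a)"
    by (rule metric_field_pfw[OF pfw a])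
  let ?G = "metric_in_chart (pfw_atlas A) (pfw_metric A g H) (pfw_chart a)"
  let ?e = "((0, 1), 0) :: (real \<times> real) \<times> 'b"
  note G = metric_in_chart_pfw[OF A a, where g = g and H = H]
  have yU: "y \<in> UNIV \<times> chart_image a" using y by (cases y) auto
  have e: "?G z V ?e = fst (fst V)" if "snd z \<in> chart_image a" for z V
    by (simp add: G[OF that] linear_0[OF g.linear_right[OF that]])
  have d0: "G.dG y V W ?e = 0" for V W
  proof (rule G.dG_unique[OF yU])
    show "((\<lambda>z. ?G z W ?e) has_derivative (\<lambda>x. 0)) (at y)"
      by (rule has_derivative_transform_within_open[OF has_derivative_const[of "fst (fst W)"] G.open_U yU]) (auto simp: e)
  qed
  have "G.dG y ?e V W = 0" for V W
  proof -
    let ?D = "\<lambda>x. G.dG y x V W"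
    have line: "((\<lambda>t. y + t *\<^sub>R ?e) has_derivative (\<lambda>t. t *\<^sub>R ?e)) (at (0::real))"
      by (auto intro!: derivative_eq_intros)
    have "((\<lambda>z. ?G z V W) has_derivative ?D) (at (y + 0 *\<^sub>R ?e))"
      using G.dG[OF yU, of V W] by (simp only: scaleR_zero_left add_0_right)
    from has_derivative_compose[OF line this]
    have "((\<lambda>t. ?G (y + t *\<^sub>R ?e) V W) has_derivative (\<lambda>t. ?D (t *\<^sub>R ?e))) (at 0)" .
    moreover have "?G (y + t *\<^sub>R ?e) V W = ?G y V W" for t
      using y by (simp add: G)
    ultimately have "((\<lambda>t::real. ?G y V W) has_derivative (\<lambda>t. ?D (t *\<^sub>R ?e))) (at 0)" by simp
    from has_derivative_unique[OF this has_derivative_const] have "?D (1 *\<^sub>R ?e) = 0" by meson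
    then show ?thesis by simp
  qed
  then have "2 * ?G y (levi_civita ?G y X Y) ?e = 0"
    using G.koszul_formula[OF yU G.is_levi_civita[OF yU], of X Y ?e] d0 by simp
  then show ?thesis by (simp add: e[OF y])
qed

lemma partial_v_eq:
  assumes A: "smooth_atlas A" and a: "a \<in> A" "snd p \<in> fst a"
  shows "partial_v A p = tangent_vec (pfw_atlas A) (pfw_chart a) p ((0, 1), 0)"
proof -
  let ?\<gamma> = "\<lambda>t. ((coord_u p, t), snd p)" and ?t = "coord_v p"
  have p: "?\<gamma> ?t = p" by (cases p) (simp add: coord_u_def coord_v_def prod_eq_iff)
  note cov = smooth_atlas_chart_cover[OF A]
  note ch = chart_cover_is_chart[OF cov a(1)]
  have "velocity (pfw_atlas A) ?\<gamma> ?t = tangent_vec (pfw_atlas A) (pfw_chart a) (?\<gamma> ?t) ((0, 1), 0)"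
  proof (rule velocity_eq_tangent_vec)
    show "pfw_chart a \<in> pfw_atlas A" using a by (simp add: pfw_atlas_eq)
    show "is_chart (pfw_chart a)" by (rule is_chart_pfw_chart[OF ch])
    show "?\<gamma> ?t \<in> fst (pfw_chart a)" using a by (simp add: pfw_chart_simps)
    show "isCont ?\<gamma> ?t" by (intro continuous_intros)
    have "snd (pfw_chart a) \<circ> ?\<gamma> = (\<lambda>t. ((coord_u p, t), snd a (snd p)))"
      by (auto simp: pfw_chart_simps)
    moreover have "((\<lambda>t. ((coord_u p, t), snd a (snd p))) has_vector_derivative ((0, 1), 0)) (at ?t)"
      by (intro has_vector_derivative_Pair has_vector_derivative_const has_vector_derivative_id)
    ultimately show "((snd (pfw_chart a) \<circ> ?\<gamma>) has_vector_derivative ((0, 1), 0)) (at ?t)" by simp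
  qed
  then show ?thesis unfolding partial_v_def p by simp
qed

section \<open>The Laplacian of u on a spacelike submanifold\<close>

text \<open>
  The \<open>u\<close>-component of the Gauss formula in a chart contains no ambient Christoffel term, by the previous
  section, so it reads \<open>Hess \<mu> = du(II)\<close>. Take traces; the factor is the one by which the mean
  curvature is normalised.
\<close>

lemma laplacian_u_eq_mean_curvature:
  fixes S :: "('s::topological_space, 'f::euclidean_space) chart set"
    and A :: "('m::topological_space, 'e::euclidean_space) chart set"
  assumes pfw: "plane_fronted_wave A g H"
    and sub: "spacelike_submanifold S (pfw_atlas A) (pfw_metric A g H) \<psi>"
  shows "laplacian S (pullback_metric (pfw_atlas A) (pfw_metric A g H) \<psi>) (coord_u \<circ> \<psi>) p
    = real DIM('f) * pfw_metric A g H (\<psi> p)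
        (mean_curvature S (pfw_atlas A) (pfw_metric A g H) \<psi> p) (partial_v A (\<psi> p))"
proof -
  have A: "smooth_atlas A" and g: "riemannian_metric A g"
    using pfw by (auto simp: plane_fronted_wave_def riemannian_manifold_def)
  have Sa: "smooth_atlas S" and \<psi>: "smooth_map S (pfw_atlas A) \<psi>"
    and r: "riemannian_metric S (pullback_metric (pfw_atlas A) (pfw_metric A g H) \<psi>)"
    using sub by (auto simp: spacelike_submanifold_def immersion_def)
  note covA = smooth_atlas_chart_cover[OF A] and covS = smooth_atlas_chart_cover[OF Sa]
  note covP = chart_cover_pfw[OF covA]
  define c where "c = chart_at S p"
  define d where "d = chart_at (pfw_atlas A) (\<psi> p)"
  have c: "c \<in> S" "p \<in> fst c" using chart_at_props[OF covS] by (auto simp: c_def)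
  have d: "d \<in> pfw_atlas A" "\<psi> p \<in> fst d" using chart_at_props[OF covP] by (auto simp: d_def)
  obtain a where a: "a \<in> A" "d = pfw_chart a" using d(1) by (auto simp: pfw_atlas_eq)
  have pa: "snd (\<psi> p) \<in> fst a" using d(2) by (auto simp: a(2) pfw_chart_simps)
  note chc = chart_cover_is_chart[OF covS c(1)] and cha = chart_cover_is_chart[OF covA a(1)]
  define G where "G = metric_in_chart S (pullback_metric (pfw_atlas A) (pfw_metric A g H) \<psi>) c"
  define G' where "G' = metric_in_chart (pfw_atlas A) (pfw_metric A g H) d"
  define \<Psi> where "\<Psi> = snd d \<circ> \<psi> \<circ> chart_inv c"
  define U where "U = snd c ` (fst c \<inter> \<psi> -` fst d)"
  define y where "y = snd c p"
  have U: "open U" and \<Psi>: "smooth_on U \<Psi>"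
    unfolding U_def \<Psi>_def using smooth_map_chart[OF covS covP \<psi> c(1) d(1)] by auto
  have y: "y \<in> U" using c d by (auto simp: U_def y_def)
  have Uc: "U \<subseteq> chart_image c" by (auto simp: U_def chart_image_def)
  interpret G: riemannian_field U G
    unfolding G_def by (rule riemannian_field_chart[OF r c(1) chc U Uc])
  define \<mu> where "\<mu> = (coord_u \<circ> \<psi>) \<circ> chart_inv c"
  have \<mu>\<Psi>: "\<mu> z = fst (fst (\<Psi> z))" for z
    by (simp add: \<mu>_def \<Psi>_def a(2) pfw_chart_simps coord_u_def)
  have L: "bounded_linear (\<lambda>x :: (real \<times> real) \<times> 'e. fst (fst x))"
    by (rule bounded_linear_compose[OF bounded_linear_fst bounded_linear_fst])
  have dP: "(\<Psi> has_derivative frechet_derivative \<Psi> (at z)) (at z)" if "z \<in> U" for z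
    by (rule smooth_on_has_derivative[OF \<Psi> that])
  have d1: "(\<mu> has_derivative (\<lambda>v. fst (fst (frechet_derivative \<Psi> (at z) v)))) (at z)" if "z \<in> U" for z
    unfolding \<mu>\<Psi>[abs_def] by (rule bounded_linear.has_derivative[OF L dP[OF that]])
  have d1': "frechet_derivative \<mu> (at z) v = fst (fst (frechet_derivative \<Psi> (at z) v))" if "z \<in> U" for z v
    using fun_cong[OF frechet_derivative_at[OF d1[OF that]], of v] by simp
  have d2P: "((\<lambda>z. frechet_derivative \<Psi> (at z) w) has_derivative
      frechet_derivative (\<lambda>z. frechet_derivative \<Psi> (at z) w) (at y)) (at y)" for w
    by (rule smooth_on_has_derivative[OF smooth_on_frechet[OF \<Psi>] y])
  have d2: "((\<lambda>z. frechet_derivative \<mu> (at z) w) has_derivative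
      (\<lambda>v. fst (fst (frechet_derivative (\<lambda>z. frechet_derivative \<Psi> (at z) w) (at y) v)))) (at y)" for w
    by (rule has_derivative_transform_within_open[OF bounded_linear.has_derivative[OF L d2P] U y]) (simp add: d1')
  have ex: "\<exists>E. orthonormal_frame (G y) E"
    by (rule inner_form.orthonormal_frame_exists[OF G.inner_form[OF y]])
  define E where "E = (SOME E. orthonormal_frame (G y) E)"
  have E: "orthonormal_frame (G y) E" unfolding E_def by (rule someI_ex[OF ex])
  define II where "II = (\<lambda>v w. second_fundamental_form G G' \<Psi> (\<lambda>_. v) (\<lambda>_. w) y)"
  have hess: "hessian G \<mu> y v w = fst (fst (II v w))" for v w
  proof -
    have "snd (\<Psi> y) \<in> chart_image a"
      using pa chart_inv_left[OF chc c(2)] by (simp add: \<Psi>_def y_def a(2) pfw_chart_simps chart_image_mem)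
    then have lc: "fst (fst (levi_civita G' (\<Psi> y) X Y)) = 0" for X Y
      unfolding G'_def a(2) by (rule levi_civita_pfw_u[OF pfw a(1)])
    have "hessian G \<mu> y v w = fst (fst (frechet_derivative (\<lambda>z. frechet_derivative \<Psi> (at z) w) (at y) v))
        - fst (fst (frechet_derivative \<Psi> (at y) (levi_civita G y v w)))"
      unfolding hessian_def d1'[OF y] using fun_cong[OF frechet_derivative_at[OF d2[of w]], of v] by simp
    moreover have "II v w = frechet_derivative (\<lambda>z. frechet_derivative \<Psi> (at z) w) (at y) v
        + levi_civita G' (\<Psi> y) (frechet_derivative \<Psi> (at y) v) (frechet_derivative \<Psi> (at y) w)
        - frechet_derivative \<Psi> (at y) (levi_civita G y v w)"
      by (simp add: II_def second_fundamental_form_def covariant_deriv_along_def covariant_deriv_def)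
    ultimately show ?thesis using lc by simp
  qed
  have "laplacian S (pullback_metric (pfw_atlas A) (pfw_metric A g H) \<psi>) (coord_u \<circ> \<psi>) p
      = divergence G (gradient G \<mu>) y"
    by (simp add: laplacian_def Let_def c_def G_def \<mu>_def y_def)
  also have "\<dots> = (\<Sum>e\<in>E. hessian G \<mu> y e e)"
  proof (rule G.laplacian_eq_frame_sum[OF y E])
    show "\<mu> differentiable (at z)" if "z \<in> U" for z using d1[OF that] unfolding differentiable_def by blast
    show "(\<lambda>z. frechet_derivative \<mu> (at z) w) differentiable (at y)" for w
      using d2[of w] unfolding differentiable_def by blast
  qed
  also have "\<dots> = fst (fst (\<Sum>e\<in>E. II e e))"
    by (simp add: hess fst_sum)
  finally have 1: "laplacian S (pullback_metric (pfw_atlas A) (pfw_metric A g H) \<psi>) (coord_u \<circ> \<psi>) p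
      = fst (fst (\<Sum>e\<in>E. II e e))" .
  have mc: "mean_curvature S (pfw_atlas A) (pfw_metric A g H) \<psi> p
      = tangent_vec (pfw_atlas A) (pfw_chart a) (\<psi> p) ((1 / real DIM('f)) *\<^sub>R (\<Sum>e\<in>E. II e e))"
    by (simp add: mean_curvature_def Let_def metric_trace_def E_def II_def G_def G'_def \<Psi>_def y_def
        c_def[symmetric] d_def[symmetric] a(2)[symmetric])
  have z: "g (snd (\<psi> p)) (tangent_vec A a (snd (\<psi> p)) X) (tangent_vec A a (snd (\<psi> p)) 0) = 0" for X
  proof -
    interpret g: riemannian_field "chart_image a" "metric_in_chart A g a"
      by (rule riemannian_field_chart[OF g a(1) cha chart_image_open[OF cha]]) simp
    from linear_0[OF g.linear_right[OF chart_image_mem[OF pa]]] show ?thesis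
      by (simp add: metric_in_chart_def chart_inv_left[OF cha pa] Let_def)
  qed
  have "pfw_metric A g H (\<psi> p) (mean_curvature S (pfw_atlas A) (pfw_metric A g H) \<psi> p) (partial_v A (\<psi> p))
      = (1 / real DIM('f)) * fst (fst (\<Sum>e\<in>E. II e e))"
    unfolding mc partial_v_eq[OF A a(1) pa] pfw_metric_tangent_vec[OF A a(1) pa] using z by simp
  then show ?thesis unfolding 1 by simp
qed

lemma smooth_coord_u:
  assumes pfw: "plane_fronted_wave A g H"
    and sub: "spacelike_submanifold S (pfw_atlas A) (pfw_metric A g H) \<psi>"
  shows "smooth_scalar_on S UNIV (coord_u \<circ> \<psi>)"
proof -
  have A: "smooth_atlas A" using pfw by (auto simp: plane_fronted_wave_def riemannian_manifold_def)
  have Sa: "smooth_atlas S" and \<psi>: "smooth_map S (pfw_atlas A) \<psi>"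
    using sub by (auto simp: spacelike_submanifold_def immersion_def)
  note covA = smooth_atlas_chart_cover[OF A] and covS = smooth_atlas_chart_cover[OF Sa]
  have "smooth_scalar_on (pfw_atlas A) UNIV coord_u"
    unfolding coord_eq by (rule smooth_scalar_on_linear_coordinate[OF covA bounded_linear_fst])
  from smooth_scalar_compose[OF covS chart_cover_pfw[OF covA] \<psi> open_UNIV this] show ?thesis by simp
qed

lemma superharmonic_uminus:
  assumes S: "smooth_atlas S" and g: "riemannian_metric S g"
    and f: "smooth_scalar_on S UNIV f" and lap: "\<And>p. 0 \<le> laplacian S g f p"
  shows "superharmonic S g (\<lambda>p. - f p)"
  unfolding superharmonic_def
proof (intro conjI allI)
  note cov = smooth_atlas_chart_cover[OF S]
  have sm: "smooth_on (chart_image c) (f \<circ> chart_inv c)" if "c \<in> S" for c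
    using f that by (simp add: smooth_scalar_on_def chart_image_def)
  have neg: "smooth_on (chart_image c) ((\<lambda>p. - f p) \<circ> chart_inv c)" if "c \<in> S" for c
    using smooth_on_bounded_linear[OF bounded_linear_minus[OF bounded_linear_ident] chart_image_open[OF chart_cover_is_chart[OF cov that]] sm[OF that]]
    by (simp add: o_def)
  show "smooth_scalar_on S UNIV (\<lambda>p. - f p)"
    using neg by (simp add: smooth_scalar_on_def chart_image_def)
  fix p
  define c where "c = chart_at S p"
  have c: "c \<in> S" "p \<in> fst c" using chart_at_props[OF cov] by (auto simp: c_def)
  note ch = chart_cover_is_chart[OF cov c(1)] and y = chart_image_mem[OF c(2)]
  define G where "G = metric_in_chart S g c"
  interpret G: riemannian_field "chart_image c" G
    unfolding G_def by (rule riemannian_field_chart[OF g c(1) ch chart_image_open[OF ch]]) simp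
  obtain E where E: "orthonormal_frame (G (snd c p)) E"
    using inner_form.orthonormal_frame_exists[OF G.inner_form[OF y]] by blast
  let ?F = "f \<circ> chart_inv c" and ?N = "(\<lambda>p. - f p) \<circ> chart_inv c"
  have N1: "frechet_derivative ?N (at z) v = - frechet_derivative ?F (at z) v" if "z \<in> chart_image c" for z v
    using fun_cong[OF frechet_derivative_at[OF has_derivative_minus[OF smooth_on_has_derivative[OF sm[OF c(1)] that]]], of v]
    by (simp add: o_def)
  have N2: "frechet_derivative (\<lambda>z. frechet_derivative ?N (at z) w) (at (snd c p)) v
      = - frechet_derivative (\<lambda>z. frechet_derivative ?F (at z) w) (at (snd c p)) v" for v w
  proof -
    have "((\<lambda>z. - frechet_derivative ?F (at z) w) has_derivative
        (\<lambda>v. - frechet_derivative (\<lambda>z. frechet_derivative ?F (at z) w) (at (snd c p)) v)) (at (snd c p))"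
      by (rule has_derivative_minus[OF smooth_on_has_derivative[OF smooth_on_frechet[OF sm[OF c(1)]] y]])
    then have "((\<lambda>z. frechet_derivative ?N (at z) w) has_derivative
        (\<lambda>v. - frechet_derivative (\<lambda>z. frechet_derivative ?F (at z) w) (at (snd c p)) v)) (at (snd c p))"
      by (rule has_derivative_transform_within_open[OF _ chart_image_open[OF ch] y]) (simp add: N1)
    from fun_cong[OF frechet_derivative_at[OF this], of v] show ?thesis by simp
  qed
  have lapF: "divergence G (gradient G h) (snd c p) = (\<Sum>e\<in>E. hessian G h (snd c p) e e)"
    if "smooth_on (chart_image c) h" for h
    by (rule G.laplacian_eq_frame_sum[OF y E smooth_on_differentiable[OF that]
          smooth_on_differentiable[OF smooth_on_frechet[OF that] y]])
  have "laplacian S g (\<lambda>p. - f p) p = divergence G (gradient G ?N) (snd c p)"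
    by (simp add: laplacian_def Let_def c_def G_def)
  also have "\<dots> = (\<Sum>e\<in>E. - hessian G ?F (snd c p) e e)"
    unfolding lapF[OF neg[OF c(1)]] by (simp add: hessian_def N1[OF y] N2)
  also have "\<dots> = - divergence G (gradient G ?F) (snd c p)"
    unfolding lapF[OF sm[OF c(1)]] by (simp add: sum_negf)
  also have "\<dots> = - laplacian S g f p"
    by (simp add: laplacian_def Let_def c_def G_def)
  finally show "laplacian S g (\<lambda>p. - f p) p \<le> 0" using lap[of p] by simp
qed

section \<open>Curves and their length\<close>

definition speed ::
    "('m::topological_space, 'e::euclidean_space) chart set \<Rightarrow> 'm metric_tensor \<Rightarrow> (real \<Rightarrow> 'm) \<Rightarrow> real \<Rightarrow> real" where
  "speed A g \<gamma> t = sqrt (g (\<gamma> t) (velocity A \<gamma> t) (velocity A \<gamma> t))"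

definition arc_length ::
    "('m::topological_space, 'e::euclidean_space) chart set \<Rightarrow> 'm metric_tensor \<Rightarrow> (real \<Rightarrow> 'm) \<Rightarrow> real \<Rightarrow> real \<Rightarrow> real" where
  "arc_length A g \<gamma> a b = integral {a..b} (speed A g \<gamma>)"

lemma curve_length_eq: "curve_length A g \<gamma> = arc_length A g \<gamma> 0 1"
  by (simp add: curve_length_def arc_length_def speed_def[abs_def])

lemma arc_length_cong:
  assumes "\<And>t. a < t \<Longrightarrow> t < b \<Longrightarrow> speed A g \<gamma> t = speed A' g' \<gamma>' t"
  shows "arc_length A g \<gamma> a b = arc_length A' g' \<gamma>' a b"
  unfolding arc_length_def integral_open_interval_real
  by (rule integral_cong) (use assms in auto)

lemma at_within_Int_open:
  assumes "open W" "s \<in> W"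
  shows "at s within (T \<inter> W) = at s within T"
  by (rule at_within_nhd[OF assms(2,1)]) auto

lemma continuous_on_open_vimageE:
  assumes "continuous_on T f" "open B"
  obtains W where "open W" "\<And>s. s \<in> T \<Longrightarrow> s \<in> W \<longleftrightarrow> f s \<in> B"
proof -
  obtain W where "open W" "W \<inter> T = f -` B \<inter> T"
    using assms unfolding continuous_on_open_invariant by blast
  then show ?thesis using that[of W] by blast
qed

lemma chart_nhd_in_interval:
  assumes "continuous_on T \<gamma>" "is_chart c"
  obtains W where "open W" "\<And>s. s \<in> T \<Longrightarrow> s \<in> W \<longleftrightarrow> \<gamma> s \<in> fst c"
  using continuous_on_open_vimageE[OF assms(1) chart_open[OF assms(2)]] by blast

text \<open>
  The chain rule for a curve followed by a smooth map. With the identity as the map it also passes from one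
  chart to another.
\<close>

lemma C1_chart_transfer:
  assumes c: "is_chart c"
    and \<Phi>: "smooth_on (snd c ` (fst c \<inter> F -` fst d)) (snd d \<circ> F \<circ> chart_inv c)"
    and W: "open W" and cont: "continuous_on ({a..b} \<inter> W) \<gamma>"
    and inc: "\<And>s. s \<in> {a..b} \<inter> W \<Longrightarrow> \<gamma> s \<in> fst c \<and> F (\<gamma> s) \<in> fst d"
    and D: "continuous_on ({a..b} \<inter> W) D"
      "\<And>s. s \<in> {a..b} \<inter> W \<Longrightarrow> ((snd c \<circ> \<gamma>) has_vector_derivative D s) (at s within {a..b})"
  defines "D' \<equiv> \<lambda>s. frechet_derivative (snd d \<circ> F \<circ> chart_inv c) (at (snd c (\<gamma> s))) (D s)"
  shows "continuous_on ({a..b} \<inter> W) D'"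
    "\<And>s. s \<in> {a..b} \<inter> W \<Longrightarrow> ((snd d \<circ> (F \<circ> \<gamma>)) has_vector_derivative D' s) (at s within {a..b})"
proof -
  let ?\<Phi> = "snd d \<circ> F \<circ> chart_inv c" and ?N = "{a..b} \<inter> W"
  have mem: "snd c (\<gamma> s) \<in> snd c ` (fst c \<inter> F -` fst d)" if "s \<in> ?N" for s
    by (rule imageI) (use inc[OF that] in blast)
  show "((snd d \<circ> (F \<circ> \<gamma>)) has_vector_derivative D' s) (at s within {a..b})" if s: "s \<in> ?N" for s
  proof -
    have sW: "s \<in> W" using s by blast
    have "(?\<Phi> has_derivative frechet_derivative ?\<Phi> (at (snd c (\<gamma> s)))) (at ((snd c \<circ> \<gamma>) s) within (snd c \<circ> \<gamma>) ` {a..b})"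
      unfolding o_apply[of "snd c" \<gamma> s]
      by (rule has_derivative_at_withinI[OF smooth_on_has_derivative[OF \<Phi> mem[OF s]]])
    from vector_derivative_diff_chain_within[OF D(2)[OF s] this]
    have "((?\<Phi> \<circ> (snd c \<circ> \<gamma>)) has_vector_derivative D' s) (at s within ?N)"
      unfolding D'_def at_within_Int_open[OF W sW] .
    then have "((snd d \<circ> (F \<circ> \<gamma>)) has_vector_derivative D' s) (at s within ?N)"
    proof (rule has_vector_derivative_transform[OF s, rotated])
      fix r assume "r \<in> ?N"
      then show "(snd d \<circ> (F \<circ> \<gamma>)) r = (?\<Phi> \<circ> (snd c \<circ> \<gamma>)) r"
        using inc[of r] by (simp add: chart_inv_left[OF c])
    qed
    then show ?thesis unfolding at_within_Int_open[OF W sW] .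
  qed
  show "continuous_on ?N D'"
    unfolding D'_def
  proof (rule linear_family_continuous_on[where A = "\<lambda>s. frechet_derivative ?\<Phi> (at (snd c (\<gamma> s)))" and D = D])
    show "linear (frechet_derivative ?\<Phi> (at (snd c (\<gamma> s))))" if "s \<in> ?N" for s
      by (rule has_derivative_linear[OF smooth_on_has_derivative[OF \<Phi> mem[OF that]]])
    have "continuous_on ?N (\<lambda>s. snd c (\<gamma> s))"
      by (rule continuous_on_compose2[OF chart_continuous[OF c] cont]) (use inc in blast)
    then show "continuous_on ?N (\<lambda>s. frechet_derivative ?\<Phi> (at (snd c (\<gamma> s))) v)" for v
      by (rule continuous_on_compose2[OF smooth_on_continuous_on[OF smooth_on_frechet[OF \<Phi>]]])
        (use mem in auto)
  qed (rule D(1))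
qed

text \<open>
  The definition asks for continuous derivatives in every chart of the atlas. It is enough to have them
  near each time in a single chart, since transition maps are smooth and one-sided derivatives on a
  nontrivial interval are unique, which makes the local ones fit together.
\<close>

lemma C1_curve_on_localI:
  assumes A: "smooth_atlas A" and ab: "a < b" and cont: "continuous_on {a..b} \<gamma>"
    and loc: "\<And>t. t \<in> {a..b} \<Longrightarrow> \<exists>c\<in>A. \<exists>W D. open W \<and> t \<in> W \<and> \<gamma> ` ({a..b} \<inter> W) \<subseteq> fst c \<and>
      continuous_on ({a..b} \<inter> W) D \<and>
      (\<forall>s\<in>{a..b} \<inter> W. ((snd c \<circ> \<gamma>) has_vector_derivative D s) (at s within {a..b}))"
  shows "C1_curve_on A \<gamma> a b"
  unfolding C1_curve_on_def
proof (intro conjI cont ballI)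
  fix c' assume c': "c' \<in> A"
  note cov = smooth_atlas_chart_cover[OF A]
  note ch' = chart_cover_is_chart[OF cov c']
  let ?X = "{a..b} \<inter> \<gamma> -` fst c'"
  define D' where "D' = (\<lambda>s. vector_derivative (snd c' \<circ> \<gamma>) (at s within {a..b}))"
  have key: "\<exists>W. open W \<and> t \<in> W \<and> continuous_on ({a..b} \<inter> W) D' \<and>
      (\<forall>s\<in>{a..b} \<inter> W. ((snd c' \<circ> \<gamma>) has_vector_derivative D' s) (at s within {a..b}))" if t: "t \<in> ?X" for t
  proof -
    obtain c W D where c: "c \<in> A" and W: "open W" "t \<in> W" "\<gamma> ` ({a..b} \<inter> W) \<subseteq> fst c"
      and D: "continuous_on ({a..b} \<inter> W) D"
        "\<And>s. s \<in> {a..b} \<inter> W \<Longrightarrow> ((snd c \<circ> \<gamma>) has_vector_derivative D s) (at s within {a..b})"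
      using loc t by (metis IntD1)
    obtain W' where W': "open W'" "\<And>s. s \<in> {a..b} \<Longrightarrow> s \<in> W' \<longleftrightarrow> \<gamma> s \<in> fst c'"
      using chart_nhd_in_interval[OF cont ch'] by blast
    let ?N = "{a..b} \<inter> (W \<inter> W')"
    let ?E = "\<lambda>s. frechet_derivative (snd c' \<circ> (\<lambda>x. x) \<circ> chart_inv c) (at (snd c (\<gamma> s))) (D s)"
    have "smooth_on (snd c ` (fst c \<inter> (\<lambda>x. x) -` fst c')) (snd c' \<circ> (\<lambda>x. x) \<circ> chart_inv c)"
      using A c c' by (simp add: smooth_atlas_def o_def)
    note tr = C1_chart_transfer[where F = "\<lambda>x. x" and d = c' and W = "W \<inter> W'" and \<gamma> = \<gamma> and D = D and a = a and b = b,
        OF chart_cover_is_chart[OF cov c] this]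
    have E: "continuous_on ?N ?E"
      "\<And>s. s \<in> ?N \<Longrightarrow> ((snd c' \<circ> ((\<lambda>x. x) \<circ> \<gamma>)) has_vector_derivative ?E s) (at s within {a..b})"
      by (rule tr; use W W' in \<open>auto intro: D(2) continuous_on_subset[OF D(1)] continuous_on_subset[OF cont]\<close>)+
    have D'_eq: "D' s = ?E s" if "s \<in> ?N" for s
      unfolding D'_def using ab that E(2)[OF that] by (intro vector_derivative_within_closed_interval) (auto simp: o_def)
    show ?thesis
    proof (intro exI[of _ "W \<inter> W'"] conjI ballI)
      show "open (W \<inter> W')" using W(1) W'(1) by (rule open_Int)
      show "t \<in> W \<inter> W'" using t W(2) W'(2) by auto
      show "continuous_on ?N D'" using E(1) by (rule continuous_on_eq) (simp add: D'_eq)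
      show "((snd c' \<circ> \<gamma>) has_vector_derivative D' s) (at s within {a..b})" if "s \<in> ?N" for s
        using E(2)[OF that] by (simp add: D'_eq[OF that] o_def)
    qed
  qed
  show "\<exists>D. continuous_on ?X D \<and> (\<forall>t\<in>?X. ((snd c' \<circ> \<gamma>) has_vector_derivative D t) (at t within {a..b}))"
  proof (intro exI[of _ D'] conjI ballI)
    show "((snd c' \<circ> \<gamma>) has_vector_derivative D' t) (at t within {a..b})" if "t \<in> ?X" for t
      using key[OF that] that by blast
    show "continuous_on ?X D'"
      unfolding continuous_on_eq_continuous_within
    proof
      fix t assume t: "t \<in> ?X"
      then obtain W where W: "open W" "t \<in> W" "continuous_on ({a..b} \<inter> W) D'" using key by blast
      have "continuous (at t within ({a..b} \<inter> W)) D'"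
        using W t unfolding continuous_on_eq_continuous_within by blast
      then have "continuous (at t within {a..b}) D'"
        using at_within_Int_open[OF W(1,2)] by metis
      then show "continuous (at t within ?X) D'" by (rule continuous_within_subset) auto
    qed
  qed
qed

lemma C1_curve_onD:
  assumes "C1_curve_on A \<gamma> a b" "c \<in> A"
  obtains D where "continuous_on ({a..b} \<inter> \<gamma> -` fst c) D"
    "\<And>t. t \<in> {a..b} \<Longrightarrow> \<gamma> t \<in> fst c \<Longrightarrow> ((snd c \<circ> \<gamma>) has_vector_derivative D t) (at t within {a..b})"
  using assms unfolding C1_curve_on_def by blast

lemma C1_curve_on_continuous: "C1_curve_on A \<gamma> a b \<Longrightarrow> continuous_on {a..b} \<gamma>"
  by (simp add: C1_curve_on_def)

lemma C1_curve_on_subinterval: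
  assumes "C1_curve_on A \<gamma> a b" "a \<le> a'" "b' \<le> b"
  shows "C1_curve_on A \<gamma> a' b'"
  unfolding C1_curve_on_def
proof (intro conjI ballI)
  have sub: "{a'..b'} \<subseteq> {a..b}" using assms(2,3) by auto
  show "continuous_on {a'..b'} \<gamma>" using C1_curve_on_continuous[OF assms(1)] sub by (rule continuous_on_subset)
  fix c assume "c \<in> A"
  obtain D where D: "continuous_on ({a..b} \<inter> \<gamma> -` fst c) D"
    "\<And>t. t \<in> {a..b} \<Longrightarrow> \<gamma> t \<in> fst c \<Longrightarrow> ((snd c \<circ> \<gamma>) has_vector_derivative D t) (at t within {a..b})"
    using C1_curve_onD[OF assms(1) \<open>c \<in> A\<close>] by blast
  show "\<exists>D. continuous_on ({a'..b'} \<inter> \<gamma> -` fst c) D \<and>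
      (\<forall>t\<in>{a'..b'} \<inter> \<gamma> -` fst c. ((snd c \<circ> \<gamma>) has_vector_derivative D t) (at t within {a'..b'}))"
  proof (intro exI[of _ D] conjI ballI)
    show "continuous_on ({a'..b'} \<inter> \<gamma> -` fst c) D" by (rule continuous_on_subset[OF D(1)]) (use sub in auto)
    fix t assume t: "t \<in> {a'..b'} \<inter> \<gamma> -` fst c"
    have "((snd c \<circ> \<gamma>) has_vector_derivative D t) (at t within {a..b})"
      by (rule D(2)) (use t sub in auto)
    then show "((snd c \<circ> \<gamma>) has_vector_derivative D t) (at t within {a'..b'})"
      using sub by (rule has_vector_derivative_within_subset)
  qed
qed

lemma C1_curve_on_cong:
  assumes C: "C1_curve_on A \<gamma> a b" and eq: "\<And>t. t \<in> {a..b} \<Longrightarrow> \<gamma>' t = \<gamma> t"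
  shows "C1_curve_on A \<gamma>' a b"
  unfolding C1_curve_on_def
proof (intro conjI ballI)
  show "continuous_on {a..b} \<gamma>'"
    by (rule continuous_on_eq[OF C1_curve_on_continuous[OF C]]) (simp add: eq)
  fix c assume "c \<in> A"
  obtain D where D: "continuous_on ({a..b} \<inter> \<gamma> -` fst c) D"
    "\<And>t. t \<in> {a..b} \<Longrightarrow> \<gamma> t \<in> fst c \<Longrightarrow> ((snd c \<circ> \<gamma>) has_vector_derivative D t) (at t within {a..b})"
    using C1_curve_onD[OF C \<open>c \<in> A\<close>] by blast
  have X: "{a..b} \<inter> \<gamma>' -` fst c = {a..b} \<inter> \<gamma> -` fst c" using eq by auto
  show "\<exists>D. continuous_on ({a..b} \<inter> \<gamma>' -` fst c) D \<and>
      (\<forall>t\<in>{a..b} \<inter> \<gamma>' -` fst c. ((snd c \<circ> \<gamma>') has_vector_derivative D t) (at t within {a..b}))"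
    unfolding X
  proof (intro exI[of _ D] conjI ballI D(1))
    fix t assume t: "t \<in> {a..b} \<inter> \<gamma> -` fst c"
    show "((snd c \<circ> \<gamma>') has_vector_derivative D t) (at t within {a..b})"
    proof (rule has_vector_derivative_transform)
      show "t \<in> {a..b}" using t by blast
      show "((snd c \<circ> \<gamma>) has_vector_derivative D t) (at t within {a..b})"
        by (rule D(2)) (use t in auto)
    qed (simp add: eq)
  qed
qed

lemma C1_curve_on_affine:
  assumes C: "C1_curve_on A \<gamma> a b" and img: "(\<lambda>t. k * t + m) ` {a'..b'} = {a..b}"
  shows "C1_curve_on A (\<lambda>t. \<gamma> (k * t + m)) a' b'"
  unfolding C1_curve_on_def
proof (intro conjI ballI)
  let ?\<phi> = "\<lambda>t. k * t + m"
  have cont\<phi>: "continuous_on T ?\<phi>" for T by (intro continuous_intros)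
  show "continuous_on {a'..b'} (\<lambda>t. \<gamma> (?\<phi> t))"
    by (rule continuous_on_compose2[OF C1_curve_on_continuous[OF C] cont\<phi>]) (use img in auto)
  fix c assume "c \<in> A"
  obtain D where D: "continuous_on ({a..b} \<inter> \<gamma> -` fst c) D"
    "\<And>t. t \<in> {a..b} \<Longrightarrow> \<gamma> t \<in> fst c \<Longrightarrow> ((snd c \<circ> \<gamma>) has_vector_derivative D t) (at t within {a..b})"
    using C1_curve_onD[OF C \<open>c \<in> A\<close>] by blast
  have im: "?\<phi> t \<in> {a..b}" if "t \<in> {a'..b'}" for t using img that by blast
  show "\<exists>D. continuous_on ({a'..b'} \<inter> (\<lambda>t. \<gamma> (?\<phi> t)) -` fst c) D \<and>
      (\<forall>t\<in>{a'..b'} \<inter> (\<lambda>t. \<gamma> (?\<phi> t)) -` fst c. ((snd c \<circ> (\<lambda>t. \<gamma> (?\<phi> t))) has_vector_derivative D t) (at t within {a'..b'}))"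
  proof (intro exI[of _ "\<lambda>t. k *\<^sub>R D (?\<phi> t)"] conjI ballI)
    show "continuous_on ({a'..b'} \<inter> (\<lambda>t. \<gamma> (?\<phi> t)) -` fst c) (\<lambda>t. k *\<^sub>R D (?\<phi> t))"
      by (intro continuous_on_scaleR continuous_on_const continuous_on_compose2[OF D(1) cont\<phi>]) (use im in auto)
    fix t assume t: "t \<in> {a'..b'} \<inter> (\<lambda>t. \<gamma> (?\<phi> t)) -` fst c"
    have 1: "(?\<phi> has_vector_derivative k) (at t within {a'..b'})"
      by (auto intro!: derivative_eq_intros simp: has_real_derivative_iff_has_vector_derivative[symmetric])
    have "((snd c \<circ> \<gamma>) has_vector_derivative D (?\<phi> t)) (at (?\<phi> t) within ?\<phi> ` {a'..b'})"
      unfolding img by (rule D(2)) (use t im in auto)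
    from vector_diff_chain_within[OF 1 this]
    show "((snd c \<circ> (\<lambda>t. \<gamma> (?\<phi> t))) has_vector_derivative k *\<^sub>R D (?\<phi> t)) (at t within {a'..b'})"
      by (simp add: o_def)
  qed
qed

locale riemannian_atlas =
  fixes A :: "('m::t2_space, 'e::euclidean_space) chart set" and g :: "'m metric_tensor"
  assumes atlas: "smooth_atlas A" and metric: "riemannian_metric A g"
begin

lemmas cover = smooth_atlas_chart_cover[OF atlas]
lemmas is_chart = chart_cover_is_chart[OF cover]

lemma chart_field: "c \<in> A \<Longrightarrow> riemannian_field (chart_image c) (metric_in_chart A g c)"
  by (rule riemannian_field_chart[OF metric _ is_chart chart_image_open[OF is_chart]]) simp_all

lemma metric_continuous:
  assumes "c \<in> A"
  shows "continuous_on (chart_image c) (\<lambda>z. metric_in_chart A g c z v w)"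
proof -
  interpret riemannian_field "chart_image c" "metric_in_chart A g c" by (rule chart_field[OF assms])
  show ?thesis
    using diff differentiable_imp_continuous_within by (intro continuous_at_imp_continuous_on ballI) blast
qed

text \<open>
  Restricted to interior times: at the ends of the interval \<open>velocity\<close> is a two-sided derivative and may
  take arbitrary values. Lengths are therefore computed on open intervals below.
\<close>

lemma speed_in_chart:
  assumes c: "c \<in> A" "\<gamma> t \<in> fst c" and t: "a < t" "t < b" and cont: "continuous_on {a..b} \<gamma>"
    and D: "((snd c \<circ> \<gamma>) has_vector_derivative D) (at t within {a..b})"
  shows "speed A g \<gamma> t = sqrt (metric_in_chart A g c (snd c (\<gamma> t)) D D)"
proof -
  have at: "at t within {a..b} = at t" using t by (rule at_within_Icc_at)
  have "t \<in> {a..b}" using t by simp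
  then have "continuous (at t within {a..b}) \<gamma>"
    using cont unfolding continuous_on_eq_continuous_within by blast
  then have "isCont \<gamma> t" "((snd c \<circ> \<gamma>) has_vector_derivative D) (at t)"
    using D unfolding at by auto
  then have "velocity A \<gamma> t = tangent_vec A c (\<gamma> t) D"
    by (intro velocity_eq_tangent_vec c is_chart)
  then show ?thesis
    by (simp add: speed_def metric_in_chart_def Let_def chart_inv_left[OF is_chart[OF c(1)] c(2)])
qed

lemma speed_in_chart_C1:
  assumes C: "C1_curve_on A \<gamma> a b" and t: "a < t" "t < b"
  obtains c D where "c \<in> A" "\<gamma> t \<in> fst c" "((snd c \<circ> \<gamma>) has_vector_derivative D) (at t within {a..b})"
    "speed A g \<gamma> t = sqrt (metric_in_chart A g c (snd c (\<gamma> t)) D D)"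
proof -
  obtain c where c: "c \<in> A" "\<gamma> t \<in> fst c" using chart_coverE[OF cover] by blast
  obtain D where "\<And>t. t \<in> {a..b} \<Longrightarrow> \<gamma> t \<in> fst c \<Longrightarrow> ((snd c \<circ> \<gamma>) has_vector_derivative D t) (at t within {a..b})"
    using C1_curve_onD[OF C c(1)] by blast
  then have D: "((snd c \<circ> \<gamma>) has_vector_derivative D t) (at t within {a..b})" using t c by auto
  show ?thesis
    by (rule that[OF c D speed_in_chart[OF c t C1_curve_on_continuous[OF C] D]])
qed

lemma speed_nonneg:
  assumes C: "C1_curve_on A \<gamma> a b" and t: "a < t" "t < b"
  shows "0 \<le> speed A g \<gamma> t"
proof -
  obtain c D where c: "c \<in> A" "\<gamma> t \<in> fst c"
    and s: "speed A g \<gamma> t = sqrt (metric_in_chart A g c (snd c (\<gamma> t)) D D)"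
    using speed_in_chart_C1[OF C t] by blast
  interpret riemannian_field "chart_image c" "metric_in_chart A g c" by (rule chart_field[OF c(1)])
  have y: "snd c (\<gamma> t) \<in> chart_image c" by (rule chart_image_mem[OF c(2)])
  have "0 \<le> metric_in_chart A g c (snd c (\<gamma> t)) D D"
    using pos[OF y, of D] linear_0[OF linear_left[OF y]] by (cases "D = 0") auto
  then show ?thesis unfolding s by simp
qed

text \<open>
  Near each time the speed agrees, except at the two ends, with a function that is continuous up to the
  ends, namely the length in a chart of the one-sided velocity.
\<close>

lemma speed_integrable:
  assumes C: "C1_curve_on A \<gamma> a b"
  shows "speed A g \<gamma> integrable_on {a..b}"
proof -
  have "speed A g \<gamma> integrable_on cbox a b"
  proof (rule integrable_on_little_subintervals, rule ballI)
    fix x assume "x \<in> cbox a b"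
    obtain c where c: "c \<in> A" "\<gamma> x \<in> fst c" using chart_coverE[OF cover] by blast
    obtain D where D: "continuous_on ({a..b} \<inter> \<gamma> -` fst c) D"
      "\<And>t. t \<in> {a..b} \<Longrightarrow> \<gamma> t \<in> fst c \<Longrightarrow> ((snd c \<circ> \<gamma>) has_vector_derivative D t) (at t within {a..b})"
      using C1_curve_onD[OF C c(1)] by blast
    note cont = C1_curve_on_continuous[OF C]
    obtain W where W: "open W" "\<And>s. s \<in> {a..b} \<Longrightarrow> s \<in> W \<longleftrightarrow> \<gamma> s \<in> fst c"
      using chart_nhd_in_interval[OF cont is_chart[OF c(1)]] by blast
    have "x \<in> W" using W(2) c(2) \<open>x \<in> cbox a b\<close> by auto
    then obtain d where d: "d > 0" "ball x d \<subseteq> W" using W(1) openE by blast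
    interpret riemannian_field "chart_image c" "metric_in_chart A g c" by (rule chart_field[OF c(1)])
    have "speed A g \<gamma> integrable_on cbox u v"
      if uv: "x \<in> cbox u v" "cbox u v \<subseteq> ball x d" "cbox u v \<subseteq> cbox a b" for u v
    proof (rule integrable_spike_finite[of "{a, b}"])
      have sub: "cbox u v \<subseteq> {a..b} \<inter> \<gamma> -` fst c" using uv d(2) W(2) by auto
      have "continuous_on (cbox u v) (\<lambda>t. snd c (\<gamma> t))"
        by (rule continuous_on_compose2[OF chart_continuous[OF is_chart[OF c(1)]] continuous_on_subset[OF cont]])
          (use sub in auto)
      moreover have "(\<lambda>t. snd c (\<gamma> t)) ` cbox u v \<subseteq> chart_image c"
        by (rule image_subsetI, rule chart_image_mem) (use sub in blast)
      ultimately have "continuous_on (cbox u v) (\<lambda>t. metric_in_chart A g c (snd c (\<gamma> t)) a' b')" for a' b'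
        by (rule continuous_on_compose2[OF metric_continuous[OF c(1)]])
      moreover have "bilinear (metric_in_chart A g c (snd c (\<gamma> t)))" if "t \<in> cbox u v" for t
        by (rule bil[OF chart_image_mem]) (use sub that in blast)
      moreover have "continuous_on (cbox u v) D" by (rule continuous_on_subset[OF D(1) sub])
      ultimately have "continuous_on (cbox u v) (\<lambda>t. metric_in_chart A g c (snd c (\<gamma> t)) (D t) (D t))"
        by (intro bilinear_family_continuous_on[where G = "\<lambda>t. metric_in_chart A g c (snd c (\<gamma> t))" and P = D and Q = D])
      then show "(\<lambda>t. sqrt (metric_in_chart A g c (snd c (\<gamma> t)) (D t) (D t))) integrable_on cbox u v"
        by (intro integrable_continuous continuous_on_real_sqrt)
      fix t assume "t \<in> cbox u v - {a, b}"
      then have "a < t" "t < b" "\<gamma> t \<in> fst c" "t \<in> {a..b}" using sub by auto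
      then show "speed A g \<gamma> t = sqrt (metric_in_chart A g c (snd c (\<gamma> t)) (D t) (D t))"
        using speed_in_chart[OF c(1) _ _ _ cont D(2)] by blast
    qed simp
    then show "\<exists>d>0. \<forall>u v. x \<in> cbox u v \<and> cbox u v \<subseteq> ball x d \<and> cbox u v \<subseteq> cbox a b \<longrightarrow>
        speed A g \<gamma> integrable_on cbox u v" using d(1) by blast
  qed
  then show ?thesis by simp
qed

lemma arc_length_nonneg:
  assumes C: "C1_curve_on A \<gamma> a b"
  shows "0 \<le> arc_length A g \<gamma> a b"
  unfolding arc_length_def integral_open_interval_real
proof (rule integral_nonneg)
  show "speed A g \<gamma> integrable_on {a<..<b}" using speed_integrable[OF C] by (simp add: integrable_on_open_interval_real)
qed (use speed_nonneg[OF C] in auto)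

lemma arc_length_combine:
  assumes C: "C1_curve_on A \<gamma> a b" and "a \<le> s" "s \<le> t" "t \<le> b"
  shows "arc_length A g \<gamma> a s + arc_length A g \<gamma> s t = arc_length A g \<gamma> a t"
  unfolding arc_length_def using assms(2,3)
  by (rule Henstock_Kurzweil_Integration.integral_combine) (rule speed_integrable[OF C1_curve_on_subinterval[OF C order_refl assms(4)]])

lemma arc_length_C1_cong:
  assumes C: "C1_curve_on A \<gamma> a b" and eq: "\<And>t. t \<in> {a..b} \<Longrightarrow> \<gamma>' t = \<gamma> t"
  shows "arc_length A g \<gamma>' a b = arc_length A g \<gamma> a b"
proof (rule arc_length_cong)
  fix t assume t: "a < t" "t < b"
  obtain c D where c: "c \<in> A" "\<gamma> t \<in> fst c"
    and D: "((snd c \<circ> \<gamma>) has_vector_derivative D) (at t within {a..b})"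
    and s: "speed A g \<gamma> t = sqrt (metric_in_chart A g c (snd c (\<gamma> t)) D D)"
    using speed_in_chart_C1[OF C t] by blast
  have tt: "t \<in> {a..b}" using t by auto
  have "((snd c \<circ> \<gamma>') has_vector_derivative D) (at t within {a..b})"
    by (rule has_vector_derivative_transform[OF tt _ D]) (simp add: eq)
  then have "speed A g \<gamma>' t = sqrt (metric_in_chart A g c (snd c (\<gamma>' t)) D D)"
    using c eq[OF tt] by (intro speed_in_chart[OF _ _ t C1_curve_on_continuous[OF C1_curve_on_cong[OF C eq]]]) auto
  then show "speed A g \<gamma>' t = speed A g \<gamma> t" using s eq[OF tt] by simp
qed

lemma arc_length_affine:
  assumes C: "C1_curve_on A \<gamma> a b" and img: "(\<lambda>t. k * t + m) ` {a'..b'} = {a..b}"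
    and k: "k \<noteq> 0" and ab: "a < b"
  shows "arc_length A g (\<lambda>t. \<gamma> (k * t + m)) a' b' = arc_length A g \<gamma> a b"
proof -
  let ?\<phi> = "\<lambda>t. k * t + m"
  have inj: "inj ?\<phi>" using k by (auto simp: inj_def)
  have ab': "a' < b'"
  proof (rule ccontr)
    assume "\<not> a' < b'"
    then have "{a'..b'} \<subseteq> {a'}" by auto
    then have "{a..b} \<subseteq> {?\<phi> a'}" using img by blast
    moreover have "a \<in> {a..b}" "b \<in> {a..b}" using ab by auto
    ultimately have "a = ?\<phi> a'" "b = ?\<phi> a'" by blast+
    then show False using ab by simp
  qed
  \<comment> \<open>in this order if \<open>k > 0\<close>, and exchanged otherwise\<close>
  have ends: "{a, b} = {?\<phi> a', ?\<phi> b'}"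
  proof (cases "k > 0")
    case True
    have "?\<phi> ` {a'..b'} = {?\<phi> a'..?\<phi> b'}" using True ab' by (simp add: image_affinity_atLeastAtMost)
    then show ?thesis using img ab by (simp add: Icc_eq_Icc)
  next
    case False
    have "?\<phi> ` {a'..b'} = {?\<phi> b'..?\<phi> a'}" using False ab' by (simp add: image_affinity_atLeastAtMost)
    then show ?thesis using img ab by (auto simp add: Icc_eq_Icc)
  qed
  have sp: "speed A g (\<lambda>t. \<gamma> (?\<phi> t)) t = \<bar>k\<bar> * speed A g \<gamma> (?\<phi> t)" if t: "a' < t" "t < b'" for t
  proof -
    have "t \<in> {a'..b'}" using t by auto
    then have 1: "?\<phi> t \<in> {a..b}" using img by blast
    have "?\<phi> t \<noteq> a" "?\<phi> t \<noteq> b" using ends t injD[OF inj, of t a'] injD[OF inj, of t b'] by (auto simp: doubleton_eq_iff)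
    with 1 have \<phi>t: "a < ?\<phi> t" "?\<phi> t < b" by auto
    obtain c D where c: "c \<in> A" "\<gamma> (?\<phi> t) \<in> fst c"
      and D: "((snd c \<circ> \<gamma>) has_vector_derivative D) (at (?\<phi> t) within {a..b})"
      and s: "speed A g \<gamma> (?\<phi> t) = sqrt (metric_in_chart A g c (snd c (\<gamma> (?\<phi> t))) D D)"
      using speed_in_chart_C1[OF C \<phi>t] by blast
    interpret riemannian_field "chart_image c" "metric_in_chart A g c" by (rule chart_field[OF c(1)])
    have y: "snd c (\<gamma> (?\<phi> t)) \<in> chart_image c" by (rule chart_image_mem[OF c(2)])
    have "(?\<phi> has_vector_derivative k) (at t within {a'..b'})"
      by (auto intro!: derivative_eq_intros simp: has_real_derivative_iff_has_vector_derivative[symmetric])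
    from vector_diff_chain_within[OF this D[folded img]]
    have "((snd c \<circ> (\<lambda>t. \<gamma> (?\<phi> t))) has_vector_derivative k *\<^sub>R D) (at t within {a'..b'})"
      by (simp add: o_def)
    from speed_in_chart[OF c(1) _ t C1_curve_on_continuous[OF C1_curve_on_affine[OF C img]] this] c(2)
    have "speed A g (\<lambda>t. \<gamma> (?\<phi> t)) t = sqrt (metric_in_chart A g c (snd c (\<gamma> (?\<phi> t))) (k *\<^sub>R D) (k *\<^sub>R D))" by simp
    also have "\<dots> = sqrt (k\<^sup>2 * metric_in_chart A g c (snd c (\<gamma> (?\<phi> t))) D D)"
      by (simp add: scale_left[OF y] scale_right[OF y] power2_eq_square)
    also have "\<dots> = \<bar>k\<bar> * speed A g \<gamma> (?\<phi> t)" by (simp add: real_sqrt_mult s)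
    finally show ?thesis .
  qed
  have "(speed A g \<gamma> has_integral arc_length A g \<gamma> a b) (cbox a b)"
    using speed_integrable[OF C] by (simp add: arc_length_def integrable_integral)
  from has_integral_affinity[OF this k, of m]
  have "((\<lambda>x. speed A g \<gamma> (?\<phi> x)) has_integral (1 / \<bar>k\<bar>) * arc_length A g \<gamma> a b)
      ((\<lambda>x. (1 / k) * x + - ((1 / k) * m)) ` {a..b})" by simp
  moreover have "(\<lambda>x. (1 / k) * x + - ((1 / k) * m)) ` {a..b} = {a'..b'}"
    unfolding img[symmetric] image_image using k by (simp add: field_simps)
  ultimately have "((\<lambda>x. speed A g \<gamma> (?\<phi> x)) has_integral (1 / \<bar>k\<bar>) * arc_length A g \<gamma> a b) {a'..b'}" by simp
  from has_integral_mult_right[OF this, of "\<bar>k\<bar>"]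
  have 1: "((\<lambda>x. \<bar>k\<bar> * speed A g \<gamma> (?\<phi> x)) has_integral arc_length A g \<gamma> a b) {a'..b'}" using k by simp
  have "arc_length A g (\<lambda>t. \<gamma> (?\<phi> t)) a' b' = integral {a'<..<b'} (\<lambda>x. \<bar>k\<bar> * speed A g \<gamma> (?\<phi> x))"
    unfolding arc_length_def integral_open_interval_real by (rule integral_cong) (use sp in auto)
  also have "\<dots> = arc_length A g \<gamma> a b"
    unfolding integral_open_interval_real[symmetric] using 1 by (rule integral_unique)
  finally show ?thesis .
qed

lemma C1_curve_const:
  assumes "a < b"
  shows "C1_curve_on A (\<lambda>t. p) a b" "arc_length A g (\<lambda>t. p) a b = 0"
proof -
  obtain c where c: "c \<in> A" "p \<in> fst c" using chart_coverE[OF cover] by blast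
  have D: "((snd c \<circ> (\<lambda>t. p)) has_vector_derivative 0) (at t within {a..b})" for t
    by (simp add: o_def has_vector_derivative_const)
  show "C1_curve_on A (\<lambda>t. p) a b"
    by (rule C1_curve_on_localI[OF atlas assms])
      (auto intro!: bexI[OF _ c(1)] exI[of _ "UNIV :: real set"] exI[of _ "\<lambda>t. 0"] simp: c D[unfolded o_def] o_def)
  interpret riemannian_field "chart_image c" "metric_in_chart A g c" by (rule chart_field[OF c(1)])
  have "speed A g (\<lambda>t. p) t = 0" if "a < t" "t < b" for t
    using speed_in_chart[of c "\<lambda>t. p" t a b 0] c that D linear_0[OF linear_left[OF chart_image_mem[OF c(2)]]] by simp
  then have "arc_length A g (\<lambda>t. p) a b = integral {a<..<b} (\<lambda>t. 0)"
    unfolding arc_length_def integral_open_interval_real by (intro integral_cong) auto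
  then show "arc_length A g (\<lambda>t. p) a b = 0" by simp
qed

lemma C1_curve_line:
  assumes c: "c \<in> A" and y: "ball y0 r \<subseteq> chart_image c" "y0 \<in> ball y0 r" "y1 \<in> ball y0 r"
  shows "C1_curve_on A (\<lambda>t. chart_inv c (y0 + t *\<^sub>R (y1 - y0))) 0 1"
proof (rule C1_curve_on_localI[OF atlas])
  let ?l = "\<lambda>t. y0 + t *\<^sub>R (y1 - y0)"
  note ch = is_chart[OF c]
  have l: "?l t \<in> chart_image c" if "t \<in> {0..1}" for t
  proof -
    have "(1 - t) *\<^sub>R y0 + t *\<^sub>R y1 \<in> ball y0 r"
      by (rule convexD[OF convex_ball y(2,3)]) (use that in auto)
    moreover have "(1 - t) *\<^sub>R y0 + t *\<^sub>R y1 = ?l t" by (simp add: algebra_simps)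
    ultimately show ?thesis using y(1) by auto
  qed
  show "continuous_on {0..1} (\<lambda>t. chart_inv c (?l t))"
    by (rule continuous_on_compose2[OF chart_inv_continuous[OF ch]]) (use l in \<open>auto intro!: continuous_intros\<close>)
  have d: "((snd c \<circ> (\<lambda>t. chart_inv c (?l t))) has_vector_derivative (y1 - y0)) (at s within {0..1})" if s: "s \<in> {0..1}" for s
  proof (rule has_vector_derivative_transform[OF s])
    have "(?l has_vector_derivative 0 + 1 *\<^sub>R (y1 - y0)) (at s within {0..1})"
      unfolding has_vector_derivative_def by (auto intro!: derivative_eq_intros)
    then show "(?l has_vector_derivative (y1 - y0)) (at s within {0..1})" by simp
  qed (simp add: chart_inv_right[OF ch l])
  fix t :: real
  show "\<exists>c'\<in>A. \<exists>W D. open W \<and> t \<in> W \<and> (\<lambda>t. chart_inv c (?l t)) ` ({0..1} \<inter> W) \<subseteq> fst c' \<and>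
      continuous_on ({0..1} \<inter> W) D \<and>
      (\<forall>s\<in>{0..1} \<inter> W. ((snd c' \<circ> (\<lambda>t. chart_inv c (?l t))) has_vector_derivative D s) (at s within {0..1}))"
  proof (intro bexI[OF _ c] exI[of _ "UNIV :: real set"] exI[of _ "\<lambda>_. y1 - y0"] conjI ballI)
    show "(\<lambda>t. chart_inv c (?l t)) ` ({0..1} \<inter> UNIV) \<subseteq> fst c" using chart_inv_mem[OF ch l] by auto
    show "((snd c \<circ> (\<lambda>t. chart_inv c (?l t))) has_vector_derivative (y1 - y0)) (at s within {0..1})" if "s \<in> {0..1} \<inter> UNIV" for s
      using d that by blast
  qed auto
qed simp

end

section \<open>The Riemannian distance\<close>

text \<open>
  A chain is a finite succession of \<open>C\<^sup>1\<close> segments with arbitrary parameter intervals, together with its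
  total length. Chains have the lengths of the piecewise \<open>C\<^sup>1\<close> curves on \<open>[0, 1]\<close> with the same ends, but
  they can be joined without reparametrisation and lend themselves to induction.
\<close>

inductive curve_chain ::
    "('m::topological_space, 'e::euclidean_space) chart set \<Rightarrow> 'm metric_tensor \<Rightarrow> 'm \<Rightarrow> 'm \<Rightarrow> real \<Rightarrow> bool"
  for A g p where
  refl: "curve_chain A g p p 0"
| step: "curve_chain A g p (\<gamma> a) l \<Longrightarrow> a < b \<Longrightarrow> C1_curve_on A \<gamma> a b \<Longrightarrow>
    curve_chain A g p (\<gamma> b) (l + arc_length A g \<gamma> a b)"

lemma curve_chain_trans:
  assumes "curve_chain A g q r l'" "curve_chain A g p q l"
  shows "curve_chain A g p r (l + l')"
  using assms
proof (induction rule: curve_chain.induct)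
  case refl
  then show ?case by simp
next
  case (step \<gamma> a l' b)
  then have "curve_chain A g p (\<gamma> b) ((l + l') + arc_length A g \<gamma> a b)"
    by (intro curve_chain.step)
  then show ?case by (simp add: add.assoc)
qed

lemma curve_chain_segment:
  assumes "a < b" "C1_curve_on A \<gamma> a b"
  shows "curve_chain A g (\<gamma> a) (\<gamma> b) (arc_length A g \<gamma> a b)"
  using curve_chain.step[where A = A and g = g and l = 0 and \<gamma> = \<gamma>, OF curve_chain.refl assms] by simp

context riemannian_atlas
begin

abbreviation chain where "chain \<equiv> curve_chain A g"

lemma chain_nonneg: "chain p q l \<Longrightarrow> 0 \<le> l"
  by (induction rule: curve_chain.induct) (auto intro: add_nonneg_nonneg arc_length_nonneg)

lemma chain_sym:
  assumes "chain p q l"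
  shows "chain q p l"
  using assms
proof (induction rule: curve_chain.induct)
  case refl
  then show ?case by (rule curve_chain.refl)
next
  case (step \<gamma> a l b)
  have img: "(\<lambda>t. -1 * t + 0) ` {-b..-a} = {a..b}"
    using step.hyps(2) by (simp add: image_affinity_atLeastAtMost)
  have "chain (\<gamma> (-1 * -b + 0)) (\<gamma> (-1 * -a + 0)) (arc_length A g (\<lambda>t. \<gamma> (-1 * t + 0)) (-b) (-a))"
    using step.hyps(2) by (intro curve_chain_segment C1_curve_on_affine[OF step.hyps(3) img]) simp
  then have "chain (\<gamma> b) (\<gamma> a) (arc_length A g \<gamma> a b)"
    using arc_length_affine[OF step.hyps(3) img _ step.hyps(2)] by simp
  from curve_chain_trans[OF step.IH this] show ?case by (simp add: add.commute)
qed

lemma partition_chain: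
  assumes "\<And>i. i < n \<Longrightarrow> \<tau> i < \<tau> (Suc i) \<and> C1_curve_on A \<gamma> (\<tau> i) (\<tau> (Suc i))"
  shows "\<tau> 0 \<le> \<tau> n \<and> speed A g \<gamma> integrable_on {\<tau> 0..\<tau> n} \<and>
    arc_length A g \<gamma> (\<tau> 0) (\<tau> n) = (\<Sum>i<n. arc_length A g \<gamma> (\<tau> i) (\<tau> (Suc i))) \<and>
    chain (\<gamma> (\<tau> 0)) (\<gamma> (\<tau> n)) (\<Sum>i<n. arc_length A g \<gamma> (\<tau> i) (\<tau> (Suc i)))"
  using assms
proof (induction n)
  case 0
  have "speed A g \<gamma> integrable_on cbox (\<tau> 0) (\<tau> 0)" by (rule integrable_on_refl)
  then show ?case by (simp add: arc_length_def curve_chain.refl)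
next
  case (Suc n)
  have IH: "\<tau> 0 \<le> \<tau> n" "speed A g \<gamma> integrable_on {\<tau> 0..\<tau> n}"
    "arc_length A g \<gamma> (\<tau> 0) (\<tau> n) = (\<Sum>i<n. arc_length A g \<gamma> (\<tau> i) (\<tau> (Suc i)))"
    "chain (\<gamma> (\<tau> 0)) (\<gamma> (\<tau> n)) (\<Sum>i<n. arc_length A g \<gamma> (\<tau> i) (\<tau> (Suc i)))"
    using Suc.IH Suc.prems by auto
  have s: "\<tau> n < \<tau> (Suc n)" "C1_curve_on A \<gamma> (\<tau> n) (\<tau> (Suc n))" using Suc.prems[of n] by auto
  have int: "speed A g \<gamma> integrable_on {\<tau> 0..\<tau> (Suc n)}"
    using IH(1) s(1)
    by (intro Henstock_Kurzweil_Integration.integrable_combine[OF _ _ IH(2) speed_integrable[OF s(2)]]) auto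
  moreover have "arc_length A g \<gamma> (\<tau> 0) (\<tau> n) + arc_length A g \<gamma> (\<tau> n) (\<tau> (Suc n)) = arc_length A g \<gamma> (\<tau> 0) (\<tau> (Suc n))"
    unfolding arc_length_def using IH(1) s(1)
    by (intro Henstock_Kurzweil_Integration.integral_combine int) auto
  moreover have "chain (\<gamma> (\<tau> 0)) (\<gamma> (\<tau> (Suc n))) ((\<Sum>i<n. arc_length A g \<gamma> (\<tau> i) (\<tau> (Suc i))) + arc_length A g \<gamma> (\<tau> n) (\<tau> (Suc n)))"
    by (rule curve_chain.step[OF IH(4) s])
  ultimately show ?case using IH(1,3) s(1) by simp
qed

lemma piecewise_C1_curve_chain:
  assumes "piecewise_C1_curve A \<gamma>"
  shows "chain (\<gamma> 0) (\<gamma> 1) (curve_length A g \<gamma>)"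
proof -
  obtain n \<tau> where \<tau>: "\<tau> 0 = 0" "\<tau> n = 1"
    "\<And>i. i < n \<Longrightarrow> \<tau> i < \<tau> (Suc i) \<and> C1_curve_on A \<gamma> (\<tau> i) (\<tau> (Suc i))"
    using assms unfolding piecewise_C1_curve_def by blast
  show ?thesis
    using partition_chain[of n \<tau> \<gamma>, OF \<tau>(3)] \<tau>(1,2) by (simp add: curve_length_eq)
qed

text \<open>
  The curve obtained so far is run through on \<open>[0, 1/2]\<close> and the new segment on \<open>[1/2, 1]\<close>.
\<close>

lemma chain_piecewise_C1_curve:
  assumes "chain p q l"
  shows "\<exists>\<gamma>. piecewise_C1_curve A \<gamma> \<and> \<gamma> 0 = p \<and> \<gamma> 1 = q \<and> curve_length A g \<gamma> = l"
  using assms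
proof (induction rule: curve_chain.induct)
  case refl
  have "piecewise_C1_curve A (\<lambda>t. p)"
    unfolding piecewise_C1_curve_def
    by (rule exI[of _ 1], rule exI[of _ real]) (simp add: C1_curve_const)
  then show ?case using C1_curve_const(2)[of 0 1 p] by (auto simp: curve_length_eq)
next
  case (step \<gamma>2 a l b)
  obtain \<gamma>1 where "piecewise_C1_curve A \<gamma>1" and g1: "\<gamma>1 0 = p" "\<gamma>1 1 = \<gamma>2 a" "curve_length A g \<gamma>1 = l"
    using step.IH by blast
  then obtain n \<tau> where \<tau>: "\<tau> 0 = 0" "\<tau> n = 1"
    "\<And>i. i < n \<Longrightarrow> \<tau> i < \<tau> (Suc i) \<and> C1_curve_on A \<gamma>1 (\<tau> i) (\<tau> (Suc i))"
    unfolding piecewise_C1_curve_def by blast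
  \<comment> \<open>\<open>t \<mapsto> kt + m\<close> maps \<open>[1/2, 1]\<close> onto \<open>[a, b]\<close>\<close>
  define k where "k = 2 * (b - a)"
  define m where "m = 2 * a - b"
  define \<gamma> where "\<gamma> = (\<lambda>t. if t \<le> 1/2 then \<gamma>1 (2 * t + 0) else \<gamma>2 (k * t + m))"
  define \<sigma> where "\<sigma> = (\<lambda>i. if i \<le> n then \<tau> i / 2 else 1)"
  have k: "k > 0" using step.hyps(2) by (simp add: k_def)
  have km: "k * (1/2) + m = a" "k * 1 + m = b" by (simp_all add: k_def m_def field_simps)
  have mono: "i \<le> n \<Longrightarrow> \<tau> i \<le> 1" for i
  proof (induction rule: inc_induct)
    case base
    then show ?case using \<tau>(2) by simp
  next
    case (step j)
    then show ?case using \<tau>(3)[of j] by auto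
  qed
  have seg1: "C1_curve_on A \<gamma> (\<sigma> i) (\<sigma> (Suc i))"
    "arc_length A g \<gamma> (\<sigma> i) (\<sigma> (Suc i)) = arc_length A g \<gamma>1 (\<tau> i) (\<tau> (Suc i))" if i: "i < n" for i
  proof -
    have s: "\<sigma> i = \<tau> i / 2" "\<sigma> (Suc i) = \<tau> (Suc i) / 2" using i by (auto simp: \<sigma>_def)
    have img: "(\<lambda>t. 2 * t + 0) ` {\<sigma> i..\<sigma> (Suc i)} = {\<tau> i..\<tau> (Suc i)}"
      unfolding s using \<tau>(3)[OF i] by (simp add: image_affinity_atLeastAtMost)
    have C: "C1_curve_on A (\<lambda>t. \<gamma>1 (2 * t + 0)) (\<sigma> i) (\<sigma> (Suc i))"
      by (rule C1_curve_on_affine[OF _ img]) (use \<tau>(3)[OF i] in blast)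
    have eq: "\<gamma> t = \<gamma>1 (2 * t + 0)" if "t \<in> {\<sigma> i..\<sigma> (Suc i)}" for t
      using that mono[of "Suc i"] i unfolding s \<gamma>_def by auto
    show "C1_curve_on A \<gamma> (\<sigma> i) (\<sigma> (Suc i))" by (rule C1_curve_on_cong[OF C eq])
    show "arc_length A g \<gamma> (\<sigma> i) (\<sigma> (Suc i)) = arc_length A g \<gamma>1 (\<tau> i) (\<tau> (Suc i))"
      using arc_length_C1_cong[OF C eq] arc_length_affine[OF _ img, of \<gamma>1] \<tau>(3)[OF i] by simp
  qed
  have s: "\<sigma> n = 1/2" "\<sigma> (Suc n) = 1" by (simp_all add: \<sigma>_def \<tau>(2))
  have img: "(\<lambda>t. k * t + m) ` {\<sigma> n..\<sigma> (Suc n)} = {a..b}"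
    unfolding s using k km by (simp add: image_affinity_atLeastAtMost)
  have C: "C1_curve_on A (\<lambda>t. \<gamma>2 (k * t + m)) (\<sigma> n) (\<sigma> (Suc n))"
    by (rule C1_curve_on_affine[OF step.hyps(3) img])
  have eq: "\<gamma> t = \<gamma>2 (k * t + m)" if "t \<in> {\<sigma> n..\<sigma> (Suc n)}" for t
  proof (cases "t = 1/2")
    case True
    show ?thesis unfolding True \<gamma>_def using km(1) g1(2) by simp
  next
    case False
    then show ?thesis using that by (simp add: \<gamma>_def s)
  qed
  have seg2: "C1_curve_on A \<gamma> (\<sigma> n) (\<sigma> (Suc n))" by (rule C1_curve_on_cong[OF C eq])
  have len2: "arc_length A g \<gamma> (\<sigma> n) (\<sigma> (Suc n)) = arc_length A g \<gamma>2 a b"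
    using arc_length_C1_cong[OF C eq] arc_length_affine[OF step.hyps(3) img _ step.hyps(2)] k by simp
  have pw: "\<sigma> i < \<sigma> (Suc i) \<and> C1_curve_on A \<gamma> (\<sigma> i) (\<sigma> (Suc i))" if "i < Suc n" for i
  proof (cases "i < n")
    case True
    then have "\<sigma> i < \<sigma> (Suc i)" using \<tau>(3)[OF True] by (simp add: \<sigma>_def)
    with seg1(1)[OF True] show ?thesis by blast
  next
    case False
    then have "i = n" using that by simp
    moreover have "\<sigma> n < \<sigma> (Suc n)" unfolding s by simp
    ultimately show ?thesis using seg2 by blast
  qed
  have \<sigma>0: "\<sigma> 0 = 0" using \<tau>(1) by (simp add: \<sigma>_def)
  have "piecewise_C1_curve A \<gamma>"
    unfolding piecewise_C1_curve_def using pw s(2) \<sigma>0 by blast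
  moreover have "\<gamma> 0 = p" "\<gamma> 1 = \<gamma>2 b" using g1(1) km(2) by (simp_all add: \<gamma>_def)
  moreover have "curve_length A g \<gamma> = l + arc_length A g \<gamma>2 a b"
  proof -
    have "curve_length A g \<gamma> = (\<Sum>i<Suc n. arc_length A g \<gamma> (\<sigma> i) (\<sigma> (Suc i)))"
      using partition_chain[of "Suc n" \<sigma> \<gamma>, OF pw] s(2) \<sigma>0 by (simp add: curve_length_eq)
    also have "\<dots> = (\<Sum>i<n. arc_length A g \<gamma>1 (\<tau> i) (\<tau> (Suc i))) + arc_length A g \<gamma>2 a b"
      by (simp add: seg1(2) len2)
    also have "(\<Sum>i<n. arc_length A g \<gamma>1 (\<tau> i) (\<tau> (Suc i))) = l"
      using partition_chain[of n \<tau> \<gamma>1, OF \<tau>(3)] \<tau>(1,2) g1(3) by (simp add: curve_length_eq)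
    finally show ?thesis .
  qed
  ultimately show ?case by blast
qed

lemma riemannian_dist_eq: "riemannian_dist A g p q = Inf {l. chain p q l}"
proof -
  have "{curve_length A g \<gamma> | \<gamma>. piecewise_C1_curve A \<gamma> \<and> pathstart \<gamma> = p \<and> pathfinish \<gamma> = q} = {l. chain p q l}"
    (is "?L = _")
  proof
    show "?L \<subseteq> {l. chain p q l}"
      using piecewise_C1_curve_chain by (auto simp: pathstart_def pathfinish_def)
    show "{l. chain p q l} \<subseteq> ?L"
    proof
      fix l assume "l \<in> {l. chain p q l}"
      then obtain \<gamma> where "piecewise_C1_curve A \<gamma>" "\<gamma> 0 = p" "\<gamma> 1 = q" "curve_length A g \<gamma> = l"
        using chain_piecewise_C1_curve by blast
      then show "l \<in> ?L" unfolding pathstart_def pathfinish_def by blast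
    qed
  qed
  then show ?thesis by (simp add: riemannian_dist_def)
qed

text \<open>
  By homogeneity only unit vectors matter, and these form a compact set together with the closed ball of
  base points.
\<close>

lemma metric_lower_bound:
  assumes c: "c \<in> A" and r: "cball y0 r \<subseteq> chart_image c" "0 \<le> r"
  obtains m where "m > 0" "\<And>z v. z \<in> cball y0 r \<Longrightarrow> m * norm v \<le> sqrt (metric_in_chart A g c z v v)"
proof -
  interpret riemannian_field "chart_image c" "metric_in_chart A g c" by (rule chart_field[OF c])
  let ?S = "cball y0 r \<times> sphere (0::'e) 1"
  have "compact ?S" by (intro compact_Times) auto
  moreover have "?S \<noteq> {}"
  proof -
    obtain b :: 'e where "b \<in> Basis" using nonempty_Basis by blast
    then have "(y0, b) \<in> ?S" using r(2) by simp
    then show ?thesis by blast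
  qed
  moreover have "continuous_on ?S (\<lambda>p. metric_in_chart A g c (fst p) (snd p) (snd p))"
  proof (rule bilinear_family_continuous_on[where G = "\<lambda>p. metric_in_chart A g c (fst p)" and P = snd and Q = snd])
    show "bilinear (metric_in_chart A g c (fst p))" if "p \<in> ?S" for p
      by (rule bil) (use that r(1) in auto)
    show "continuous_on ?S (\<lambda>p. metric_in_chart A g c (fst p) v w)" for v w
      by (rule continuous_on_compose2[OF metric_continuous[OF c] continuous_on_fst[OF continuous_on_id]]) (use r(1) in auto)
    show "continuous_on ?S snd" by (intro continuous_intros)
    show "continuous_on ?S snd" by (intro continuous_intros)
  qed
  ultimately obtain p where p: "p \<in> ?S"
    "\<And>q. q \<in> ?S \<Longrightarrow> metric_in_chart A g c (fst p) (snd p) (snd p) \<le> metric_in_chart A g c (fst q) (snd q) (snd q)"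
    using continuous_attains_inf[of ?S "\<lambda>p. metric_in_chart A g c (fst p) (snd p) (snd p)"] by blast
  define \<mu> where "\<mu> = metric_in_chart A g c (fst p) (snd p) (snd p)"
  have "snd p \<noteq> 0" using p(1) by auto
  then have \<mu>: "\<mu> > 0" unfolding \<mu>_def using p(1) r(1) by (intro pos) auto
  have "sqrt \<mu> * norm v \<le> sqrt (metric_in_chart A g c z v v)" if z: "z \<in> cball y0 r" for z v
  proof (cases "v = 0")
    case True
    then show ?thesis using linear_0[OF linear_left, of z] z r(1) by auto
  next
    case False
    define n where "n = (1 / norm v) *\<^sub>R v"
    have "(z, n) \<in> ?S" using z False by (simp add: n_def)
    from p(2)[OF this] have "\<mu> \<le> metric_in_chart A g c z n n" by (simp add: \<mu>_def)
    then have "\<mu> * (norm v)\<^sup>2 \<le> metric_in_chart A g c z n n * (norm v)\<^sup>2" by (rule mult_right_mono) simp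
    also have "\<dots> = metric_in_chart A g c z (norm v *\<^sub>R n) (norm v *\<^sub>R n)"
      using z r(1) scale_left[of z] scale_right[of z] by (auto simp: power2_eq_square)
    also have "norm v *\<^sub>R n = v" using False by (simp add: n_def)
    finally have "sqrt (\<mu> * (norm v)\<^sup>2) \<le> sqrt (metric_in_chart A g c z v v)" by (rule real_sqrt_le_mono)
    then show ?thesis by (simp add: real_sqrt_mult)
  qed
  then show ?thesis using \<mu> by (intro that[of "sqrt \<mu>"]) auto
qed

text \<open>
  The displacement in the chart is the integral of the velocity, whose Euclidean norm the metric controls.
\<close>

lemma arc_length_ge_chart_dist:
  assumes C: "C1_curve_on A \<gamma> a b" and c: "c \<in> A" and ab: "a \<le> b"
    and inc: "\<And>t. t \<in> {a..b} \<Longrightarrow> \<gamma> t \<in> fst c"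
    and m: "\<And>t v. t \<in> {a..b} \<Longrightarrow> m * norm v \<le> sqrt (metric_in_chart A g c (snd c (\<gamma> t)) v v)" "0 \<le> m"
  shows "m * dist (snd c (\<gamma> a)) (snd c (\<gamma> b)) \<le> arc_length A g \<gamma> a b"
proof -
  obtain D where D:
    "\<And>t. t \<in> {a..b} \<Longrightarrow> \<gamma> t \<in> fst c \<Longrightarrow> ((snd c \<circ> \<gamma>) has_vector_derivative D t) (at t within {a..b})"
    using C1_curve_onD[OF C c] by blast
  have "(D has_integral ((snd c \<circ> \<gamma>) b - (snd c \<circ> \<gamma>) a)) {a..b}"
    by (rule fundamental_theorem_of_calculus[OF ab]) (use D inc in blast)
  from has_integral_cmul[OF this, of m]
  have 1: "((\<lambda>t. m *\<^sub>R D t) has_integral m *\<^sub>R (snd c (\<gamma> b) - snd c (\<gamma> a))) {a..b}" by simp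
  then have int: "(\<lambda>t. m *\<^sub>R D t) integrable_on {a..b}" by blast
  have "m * dist (snd c (\<gamma> a)) (snd c (\<gamma> b)) = norm (integral {a..b} (\<lambda>t. m *\<^sub>R D t))"
    unfolding integral_unique[OF 1] using m(2) by (simp add: dist_norm norm_minus_commute)
  also have "\<dots> = norm (integral {a<..<b} (\<lambda>t. m *\<^sub>R D t))" by (simp only: integral_open_interval_real)
  also have "\<dots> \<le> integral {a<..<b} (speed A g \<gamma>)"
  proof (rule Henstock_Kurzweil_Integration.integral_norm_bound_integral)
    show "(\<lambda>t. m *\<^sub>R D t) integrable_on {a<..<b}" using int by (simp only: integrable_on_open_interval_real)
    show "speed A g \<gamma> integrable_on {a<..<b}"
      using speed_integrable[OF C] by (simp only: integrable_on_open_interval_real)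
    fix t assume "t \<in> {a<..<b}"
    then have t: "t \<in> {a..b}" "a < t" "t < b" by auto
    have "speed A g \<gamma> t = sqrt (metric_in_chart A g c (snd c (\<gamma> t)) (D t) (D t))"
      by (rule speed_in_chart[OF c inc[OF t(1)] t(2,3) C1_curve_on_continuous[OF C] D[OF t(1) inc[OF t(1)]]])
    then show "norm (m *\<^sub>R D t) \<le> speed A g \<gamma> t" using m(1)[OF t(1), of "D t"] m(2) by simp
  qed
  also have "\<dots> = arc_length A g \<gamma> a b" by (simp only: arc_length_def integral_open_interval_real)
  finally show ?thesis .
qed

text \<open>
  Distinct points have positive distance for this reason: up to the first time at which a curve leaves a
  chart ball, its length bounds its displacement in the chart from above, so a chain shorter than a certain
  \<open>\<epsilon>\<close> never leaves the ball and its end is as close to its origin as its length tells.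
\<close>

lemma chain_lower_bound:
  assumes c: "c \<in> A" and q: "q \<in> fst c"
  obtains \<epsilon> m where "\<epsilon> > 0" "m > 0"
    "\<And>p l. chain q p l \<Longrightarrow> l < \<epsilon> \<Longrightarrow> p \<in> fst c \<and> m * dist (snd c q) (snd c p) \<le> l"
proof -
  note ch = is_chart[OF c]
  define y0 where "y0 = snd c q"
  obtain r where r: "r > 0" "cball y0 r \<subseteq> chart_image c"
    using chart_image_open[OF ch] chart_image_mem[OF q] open_contains_cball unfolding y0_def by blast
  obtain m where m: "m > 0" "\<And>z v. z \<in> cball y0 r \<Longrightarrow> m * norm v \<le> sqrt (metric_in_chart A g c z v v)"
    using metric_lower_bound[OF c r(2)] r(1) by auto
  define K where "K = (\<lambda>\<rho>. chart_inv c ` cball y0 \<rho>)"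
  have K_iff: "p \<in> K \<rho> \<longleftrightarrow> p \<in> fst c \<and> dist y0 (snd c p) \<le> \<rho>" if "\<rho> \<le> r" for p \<rho>
  proof
    have sub: "cball y0 \<rho> \<subseteq> chart_image c" using r(2) that by auto
    show "p \<in> fst c \<and> dist y0 (snd c p) \<le> \<rho>" if "p \<in> K \<rho>"
      using that sub chart_inv_mem[OF ch] chart_inv_right[OF ch] unfolding K_def by auto
    show "p \<in> K \<rho>" if "p \<in> fst c \<and> dist y0 (snd c p) \<le> \<rho>"
      unfolding K_def using that chart_inv_left[OF ch, of p] by (intro image_eqI[of _ _ "snd c p"]) auto
  qed
  have K_closed: "closed (K \<rho>)" if "\<rho> \<le> r" for \<rho>
  proof -
    have "continuous_on (cball y0 \<rho>) (chart_inv c)"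
      by (rule continuous_on_subset[OF chart_inv_continuous[OF ch]]) (use r(2) that in auto)
    then show ?thesis unfolding K_def by (intro compact_imp_closed compact_continuous_image) auto
  qed
  define V where "V = fst c \<inter> snd c -` ball y0 r"
  have V: "open V" unfolding V_def
    by (rule continuous_open_preimage[OF chart_continuous[OF ch] chart_open[OF ch]]) simp
  have main: "p \<in> fst c \<and> m * dist y0 (snd c p) \<le> l" if "chain q p l" "l < m * r" for p l
    using that
  proof (induction rule: curve_chain.induct)
    case refl
    then show ?case using q by (simp add: y0_def)
  next
    case (step \<gamma> a l b)
    define len where "len = arc_length A g \<gamma> a b"
    have len: "0 \<le> len" unfolding len_def by (rule arc_length_nonneg[OF step.hyps(3)])
    have l: "l + len < m * r" using step.prems by (simp add: len_def)
    have \<gamma>a: "\<gamma> a \<in> fst c" "m * dist y0 (snd c (\<gamma> a)) \<le> l" using step.IH l len by auto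
    define \<rho> where "\<rho> = (l + len) / m"
    have \<rho>: "\<rho> < r" "m * \<rho> = l + len" using l m(1) by (simp_all add: \<rho>_def pos_divide_less_eq mult.commute)
    note cont = C1_curve_on_continuous[OF step.hyps(3)]
    \<comment> \<open>as long as the curve stays in the chart ball, its length controls how far it has moved\<close>
    have near: "\<gamma> s \<in> K \<rho>" if s: "s \<in> {a..b}" and inV: "\<And>t. t \<in> {a..s} \<Longrightarrow> \<gamma> t \<in> V" for s
    proof -
      have "m * dist (snd c (\<gamma> a)) (snd c (\<gamma> s)) \<le> arc_length A g \<gamma> a s"
      proof (rule arc_length_ge_chart_dist[OF _ c])
        show "C1_curve_on A \<gamma> a s" by (rule C1_curve_on_subinterval[OF step.hyps(3)]) (use s in auto)
        show "\<gamma> t \<in> fst c" if "t \<in> {a..s}" for t using inV[OF that] by (simp add: V_def)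
        show "m * norm v \<le> sqrt (metric_in_chart A g c (snd c (\<gamma> t)) v v)" if "t \<in> {a..s}" for t v
          by (rule m(2)) (use inV[OF that] in \<open>simp add: V_def\<close>)
      qed (use s m(1) in auto)
      also have "\<dots> \<le> len"
        using arc_length_combine[OF step.hyps(3), of s b] s
          arc_length_nonneg[OF C1_curve_on_subinterval[OF step.hyps(3), of s b]] by (simp add: len_def)
      finally have "m * dist y0 (snd c (\<gamma> s)) \<le> l + len"
        using mult_left_mono[OF dist_triangle[of y0 "snd c (\<gamma> s)" "snd c (\<gamma> a)"], of m] \<gamma>a(2) m(1)
        by (simp add: distrib_left)
      then have "dist y0 (snd c (\<gamma> s)) \<le> \<rho>" using m(1) by (simp add: \<rho>_def pos_le_divide_eq mult.commute)
      moreover have "\<gamma> s \<in> fst c" using inV[of s] s by (simp add: V_def)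
      ultimately show ?thesis using K_iff \<rho>(1) by simp
    qed
    have KV: "K \<rho> \<subseteq> V" using K_iff[of \<rho>] \<rho>(1) by (auto simp: V_def)
    have "dist y0 (snd c (\<gamma> a)) < r"
    proof -
      have "m * dist y0 (snd c (\<gamma> a)) < m * r" using \<gamma>a(2) l len by linarith
      then show ?thesis using m(1) by simp
    qed
    then have aV: "\<gamma> a \<in> V" using \<gamma>a(1) by (simp add: V_def)
    \<comment> \<open>at a first exit time \<open>u\<close> the curve would lie in the closed set \<open>K \<rho>\<close> inside the open ball\<close>
    have inV: "\<gamma> t \<in> V" if "t \<in> {a..b}" for t
    proof (rule ccontr)
      assume "\<gamma> t \<notin> V"
      obtain W where W: "open W" "\<And>s. s \<in> {a..b} \<Longrightarrow> s \<in> W \<longleftrightarrow> \<gamma> s \<in> V"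
        using continuous_on_open_vimageE[OF cont V] by blast
      have "compact ({a..b} - W)" using W(1) by (intro compact_diff) auto
      moreover have "t \<in> {a..b} - W" using W(2) that \<open>\<gamma> t \<notin> V\<close> by auto
      ultimately obtain u where u: "u \<in> {a..b} - W" "\<And>s. s \<in> {a..b} - W \<Longrightarrow> u \<le> s"
        using compact_attains_inf[of "{a..b} - W"] by blast
      have "\<gamma> u \<notin> V" using u(1) W(2) by blast
      then have "u \<noteq> a" using aV by auto
      then have au: "a < u" "u \<le> b" using u(1) by auto
      have before: "\<gamma> s \<in> V" if "s \<in> {a..<u}" for s
        using u(2)[of s] W(2)[of s] that au by force
      have "\<gamma> ` {a..<u} \<subseteq> K \<rho>"
        by (intro image_subsetI near) (use au in \<open>auto intro: before\<close>)
      moreover have "continuous_on (closure {a..<u}) \<gamma>"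
        unfolding closure_atLeastLessThan[OF au(1)] by (rule continuous_on_subset[OF cont]) (use au in auto)
      ultimately have "\<gamma> ` closure {a..<u} \<subseteq> K \<rho>"
        using K_closed \<rho>(1) by (intro image_closure_subset) auto
      then have "\<gamma> u \<in> K \<rho>" unfolding closure_atLeastLessThan[OF au(1)] using au by auto
      with KV \<open>\<gamma> u \<notin> V\<close> show False by blast
    qed
    have "\<gamma> b \<in> K \<rho>" by (rule near) (use step.hyps(2) inV in auto)
    then have "\<gamma> b \<in> fst c" "dist y0 (snd c (\<gamma> b)) \<le> \<rho>" using K_iff \<rho>(1) by auto
    moreover from this(2) have "m * dist y0 (snd c (\<gamma> b)) \<le> l + len"
      using mult_left_mono[of "dist y0 (snd c (\<gamma> b))" \<rho> m] m(1) \<rho>(2) by simp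
    ultimately show ?case by (simp add: len_def)
  qed
  show ?thesis
  proof (rule that[of "m * r" m])
    show "m * r > 0" using m(1) r(1) by simp
    show "p \<in> fst c \<and> m * dist (snd c q) (snd c p) \<le> l" if "chain q p l" "l < m * r" for p l
      using main[OF that] by (simp add: y0_def)
  qed (rule m(1))
qed

lemma chain_connected_locally:
  assumes c: "c \<in> A" and r: "ball (snd c p) r \<subseteq> chart_image c" "r > 0" and p: "p \<in> fst c"
    and q: "q \<in> chart_inv c ` ball (snd c p) r"
  shows "\<exists>l. chain p q l"
proof -
  note ch = is_chart[OF c]
  obtain y where y: "y \<in> ball (snd c p) r" "q = chart_inv c y" using q by blast
  have "C1_curve_on A (\<lambda>t. chart_inv c (snd c p + t *\<^sub>R (y - snd c p))) 0 1"
    by (rule C1_curve_line[OF c r(1) _ y(1)]) (use r(2) in simp)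
  from curve_chain_segment[OF zero_less_one this, of g] show ?thesis
    using chart_inv_left[OF ch p] y(2) by auto
qed

lemma chain_component_nhd:
  obtains N where "open N" "p \<in> N" "\<And>q. q \<in> N \<Longrightarrow> \<exists>l. chain p q l"
proof -
  obtain c where c: "c \<in> A" "p \<in> fst c" using chart_coverE[OF cover] by blast
  note ch = is_chart[OF c(1)]
  obtain r where r: "r > 0" "ball (snd c p) r \<subseteq> chart_image c"
    using chart_image_open[OF ch] chart_image_mem[OF c(2)] openE by blast
  let ?N = "fst c \<inter> snd c -` ball (snd c p) r"
  have "open ?N" by (rule continuous_open_preimage[OF chart_continuous[OF ch] chart_open[OF ch]]) simp
  moreover have "p \<in> ?N" using c(2) r(1) by simp
  moreover have "\<exists>l. chain p q l" if "q \<in> ?N" for q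
  proof (rule chain_connected_locally[OF c(1) r(2,1) c(2)])
    show "q \<in> chart_inv c ` ball (snd c p) r"
      using that chart_inv_left[OF ch, of q] by (intro image_eqI[of _ _ "snd c q"]) auto
  qed
  ultimately show ?thesis using that by blast
qed

end

locale connected_riemannian_atlas = riemannian_atlas A g
  for A :: "('m::t2_space, 'e::euclidean_space) chart set" and g +
  assumes connected: "connected (UNIV :: 'm set)"
begin

text \<open>
  The points that chains from \<open>p\<close> reach form an open set with open complement.
\<close>

lemma chain_exists: "\<exists>l. chain p q l"
proof -
  let ?R = "{q. \<exists>l. chain p q l}"
  have "open ?R"
  proof (rule topological_space_class.openI)
    fix q assume "q \<in> ?R"
    obtain N where N: "open N" "q \<in> N" "\<And>q'. q' \<in> N \<Longrightarrow> \<exists>l. chain q q' l"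
      using chain_component_nhd by blast
    have "q' \<in> ?R" if q': "q' \<in> N" for q'
    proof -
      obtain l l' where "chain p q l" "chain q q' l'" using \<open>q \<in> ?R\<close> N(3)[OF q'] by blast
      then show ?thesis using curve_chain_trans[of A g q q' l' p l] by blast
    qed
    with N(1,2) show "\<exists>T. open T \<and> q \<in> T \<and> T \<subseteq> ?R" by (intro exI[of _ N]) blast
  qed
  moreover have "open (- ?R)"
  proof (rule topological_space_class.openI)
    fix q assume q: "q \<in> - ?R"
    obtain N where N: "open N" "q \<in> N" "\<And>q'. q' \<in> N \<Longrightarrow> \<exists>l. chain q q' l"
      using chain_component_nhd by blast
    have "N \<subseteq> - ?R"
    proof
      fix q' assume "q' \<in> N"
      then obtain l where l: "chain q' q l" using N(3) chain_sym by blast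
      show "q' \<in> - ?R"
      proof
        assume "q' \<in> ?R"
        then obtain l' where "chain p q' l'" by blast
        from curve_chain_trans[OF l this] q show False by blast
      qed
    qed
    with N show "\<exists>T. open T \<and> q \<in> T \<and> T \<subseteq> - ?R" by blast
  qed
  moreover have "p \<in> ?R" using curve_chain.refl by blast
  ultimately have "- ?R = {}"
    using connected unfolding connected_def by blast
  then show ?thesis by blast
qed

abbreviation d where "d \<equiv> riemannian_dist A g"

lemma chain_bdd_below: "bdd_below {l. chain p q l}"
  using chain_nonneg by (intro bdd_belowI[of _ 0]) auto

lemma dist_less_iff: "d p q < e \<longleftrightarrow> (\<exists>l<e. chain p q l)"
  unfolding riemannian_dist_eq
  using cInf_less_iff[OF _ chain_bdd_below, of p q e] chain_exists[of p q] by auto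

lemma dist_le_chain: "chain p q l \<Longrightarrow> d p q \<le> l"
  unfolding riemannian_dist_eq by (rule cInf_lower[OF _ chain_bdd_below]) simp

lemma dist_nonneg: "0 \<le> d p q"
proof (rule ccontr)
  assume "\<not> 0 \<le> d p q"
  then obtain l where "l < 0" "chain p q l" using dist_less_iff[of p q 0] by auto
  with chain_nonneg[of p q l] show False by simp
qed

lemma metric_space: "Metric_space UNIV d"
proof
  fix p q r
  show "0 \<le> d p q" by (rule dist_nonneg)
  have le: "d q p \<le> d p q" for p q
  proof (rule field_le_epsilon)
    fix e :: real assume "e > 0"
    then obtain l where "l < d p q + e" "chain p q l" using dist_less_iff[of p q "d p q + e"] by auto
    with dist_le_chain[OF chain_sym] show "d q p \<le> d p q + e" by fastforce
  qed
  show "d p q = d q p" using le[of p q] le[of q p] by simp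
  show "d p q = 0 \<longleftrightarrow> p = q"
  proof
    assume "p = q"
    then show "d p q = 0" using dist_le_chain[OF curve_chain.refl, of q] dist_nonneg[of p q] by simp
  next
    assume 0: "d p q = 0"
    obtain c where c: "c \<in> A" "p \<in> fst c" using chart_coverE[OF cover] by blast
    obtain \<epsilon> m where em: "\<epsilon> > 0" "m > 0"
      "\<And>q l. chain p q l \<Longrightarrow> l < \<epsilon> \<Longrightarrow> q \<in> fst c \<and> m * dist (snd c p) (snd c q) \<le> l"
      using chain_lower_bound[OF c] by blast
    have small: "\<exists>l<e. chain p q l" if "e > 0" for e using dist_less_iff[of p q e] 0 that by simp
    obtain l0 where "l0 < \<epsilon>" "chain p q l0" using small[OF em(1)] by blast
    then have q: "q \<in> fst c" using em(3) by blast
    have "m * dist (snd c p) (snd c q) \<le> 0"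
    proof (rule field_le_epsilon)
      fix e :: real assume "e > 0"
      then obtain l where "l < min e \<epsilon>" "chain p q l" using small[of "min e \<epsilon>"] em(1) by auto
      then show "m * dist (snd c p) (snd c q) \<le> 0 + e" using em(3)[of q l] by auto
    qed
    then have "snd c p = snd c q" using em(2) by (simp add: mult_le_0_iff)
    then show "p = q" using chart_inv_left[OF is_chart[OF c(1)]] c(2) q by metis
  qed
  show "d p r \<le> d p q + d q r"
  proof (rule field_le_epsilon)
    fix e :: real assume "e > 0"
    then obtain l l' where "l < d p q + e / 2" "chain p q l" "l' < d q r + e / 2" "chain q r l'"
      using dist_less_iff[of p q "d p q + e / 2"] dist_less_iff[of q r "d q r + e / 2"] by auto
    with dist_le_chain[OF curve_chain_trans] show "d p r \<le> d p q + d q r + e" by fastforce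
  qed
qed

end

section \<open>Local isometries and the lifting of curves\<close>

locale local_isometry =
  src: connected_riemannian_atlas S gS + tgt: connected_riemannian_atlas A gA
  for S :: "('s::t2_space, 'f::euclidean_space) chart set" and gS
    and A :: "('m::t2_space, 'e::euclidean_space) chart set" and gA +
  fixes \<pi> :: "'s \<Rightarrow> 'm"
  assumes smooth: "smooth_map S A \<pi>" and dims: "DIM('f) = DIM('e)"
    and isometric: "c \<in> S \<Longrightarrow> a \<in> A \<Longrightarrow> y \<in> snd c ` (fst c \<inter> \<pi> -` fst a) \<Longrightarrow>
      metric_in_chart S gS c y v w = metric_in_chart A gA a ((snd a \<circ> \<pi> \<circ> chart_inv c) y)
        (frechet_derivative (snd a \<circ> \<pi> \<circ> chart_inv c) (at y) v)
        (frechet_derivative (snd a \<circ> \<pi> \<circ> chart_inv c) (at y) w)"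
begin

lemma continuous: "continuous_on UNIV \<pi>"
  using smooth by (simp add: smooth_map_def)

lemma isometry_in_charts:
  assumes c: "c \<in> S" and a: "a \<in> A"
  shows "local_isometry_field (snd c ` (fst c \<inter> \<pi> -` fst a)) (metric_in_chart S gS c)
    (chart_image a) (metric_in_chart A gA a) (snd a \<circ> \<pi> \<circ> chart_inv c)"
proof -
  note chart = smooth_map_chart[OF src.cover tgt.cover smooth c a]
  interpret s: riemannian_field "snd c ` (fst c \<inter> \<pi> -` fst a)" "metric_in_chart S gS c"
    by (rule riemannian_field_chart[OF src.metric c src.is_chart[OF c] chart(1)]) (auto simp: chart_image_def)
  interpret t: riemannian_field "chart_image a" "metric_in_chart A gA a" by (rule tgt.chart_field[OF a])
  show ?thesis
  proof
    show "smooth_on (snd c ` (fst c \<inter> \<pi> -` fst a)) (snd a \<circ> \<pi> \<circ> chart_inv c)" by (rule chart(2))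
    show "(snd a \<circ> \<pi> \<circ> chart_inv c) z \<in> chart_image a" if "z \<in> snd c ` (fst c \<inter> \<pi> -` fst a)" for z
      using that chart_inv_left[OF src.is_chart[OF c]] by (auto intro: chart_image_mem)
    show "metric_in_chart S gS c z v w = metric_in_chart A gA a ((snd a \<circ> \<pi> \<circ> chart_inv c) z)
        (frechet_derivative (snd a \<circ> \<pi> \<circ> chart_inv c) (at z) v)
        (frechet_derivative (snd a \<circ> \<pi> \<circ> chart_inv c) (at z) w)"
      if "z \<in> snd c ` (fst c \<inter> \<pi> -` fst a)" for z v w by (rule isometric[OF c a that])
  qed (rule dims)
qed

text \<open>
  Near each time the curve and its image lie in one chart each; this is the common core of the next two
  lemmas.
\<close>

lemma curve_image_local:
  assumes C: "C1_curve_on S \<gamma> a b" and t: "t \<in> {a..b}"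
  obtains c e W D where "c \<in> S" "e \<in> A" "open W" "t \<in> W"
    "\<And>s. s \<in> {a..b} \<inter> W \<Longrightarrow> \<gamma> s \<in> fst c \<and> \<pi> (\<gamma> s) \<in> fst e"
    "\<And>s. s \<in> {a..b} \<inter> W \<Longrightarrow> ((snd c \<circ> \<gamma>) has_vector_derivative D s) (at s within {a..b})"
    "continuous_on ({a..b} \<inter> W) (\<lambda>s. frechet_derivative (snd e \<circ> \<pi> \<circ> chart_inv c) (at (snd c (\<gamma> s))) (D s))"
    "\<And>s. s \<in> {a..b} \<inter> W \<Longrightarrow> ((snd e \<circ> (\<pi> \<circ> \<gamma>)) has_vector_derivative
        frechet_derivative (snd e \<circ> \<pi> \<circ> chart_inv c) (at (snd c (\<gamma> s))) (D s)) (at s within {a..b})"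
proof -
  note cont = C1_curve_on_continuous[OF C]
  obtain c where c: "c \<in> S" "\<gamma> t \<in> fst c" using chart_coverE[OF src.cover] by blast
  obtain e where e: "e \<in> A" "\<pi> (\<gamma> t) \<in> fst e" using chart_coverE[OF tgt.cover] by blast
  obtain D where D: "continuous_on ({a..b} \<inter> \<gamma> -` fst c) D"
    "\<And>t. t \<in> {a..b} \<Longrightarrow> \<gamma> t \<in> fst c \<Longrightarrow> ((snd c \<circ> \<gamma>) has_vector_derivative D t) (at t within {a..b})"
    using C1_curve_onD[OF C c(1)] by blast
  have "open (fst c \<inter> \<pi> -` fst e)"
    using chart_open[OF src.is_chart[OF c(1)]] open_vimage[OF chart_open[OF tgt.is_chart[OF e(1)]] continuous] by (rule open_Int)
  then obtain W where W: "open W" "\<And>s. s \<in> {a..b} \<Longrightarrow> s \<in> W \<longleftrightarrow> \<gamma> s \<in> fst c \<inter> \<pi> -` fst e"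
    using continuous_on_open_vimageE[OF cont] by blast
  have inc: "\<gamma> s \<in> fst c \<and> \<pi> (\<gamma> s) \<in> fst e" if "s \<in> {a..b} \<inter> W" for s
    using W(2)[of s] that by blast
  have D2: "((snd c \<circ> \<gamma>) has_vector_derivative D s) (at s within {a..b})" if "s \<in> {a..b} \<inter> W" for s
    using D(2)[of s] inc[OF that] that by blast
  have D1: "continuous_on ({a..b} \<inter> W) D" by (rule continuous_on_subset[OF D(1)]) (use inc in blast)
  have cont': "continuous_on ({a..b} \<inter> W) \<gamma>" by (rule continuous_on_subset[OF cont]) blast
  have tW: "t \<in> W" using W(2)[OF t] c(2) e(2) by blast
  note tr = C1_chart_transfer[OF src.is_chart[OF c(1)] smooth_map_chart(2)[OF src.cover tgt.cover smooth c(1) e(1)]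
      W(1) cont' inc D1 D2]
  show ?thesis by (rule that[OF c(1) e(1) W(1) tW inc D2 tr])
qed

lemma curve_image_C1:
  assumes C: "C1_curve_on S \<gamma> a b" and ab: "a < b"
  shows "C1_curve_on A (\<pi> \<circ> \<gamma>) a b"
proof (rule C1_curve_on_localI[OF tgt.atlas ab])
  show "continuous_on {a..b} (\<pi> \<circ> \<gamma>)"
    using C1_curve_on_continuous[OF C] continuous_on_subset[OF continuous] by (rule continuous_on_compose) auto
  fix t assume "t \<in> {a..b}"
  then obtain c e W D where *: "c \<in> S" "e \<in> A" "open W" "t \<in> W"
    "\<And>s. s \<in> {a..b} \<inter> W \<Longrightarrow> \<gamma> s \<in> fst c \<and> \<pi> (\<gamma> s) \<in> fst e"
    "\<And>s. s \<in> {a..b} \<inter> W \<Longrightarrow> ((snd c \<circ> \<gamma>) has_vector_derivative D s) (at s within {a..b})"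
    "continuous_on ({a..b} \<inter> W) (\<lambda>s. frechet_derivative (snd e \<circ> \<pi> \<circ> chart_inv c) (at (snd c (\<gamma> s))) (D s))"
    "\<And>s. s \<in> {a..b} \<inter> W \<Longrightarrow> ((snd e \<circ> (\<pi> \<circ> \<gamma>)) has_vector_derivative
        frechet_derivative (snd e \<circ> \<pi> \<circ> chart_inv c) (at (snd c (\<gamma> s))) (D s)) (at s within {a..b})"
    by (rule curve_image_local[OF C]) (rule that)
  show "\<exists>c\<in>A. \<exists>W D. open W \<and> t \<in> W \<and> (\<pi> \<circ> \<gamma>) ` ({a..b} \<inter> W) \<subseteq> fst c \<and> continuous_on ({a..b} \<inter> W) D \<and>
      (\<forall>s\<in>{a..b} \<inter> W. ((snd c \<circ> (\<pi> \<circ> \<gamma>)) has_vector_derivative D s) (at s within {a..b}))"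
  proof (intro bexI[OF _ *(2)] exI conjI ballI)
    show "open W" "t \<in> W" by (fact *)+
    show "(\<pi> \<circ> \<gamma>) ` ({a..b} \<inter> W) \<subseteq> fst e" using *(5) by auto
    show "continuous_on ({a..b} \<inter> W) (\<lambda>s. frechet_derivative (snd e \<circ> \<pi> \<circ> chart_inv c) (at (snd c (\<gamma> s))) (D s))" by (rule *(7))
    show "((snd e \<circ> (\<pi> \<circ> \<gamma>)) has_vector_derivative
        frechet_derivative (snd e \<circ> \<pi> \<circ> chart_inv c) (at (snd c (\<gamma> s))) (D s)) (at s within {a..b})"
      if "s \<in> {a..b} \<inter> W" for s by (rule *(8)[OF that])
  qed
qed

lemma arc_length_image:
  assumes C: "C1_curve_on S \<gamma> a b" and ab: "a < b"
  shows "arc_length A gA (\<pi> \<circ> \<gamma>) a b = arc_length S gS \<gamma> a b"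
proof (rule arc_length_cong)
  fix t assume t: "a < t" "t < b"
  then have tI: "t \<in> {a..b}" by auto
  obtain c e W D where *: "c \<in> S" "e \<in> A" "open W" "t \<in> W"
    "\<And>s. s \<in> {a..b} \<inter> W \<Longrightarrow> \<gamma> s \<in> fst c \<and> \<pi> (\<gamma> s) \<in> fst e"
    "\<And>s. s \<in> {a..b} \<inter> W \<Longrightarrow> ((snd c \<circ> \<gamma>) has_vector_derivative D s) (at s within {a..b})"
    "continuous_on ({a..b} \<inter> W) (\<lambda>s. frechet_derivative (snd e \<circ> \<pi> \<circ> chart_inv c) (at (snd c (\<gamma> s))) (D s))"
    "\<And>s. s \<in> {a..b} \<inter> W \<Longrightarrow> ((snd e \<circ> (\<pi> \<circ> \<gamma>)) has_vector_derivative
        frechet_derivative (snd e \<circ> \<pi> \<circ> chart_inv c) (at (snd c (\<gamma> s))) (D s)) (at s within {a..b})"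
    by (rule curve_image_local[OF C tI]) (rule that)
  let ?\<Phi> = "snd e \<circ> \<pi> \<circ> chart_inv c" and ?y = "snd c (\<gamma> t)"
  have tW: "t \<in> {a..b} \<inter> W" using tI *(4) by blast
  have inc: "\<gamma> t \<in> fst c" "\<pi> (\<gamma> t) \<in> fst e" using *(5)[OF tW] by auto
  have y: "?y \<in> snd c ` (fst c \<inter> \<pi> -` fst e)" using inc by blast
  have \<Phi>y: "?\<Phi> ?y = snd e (\<pi> (\<gamma> t))" by (simp add: chart_inv_left[OF src.is_chart[OF *(1)] inc(1)])
  have "speed S gS \<gamma> t = sqrt (metric_in_chart S gS c ?y (D t) (D t))"
    by (rule src.speed_in_chart[OF *(1) inc(1) t C1_curve_on_continuous[OF C] *(6)[OF tW]])
  also have "\<dots> = sqrt (metric_in_chart A gA e (snd e (\<pi> (\<gamma> t)))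
      (frechet_derivative ?\<Phi> (at ?y) (D t)) (frechet_derivative ?\<Phi> (at ?y) (D t)))"
    unfolding isometric[OF *(1,2) y] \<Phi>y ..
  also have "\<dots> = speed A gA (\<pi> \<circ> \<gamma>) t"
    using tgt.speed_in_chart[OF *(2) _ t C1_curve_on_continuous[OF curve_image_C1[OF C ab]] *(8)[OF tW]] inc(2) by simp
  finally show "speed A gA (\<pi> \<circ> \<gamma>) t = speed S gS \<gamma> t" ..
qed

lemma chain_image:
  assumes "src.chain p q l"
  shows "tgt.chain (\<pi> p) (\<pi> q) l"
  using assms
proof (induction rule: curve_chain.induct)
  case refl
  show ?case by (rule curve_chain.refl)
next
  case (step \<gamma> a l b)
  have "tgt.chain (\<pi> p) ((\<pi> \<circ> \<gamma>) b) (l + arc_length A gA (\<pi> \<circ> \<gamma>) a b)"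
    using step.IH by (intro curve_chain.step step.hyps curve_image_C1) simp
  then show ?case by (simp add: arc_length_image[OF step.hyps(3,2)])
qed

lemma dist_image_le: "tgt.d (\<pi> p) (\<pi> q) \<le> src.d p q"
proof (rule field_le_epsilon)
  fix e :: real assume "e > 0"
  then obtain l where l: "l < src.d p q + e" "src.chain p q l"
    using src.dist_less_iff[of p q "src.d p q + e"] by auto
  have "tgt.d (\<pi> p) (\<pi> q) \<le> l" by (rule tgt.dist_le_chain[OF chain_image[OF l(2)]])
  then show "tgt.d (\<pi> p) (\<pi> q) \<le> src.d p q + e" using l(1) by simp
qed

text \<open>
  The inverse function theorem in charts. The derivative \<open>h'\<close> of the section is described by the linear
  equation that it solves, which is what the lifting of velocities uses.
\<close>

lemma local_section:
  obtains c e N h where "c \<in> S" "p \<in> fst c" "e \<in> A" "open N" "\<pi> p \<in> N" "N \<subseteq> fst e"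
    "h (snd e (\<pi> p)) = snd c p"
    "\<And>q. q \<in> N \<Longrightarrow> h (snd e q) \<in> snd c ` (fst c \<inter> \<pi> -` fst e) \<and> \<pi> (chart_inv c (h (snd e q))) = q"
    "\<And>q. q \<in> N \<Longrightarrow> \<exists>h'. (h has_derivative h') (at (snd e q)) \<and>
      (\<forall>v. frechet_derivative (snd e \<circ> \<pi> \<circ> chart_inv c) (at (h (snd e q))) (h' v) = v)"
proof -
  obtain c where c: "c \<in> S" "p \<in> fst c" using chart_coverE[OF src.cover] by blast
  obtain e where e: "e \<in> A" "\<pi> p \<in> fst e" using chart_coverE[OF tgt.cover] by blast
  note chc = src.is_chart[OF c(1)] and che = tgt.is_chart[OF e(1)]
  define U where "U = snd c ` (fst c \<inter> \<pi> -` fst e)"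
  define \<Phi> where "\<Phi> = snd e \<circ> \<pi> \<circ> chart_inv c"
  interpret iso: local_isometry_field U "metric_in_chart S gS c" "chart_image e" "metric_in_chart A gA e" \<Phi>
    unfolding U_def \<Phi>_def by (rule isometry_in_charts[OF c(1) e(1)])
  define y where "y = snd c p"
  have y: "y \<in> U" unfolding y_def U_def using c e by blast
  \<comment> \<open>identify the two model spaces, which are distinct types of equal dimension\<close>
  obtain L :: "'e \<Rightarrow> 'f" and L' where L: "linear L" "linear L'" "\<And>x. L' (L x) = x" "\<And>x. L (L' x) = x"
    using isomorphisms_UNIV_UNIV[OF dims[symmetric]] by metis
  have bl: "bounded_linear L" "bounded_linear L'" using L by (auto simp: linear_conv_bounded_linear)
  define f' where "f' = (\<lambda>z. Blinfun (\<lambda>v. L (iso.d\<Phi> z v)))"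
  have f': "blinfun_apply (f' z) = (\<lambda>v. L (iso.d\<Phi> z v))" if "z \<in> U" for z
    unfolding f'_def
    by (rule bounded_linear_Blinfun_apply[OF bounded_linear_compose[OF bl(1) has_derivative_bounded_linear[OF iso.d\<Phi>[OF that]]]])
  obtain R where R: "linear R" "R \<circ> iso.d\<Phi> y = id"
    using linear_injective_left_inverse[OF iso.linear_d\<Phi>[OF y] iso.inj_d\<Phi>[OF y]] by blast
  define invf where "invf = Blinfun (\<lambda>x. R (L' x))"
  have invf: "blinfun_apply invf = (\<lambda>x. R (L' x))"
    unfolding invf_def
    by (rule bounded_linear_Blinfun_apply) (use linear_compose[OF L(2) R(1)] in \<open>simp add: linear_conv_bounded_linear o_def\<close>)
  obtain U' V h g' where ift: "open U'" "U' \<subseteq> U" "y \<in> U'" "open V" "L (\<Phi> y) \<in> V"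
    "homeomorphism U' V (\<lambda>z. L (\<Phi> z)) h" "\<And>x. x \<in> V \<Longrightarrow> (h has_derivative g' x) (at x)"
    "\<And>x. x \<in> V \<Longrightarrow> g' x = inv (blinfun_apply (f' (h x)))"
    "\<And>x. x \<in> V \<Longrightarrow> bij (blinfun_apply (f' (h x)))"
  proof (rule inverse_function_theorem[OF iso.src.open_U _ _ y])
    show "((\<lambda>z. L (\<Phi> z)) has_derivative blinfun_apply (f' z)) (at z)" if "z \<in> U" for z
      unfolding f'[OF that] by (rule bounded_linear.has_derivative[OF bl(1) iso.d\<Phi>[OF that]])
    show "continuous_on U f'"
    proof (rule continuous_on_blinfun_componentwise)
      fix i :: 'f
      have "continuous_on U (\<lambda>z. L (iso.d\<Phi> z i))"
        by (rule bounded_linear.continuous_on[OF bl(1) smooth_on_continuous_on[OF smooth_on_frechet[OF iso.smooth]]])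
      then show "continuous_on U (\<lambda>z. blinfun_apply (f' z) i)"
        by (rule continuous_on_eq) (simp add: f')
    qed
    show "invf o\<^sub>L f' y = id_blinfun"
      by (rule blinfun_eqI) (use R(2) in \<open>simp add: invf f'[OF y] L(3) fun_eq_iff\<close>)
  qed blast
  have hom: "\<And>z. z \<in> U' \<Longrightarrow> h (L (\<Phi> z)) = z" "\<And>x. x \<in> V \<Longrightarrow> L (\<Phi> (h x)) = x" "h ` V = U'"
    using ift(6) by (auto simp: homeomorphism_def)
  define N where "N = fst e \<inter> snd e -` (L -` V)"
  have N: "open N"
    unfolding N_def
    by (rule continuous_open_preimage[OF chart_continuous[OF che] chart_open[OF che]
          open_vimage[OF ift(4) linear_continuous_on[OF bl(1)]]])
  have \<Phi>y: "\<Phi> y = snd e (\<pi> p)" by (simp add: \<Phi>_def y_def chart_inv_left[OF chc c(2)])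
  have hU: "h (L (snd e q)) \<in> U" if "q \<in> N" for q
    using that hom(3) ift(2) by (auto simp: N_def)
  show ?thesis
  proof (rule that[OF c e(1) N, of "\<lambda>x. h (L x)"])
    show "\<pi> p \<in> N" using e(2) ift(5) \<Phi>y by (simp add: N_def)
    show "N \<subseteq> fst e" by (auto simp: N_def)
    show "h (L (snd e (\<pi> p))) = snd c p" using hom(1)[OF ift(3)] unfolding \<Phi>y unfolding y_def .
    fix q assume q: "q \<in> N"
    then have V: "L (snd e q) \<in> V" and qe: "q \<in> fst e" by (auto simp: N_def)
    have "L (\<Phi> (h (L (snd e q)))) = L (snd e q)" by (rule hom(2)[OF V])
    then have \<Phi>h: "\<Phi> (h (L (snd e q))) = snd e q" using L(3) by metis
    obtain r where r: "r \<in> fst c" "\<pi> r \<in> fst e" "h (L (snd e q)) = snd c r"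
      using hU[OF q] unfolding U_def by blast
    have "snd e (\<pi> r) = snd e q" using \<Phi>h by (simp add: r(3) \<Phi>_def chart_inv_left[OF chc r(1)])
    then have "\<pi> r = q" using chart_inv_left[OF che r(2)] chart_inv_left[OF che qe] by metis
    then show "h (L (snd e q)) \<in> snd c ` (fst c \<inter> \<pi> -` fst e) \<and> \<pi> (chart_inv c (h (L (snd e q)))) = q"
      using hU[OF q] by (simp add: U_def r(3) chart_inv_left[OF chc r(1)])
    let ?h' = "\<lambda>v. g' (L (snd e q)) (L v)"
    have "((\<lambda>x. h (L x)) has_derivative ?h') (at (snd e q))"
      by (rule has_derivative_compose[OF bounded_linear_imp_has_derivative[OF bl(1)] ift(7)[OF V]])
    moreover have "iso.d\<Phi> (h (L (snd e q))) (?h' v) = v" for v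
    proof -
      have "blinfun_apply (f' (h (L (snd e q)))) (?h' v) = L v"
        unfolding ift(8)[OF V] by (rule surj_f_inv_f[OF bij_is_surj[OF ift(9)[OF V]]])
      then have "L (iso.d\<Phi> (h (L (snd e q))) (?h' v)) = L v" unfolding f'[OF hU[OF q]] .
      then show ?thesis using L(3) by metis
    qed
    ultimately show "\<exists>h'. ((\<lambda>x. h (L x)) has_derivative h') (at (snd e q)) \<and>
      (\<forall>v. frechet_derivative (snd e \<circ> \<pi> \<circ> chart_inv c) (at (h (L (snd e q)))) (h' v) = v)"
      unfolding \<Phi>_def by blast
  qed
qed

text \<open>
  Compose the curve with a local section of \<open>\<pi>\<close>. The velocity of the composite depends continuously on time
  because it solves a linear system with continuous coefficients.
\<close>

lemma local_lift:
  obtains N where "open N" "\<pi> p \<in> N"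
    "\<And>\<gamma> a b. a < b \<Longrightarrow> C1_curve_on A \<gamma> a b \<Longrightarrow> \<gamma> ` {a..b} \<subseteq> N \<Longrightarrow> \<gamma> a = \<pi> p \<Longrightarrow>
      \<exists>\<gamma>'. C1_curve_on S \<gamma>' a b \<and> \<gamma>' a = p \<and> (\<forall>t\<in>{a..b}. \<pi> (\<gamma>' t) = \<gamma> t)"
proof -
  obtain c e N h where c: "c \<in> S" "p \<in> fst c" and e: "e \<in> A" and N: "open N" "\<pi> p \<in> N" "N \<subseteq> fst e"
    and h0: "h (snd e (\<pi> p)) = snd c p"
    and h: "\<And>q. q \<in> N \<Longrightarrow> h (snd e q) \<in> snd c ` (fst c \<inter> \<pi> -` fst e) \<and> \<pi> (chart_inv c (h (snd e q))) = q"
    and h': "\<And>q. q \<in> N \<Longrightarrow> \<exists>h'. (h has_derivative h') (at (snd e q)) \<and>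
      (\<forall>v. frechet_derivative (snd e \<circ> \<pi> \<circ> chart_inv c) (at (h (snd e q))) (h' v) = v)"
    using local_section[of p] by blast
  note chc = src.is_chart[OF c(1)]
  let ?\<Phi> = "snd e \<circ> \<pi> \<circ> chart_inv c"
  interpret iso: local_isometry_field "snd c ` (fst c \<inter> \<pi> -` fst e)" "metric_in_chart S gS c"
      "chart_image e" "metric_in_chart A gA e" ?\<Phi>
    by (rule isometry_in_charts[OF c(1) e(1)])
  have "\<exists>\<gamma>'. C1_curve_on S \<gamma>' a b \<and> \<gamma>' a = p \<and> (\<forall>t\<in>{a..b}. \<pi> (\<gamma>' t) = \<gamma> t)"
    if ab: "a < b" and C: "C1_curve_on A \<gamma> a b" and inN: "\<gamma> ` {a..b} \<subseteq> N" and start: "\<gamma> a = \<pi> p" for \<gamma> a b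
  proof -
    have iN: "\<gamma> t \<in> N" if "t \<in> {a..b}" for t using inN that by blast
    define x where "x = (\<lambda>t. h (snd e (\<gamma> t)))"
    define \<gamma>' where "\<gamma>' = (\<lambda>t. chart_inv c (x t))"
    have x: "x t \<in> snd c ` (fst c \<inter> \<pi> -` fst e)" "\<pi> (\<gamma>' t) = \<gamma> t" if "t \<in> {a..b}" for t
      using h[OF iN[OF that]] by (auto simp: x_def \<gamma>'_def)
    then have xc: "x t \<in> chart_image c" if "t \<in> {a..b}" for t using that by (auto simp: chart_image_def)
    obtain D where D: "continuous_on ({a..b} \<inter> \<gamma> -` fst e) D"
      "\<And>t. t \<in> {a..b} \<Longrightarrow> \<gamma> t \<in> fst e \<Longrightarrow> ((snd e \<circ> \<gamma>) has_vector_derivative D t) (at t within {a..b})"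
      using C1_curve_onD[OF C e] by blast
    have ie: "\<gamma> t \<in> fst e" if "t \<in> {a..b}" for t using iN[OF that] N(3) by blast
    have "\<exists>h'. \<forall>t\<in>{a..b}. (h has_derivative h' t) (at (snd e (\<gamma> t))) \<and>
      (\<forall>v. frechet_derivative ?\<Phi> (at (x t)) (h' t v) = v)"
      by (rule bchoice) (use h' iN x_def in blast)
    then obtain h' where h': "\<And>t. t \<in> {a..b} \<Longrightarrow> (h has_derivative h' t) (at (snd e (\<gamma> t)))"
      "\<And>t v. t \<in> {a..b} \<Longrightarrow> frechet_derivative ?\<Phi> (at (x t)) (h' t v) = v" by blast
    define X where "X = (\<lambda>t. h' t (D t))"
    have dx: "(x has_vector_derivative X t) (at t within {a..b})" if t: "t \<in> {a..b}" for t
    proof -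
      have "(h has_derivative h' t) (at ((snd e \<circ> \<gamma>) t) within (snd e \<circ> \<gamma>) ` {a..b})"
        unfolding o_apply by (rule has_derivative_at_withinI[OF h'(1)[OF t]])
      from vector_derivative_diff_chain_within[OF D(2)[OF t ie[OF t]] this]
      show ?thesis by (simp add: x_def[abs_def] X_def o_def)
    qed
    have contx: "continuous_on {a..b} x"
      by (rule continuous_on_vector_derivative[OF dx])
    have contX: "continuous_on {a..b} X"
    proof (rule linear_system_solution_continuous_on[where A = "\<lambda>t. frechet_derivative ?\<Phi> (at (x t))" and h = D])
      show "linear (frechet_derivative ?\<Phi> (at (x t)))" if "t \<in> {a..b}" for t by (rule iso.linear_d\<Phi>[OF x(1)[OF that]])
      show "inj (frechet_derivative ?\<Phi> (at (x t)))" if "t \<in> {a..b}" for t by (rule iso.inj_d\<Phi>[OF x(1)[OF that]])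
      show "continuous_on {a..b} (\<lambda>t. frechet_derivative ?\<Phi> (at (x t)) v)" for v
        by (rule continuous_on_compose2[OF smooth_on_continuous_on[OF smooth_on_frechet[OF iso.smooth]] contx])
          (use x(1) in blast)
      show "continuous_on {a..b} D" by (rule continuous_on_subset[OF D(1)]) (use ie in blast)
      show "frechet_derivative ?\<Phi> (at (x t)) (X t) = D t" if "t \<in> {a..b}" for t
        unfolding X_def by (rule h'(2)[OF that])
    qed
    have d\<gamma>': "((snd c \<circ> \<gamma>') has_vector_derivative X s) (at s within {a..b})" if s: "s \<in> {a..b}" for s
      by (rule has_vector_derivative_transform[OF s _ dx[OF s]]) (simp add: \<gamma>'_def chart_inv_right[OF chc xc])
    have "C1_curve_on S \<gamma>' a b"
    proof (rule C1_curve_on_localI[OF src.atlas ab])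
      show "continuous_on {a..b} \<gamma>'"
        unfolding \<gamma>'_def by (rule continuous_on_compose2[OF chart_inv_continuous[OF chc] contx]) (use xc in blast)
      fix t :: real
      show "\<exists>c\<in>S. \<exists>W D. open W \<and> t \<in> W \<and> \<gamma>' ` ({a..b} \<inter> W) \<subseteq> fst c \<and> continuous_on ({a..b} \<inter> W) D \<and>
        (\<forall>s\<in>{a..b} \<inter> W. ((snd c \<circ> \<gamma>') has_vector_derivative D s) (at s within {a..b}))"
      proof (intro bexI[OF _ c(1)] exI[of _ "UNIV :: real set"] exI[of _ X] conjI ballI)
        show "\<gamma>' ` ({a..b} \<inter> UNIV) \<subseteq> fst c" unfolding \<gamma>'_def using chart_inv_mem[OF chc xc] by auto
        show "((snd c \<circ> \<gamma>') has_vector_derivative X s) (at s within {a..b})" if "s \<in> {a..b} \<inter> UNIV" for s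
          using d\<gamma>' that by blast
      qed (use contX in auto)
    qed
    moreover have "\<gamma>' a = p" by (simp add: \<gamma>'_def x_def start h0 chart_inv_left[OF chc c(2)])
    ultimately show ?thesis using x(2) by blast
  qed
  from that[OF N(1,2) this] show ?thesis .
qed

end

section \<open>Completeness and parabolicity descend along a local isometry\<close>

locale complete_local_isometry = local_isometry S gS A gA \<pi>
  for S :: "('s::t2_space, 'f::euclidean_space) chart set" and gS
    and A :: "('m::t2_space, 'e::euclidean_space) chart set" and gA and \<pi> +
  assumes complete: "complete_metric S gS"
begin

sublocale dS: Metric_space UNIV src.d by (rule src.metric_space)
sublocale dM: Metric_space UNIV tgt.d by (rule tgt.metric_space)

lemma Cauchy_limit:
  fixes x :: "nat \<Rightarrow> 's"
  assumes "\<And>\<epsilon>. \<epsilon> > 0 \<Longrightarrow> \<exists>N. \<forall>m n. N \<le> m \<longrightarrow> m \<le> n \<longrightarrow> src.d (x m) (x n) < \<epsilon>"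
  obtains l where "\<And>\<epsilon>. \<epsilon> > 0 \<Longrightarrow> \<exists>N. \<forall>n\<ge>N. src.d (x n) l < \<epsilon>"
proof -
  have "dS.MCauchy x"
    unfolding dS.MCauchy_def
  proof (intro conjI allI impI)
    fix \<epsilon> :: real assume "\<epsilon> > 0"
    then obtain N where N: "\<And>m n. N \<le> m \<Longrightarrow> m \<le> n \<Longrightarrow> src.d (x m) (x n) < \<epsilon>" using assms by blast
    have "src.d (x m) (x n) < \<epsilon>" if "N \<le> m" "N \<le> n" for m n
      using N[of m n] N[of n m] that dS.commute[of "x m" "x n"] by (cases "m \<le> n") auto
    then show "\<exists>N. \<forall>n n'. N \<le> n \<longrightarrow> N \<le> n' \<longrightarrow> src.d (x n) (x n') < \<epsilon>" by blast
  qed simp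
  then obtain l where "limitin dS.mtopology x l sequentially"
    using complete unfolding complete_metric_def dS.mcomplete_def by blast
  then show ?thesis using that[of l] unfolding dS.limit_metric_sequentially by blast
qed

text \<open>
  A partial lift is recorded by its end only, as a pair \<open>x\<close> of a time and a point over the curve at that
  time; \<open>le x y\<close> says that the points of \<open>x\<close> and \<open>y\<close> are no farther apart than the arc of the curve between
  the two times is long. Choose a sequence of such pairs in which every step advances by at least half of
  what is possible. The points form a Cauchy sequence, since the times are bounded, and the limit supplied
  by completeness is again a pair of this kind. Before the final time it could be extended locally, by a
  fixed amount that would have been available at every step, contrary to the choice of the steps.
  Comparing distances rather than lifted curves is what makes a limit of partial lifts a partial lift.
\<close>

lemma lift_segment:
  assumes ab: "a < b" and C: "C1_curve_on A \<gamma> a b" and p: "\<pi> p = \<gamma> a"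
  shows "\<exists>q. \<pi> q = \<gamma> b \<and> src.d p q \<le> arc_length A gA \<gamma> a b"
proof (rule ccontr)
  assume contra: "\<nexists>q. \<pi> q = \<gamma> b \<and> src.d p q \<le> arc_length A gA \<gamma> a b"
  define L where "L = (\<lambda>t. arc_length A gA \<gamma> a t)"
  have sub: "C1_curve_on A \<gamma> s t" if "a \<le> s" "t \<le> b" for s t by (rule C1_curve_on_subinterval[OF C that])
  have L_seg: "arc_length A gA \<gamma> s t = L t - L s" if "a \<le> s" "s \<le> t" "t \<le> b" for s t
    using tgt.arc_length_combine[OF C that] by (simp add: L_def)
  have L_mono: "L s \<le> L t" if "a \<le> s" "s \<le> t" "t \<le> b" for s t
    using L_seg[OF that] tgt.arc_length_nonneg[OF sub[OF that(1,3)]] by simp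
  have L_cont: "continuous_on {a..b} L"
    unfolding L_def arc_length_def by (rule indefinite_integral_continuous_1[OF tgt.speed_integrable[OF C]])
  have La: "L a = 0" by (simp add: L_def arc_length_def)
  define X where "X = {x. fst x \<in> {a..b} \<and> \<pi> (snd x) = \<gamma> (fst x)}"
  define le where "le = (\<lambda>x y. x \<in> X \<and> y \<in> X \<and> fst x \<le> fst y \<and> src.d (snd x) (snd y) \<le> L (fst y) - L (fst x))"
  have le_refl: "le x x" if "x \<in> X" for x using that by (simp add: le_def)
  have le_trans: "le x z" if "le x y" "le y z" for x y z
    using that dS.triangle[of "snd x" "snd y" "snd z"] by (auto simp: le_def)
  \<comment> \<open>local lifting makes every partial lift that does not end at time b extendable\<close>
  have extend: "\<exists>y. le x y \<and> fst x < fst y" if x: "x \<in> X" and "fst x < b" for x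
  proof -
    obtain N where N: "open N" "\<pi> (snd x) \<in> N"
      "\<And>\<gamma> a b. a < b \<Longrightarrow> C1_curve_on A \<gamma> a b \<Longrightarrow> \<gamma> ` {a..b} \<subseteq> N \<Longrightarrow> \<gamma> a = \<pi> (snd x) \<Longrightarrow>
        \<exists>\<gamma>'. C1_curve_on S \<gamma>' a b \<and> \<gamma>' a = snd x \<and> (\<forall>t\<in>{a..b}. \<pi> (\<gamma>' t) = \<gamma> t)"
      by (rule local_lift[of "snd x"]) (rule that)
    have fx: "fst x \<in> {a..b}" "\<gamma> (fst x) = \<pi> (snd x)" using x by (auto simp: X_def)
    obtain W where W: "open W" "\<And>s. s \<in> {a..b} \<Longrightarrow> s \<in> W \<longleftrightarrow> \<gamma> s \<in> N"
      using continuous_on_open_vimageE[OF C1_curve_on_continuous[OF C] N(1)] by blast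
    have "fst x \<in> W" using W(2)[OF fx(1)] N(2) fx(2) by simp
    then obtain e where e: "e > 0" "ball (fst x) e \<subseteq> W" using W(1) openE by blast
    define t where "t = min b (fst x + e / 2)"
    have t: "fst x < t" "t \<le> b" using e(1) that by (auto simp: t_def)
    have inN: "\<gamma> ` {fst x..t} \<subseteq> N"
    proof (rule image_subsetI)
      fix s assume s: "s \<in> {fst x..t}"
      then have "s \<in> ball (fst x) e" using e(1) by (auto simp: t_def dist_real_def)
      then show "\<gamma> s \<in> N" using e(2) W(2)[of s] s fx(1) t(2) by auto
    qed
    have Cx: "C1_curve_on A \<gamma> (fst x) t" by (rule sub) (use fx t in auto)
    obtain \<gamma>' where \<gamma>': "C1_curve_on S \<gamma>' (fst x) t" "\<gamma>' (fst x) = snd x" "\<And>s. s \<in> {fst x..t} \<Longrightarrow> \<pi> (\<gamma>' s) = \<gamma> s"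
      using N(3)[OF t(1) Cx inN fx(2)] by blast
    have "src.d (snd x) (\<gamma>' t) \<le> arc_length S gS \<gamma>' (fst x) t"
      using src.dist_le_chain[OF curve_chain_segment[OF t(1) \<gamma>'(1)]] \<gamma>'(2) by simp
    also have "\<dots> = arc_length A gA (\<pi> \<circ> \<gamma>') (fst x) t" by (rule arc_length_image[OF \<gamma>'(1) t(1), symmetric])
    also have "\<dots> = arc_length A gA \<gamma> (fst x) t" by (rule tgt.arc_length_C1_cong[OF Cx]) (simp add: \<gamma>'(3))
    also have "\<dots> = L t - L (fst x)" by (rule L_seg) (use fx t in auto)
    finally have "src.d (snd x) (\<gamma>' t) \<le> L t - L (fst x)" .
    moreover have "(t, \<gamma>' t) \<in> X" using \<gamma>'(3)[of t] t fx(1) by (simp add: X_def)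
    ultimately have "le x (t, \<gamma>' t)" using x t by (simp add: le_def)
    then show ?thesis using t(1) by (intro exI[of _ "(t, \<gamma>' t)"]) simp
  qed
  define s where "s = (\<lambda>x. Sup {fst y | y. le x y})"
  have bdd: "bdd_above {fst y | y. le x y}" for x
    by (rule bdd_aboveI[of _ b]) (auto simp: le_def X_def)
  have s_ge: "fst y \<le> s x" if "le x y" for x y
    unfolding s_def by (rule cSup_upper[OF _ bdd]) (use that in blast)
  \<comment> \<open>always extend by at least half of what is possible, so that the steps cannot accumulate before time b\<close>
  have next_ex: "\<exists>y. le x y \<and> (fst x + s x) / 2 \<le> fst y" if x: "x \<in> X" for x
  proof (cases "fst x < s x")
    case True
    then have "(fst x + s x) / 2 < Sup {fst y | y. le x y}" by (simp add: s_def)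
    moreover have "{fst y | y. le x y} \<noteq> {}" using le_refl[OF x] by blast
    ultimately obtain z where "z \<in> {fst y | y. le x y}" "(fst x + s x) / 2 < z" using less_cSup_iff[OF _ bdd] by blast
    then show ?thesis by auto
  next
    case False
    then show ?thesis using le_refl[OF x] by (intro exI[of _ x]) auto
  qed
  have x0: "(a, p) \<in> X" using p ab by (simp add: X_def)
  have "\<exists>x. \<forall>n. (x n \<in> X \<and> le (a, p) (x n)) \<and> (le (x n) (x (Suc n)) \<and> (fst (x n) + s (x n)) / 2 \<le> fst (x (Suc n)))"
  proof (rule dependent_nat_choice)
    show "\<exists>x. x \<in> X \<and> le (a, p) x" using x0 le_refl by blast
    fix x :: "real \<times> 's" and n :: nat
    assume x: "x \<in> X \<and> le (a, p) x"
    then obtain y where y: "le x y" "(fst x + s x) / 2 \<le> fst y" using next_ex by blast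
    then have "y \<in> X" by (simp add: le_def)
    then show "\<exists>y. (y \<in> X \<and> le (a, p) y) \<and> (le x y \<and> (fst x + s x) / 2 \<le> fst y)"
      using y x le_trans[of "(a, p)" x y] by blast
  qed
  then obtain x where xX: "\<And>n. x n \<in> X" and x_start: "\<And>n. le (a, p) (x n)"
    and x_step: "\<And>n. le (x n) (x (Suc n))" and x_half: "\<And>n. (fst (x n) + s (x n)) / 2 \<le> fst (x (Suc n))"
    by blast
  have x_le: "le (x m) (x n)" if "m \<le> n" for m n
    using that
  proof (induction rule: dec_induct)
    case base
    show ?case by (rule le_refl[OF xX])
  next
    case (step n)
    then show ?case using le_trans[OF _ x_step] by blast
  qed
  define t where "t = (\<lambda>n. fst (x n))"
  have tI: "t n \<in> {a..b}" for n using xX[of n] by (simp add: X_def t_def)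
  have t_inc: "incseq t" unfolding incseq_def t_def using x_le by (auto simp: le_def)
  moreover have "bdd_above (range t)" using tI by (intro bdd_aboveI[of _ b]) auto
  ultimately obtain T where T: "t \<longlonglongrightarrow> T" using LIMSEQ_incseq_SUP by blast
  have tT: "t n \<le> T" for n by (rule incseq_le[OF t_inc T])
  have TI: "T \<in> {a..b}" by (rule Lim_in_closed_set[OF closed_atLeastAtMost _ _ T]) (use tI in auto)
  have LT: "(\<lambda>n. L (t n)) \<longlonglongrightarrow> L T"
    by (rule continuous_on_tendsto_compose[OF L_cont T TI]) (use tI in auto)
  have dx: "src.d (snd (x m)) (snd (x n)) \<le> L (t n) - L (t m)" if "m \<le> n" for m n
    using x_le[OF that] by (simp add: le_def t_def)
  have dxT: "src.d (snd (x m)) (snd (x n)) \<le> L T - L (t m)" if "m \<le> n" for m n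
    using dx[OF that] L_mono[of "t n" T] tI[of n] TI tT[of n] by auto
  have near: "\<exists>N. \<forall>n\<ge>N. L T - L (t n) < \<epsilon>" if \<epsilon>: "\<epsilon> > 0" for \<epsilon>
  proof -
    obtain N where N: "\<And>n. n \<ge> N \<Longrightarrow> \<bar>L (t n) - L T\<bar> < \<epsilon>"
      using LIMSEQ_D[OF LT \<epsilon>] by (auto simp: real_norm_def)
    have "L T - L (t n) < \<epsilon>" if "n \<ge> N" for n using N[OF that] by linarith
    then show ?thesis by blast
  qed
  obtain q where q: "\<And>\<epsilon>. \<epsilon> > 0 \<Longrightarrow> \<exists>N. \<forall>n\<ge>N. src.d (snd (x n)) q < \<epsilon>"
  proof (rule Cauchy_limit[of "\<lambda>n. snd (x n)"])
    fix \<epsilon> :: real assume "\<epsilon> > 0"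
    then obtain N where "\<And>n. n \<ge> N \<Longrightarrow> L T - L (t n) < \<epsilon>" using near by blast
    then show "\<exists>N. \<forall>m n. N \<le> m \<longrightarrow> m \<le> n \<longrightarrow> src.d (snd (x m)) (snd (x n)) < \<epsilon>"
      using dxT by (meson order_le_less_trans)
  qed blast
  have "tgt.d (\<pi> q) (\<gamma> T) \<le> 0"
  proof (rule field_le_epsilon)
    fix \<epsilon> :: real assume \<epsilon>: "\<epsilon> > 0"
    then obtain N1 where N1: "\<And>n. n \<ge> N1 \<Longrightarrow> src.d (snd (x n)) q < \<epsilon> / 2" using q[of "\<epsilon> / 2"] by auto
    obtain N2 where N2: "\<And>n. n \<ge> N2 \<Longrightarrow> L T - L (t n) < \<epsilon> / 2" using near[of "\<epsilon> / 2"] \<epsilon> by auto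
    define n where "n = max N1 N2"
    have "tgt.d (\<gamma> (t n)) (\<gamma> T) \<le> L T - L (t n)"
    proof (cases "t n = T")
      case False
      then have lt: "t n < T" using tT[of n] by simp
      have "tgt.d (\<gamma> (t n)) (\<gamma> T) \<le> arc_length A gA \<gamma> (t n) T"
        by (rule tgt.dist_le_chain[OF curve_chain_segment[OF lt sub]]) (use tI[of n] TI in auto)
      also have "\<dots> = L T - L (t n)" by (rule L_seg) (use tI[of n] TI lt in auto)
      finally show ?thesis .
    qed simp
    moreover have "tgt.d (\<pi> q) (\<pi> (snd (x n))) \<le> src.d (snd (x n)) q"
      using dist_image_le[of q "snd (x n)"] dS.commute by metis
    moreover have "\<pi> (snd (x n)) = \<gamma> (t n)" using xX[of n] by (simp add: X_def t_def)
    moreover have "tgt.d (\<pi> q) (\<gamma> T) \<le> tgt.d (\<pi> q) (\<gamma> (t n)) + tgt.d (\<gamma> (t n)) (\<gamma> T)"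
      by (rule dM.triangle) auto
    moreover have "src.d (snd (x n)) q < \<epsilon> / 2" "L T - L (t n) < \<epsilon> / 2" using N1[of n] N2[of n] by (auto simp: n_def)
    ultimately show "tgt.d (\<pi> q) (\<gamma> T) \<le> 0 + \<epsilon>" by simp
  qed
  then have \<pi>q: "\<pi> q = \<gamma> T" using dM.nonneg[of "\<pi> q" "\<gamma> T"] dM.zero[of "\<pi> q" "\<gamma> T"] by simp
  then have qX: "(T, q) \<in> X" using TI by (simp add: X_def)
  have limit: "le (x n) (T, q)" for n
  proof -
    have "src.d (snd (x n)) q \<le> L T - L (t n)"
    proof (rule field_le_epsilon)
      fix \<epsilon> :: real assume "\<epsilon> > 0"
      then obtain N where N: "\<And>n. n \<ge> N \<Longrightarrow> src.d (snd (x n)) q < \<epsilon>" using q by blast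
      define m where "m = max N n"
      have "src.d (snd (x n)) q \<le> src.d (snd (x n)) (snd (x m)) + src.d (snd (x m)) q" by (rule dS.triangle) auto
      then show "src.d (snd (x n)) q \<le> L T - L (t n) + \<epsilon>"
        using dxT[of n m] N[of m] by (simp add: m_def)
    qed
    then show ?thesis using xX[of n] qX tT[of n] by (simp add: le_def t_def)
  qed
  have "T \<noteq> b"
  proof
    assume "T = b"
    with le_trans[OF x_start limit] have "le (a, p) (b, q)" by blast
    then have "src.d p q \<le> arc_length A gA \<gamma> a b" by (simp add: le_def La) (simp add: L_def)
    moreover have "\<pi> q = \<gamma> b" using \<pi>q \<open>T = b\<close> by simp
    ultimately show False using contra by blast
  qed
  then have "fst (T, q) < b" using TI by simp
  then obtain y where y: "le (T, q) y" "T < fst y" using extend[OF qX] by auto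
  have "(t n + fst y) / 2 \<le> t (Suc n)" for n
    using s_ge[OF le_trans[OF limit y(1)], of n] x_half[of n] by (simp add: t_def)
  then have "(t n + fst y) / 2 \<le> T" for n using tT[of "Suc n"] by (meson order_trans)
  moreover have "(\<lambda>n. (t n + fst y) / 2) \<longlonglongrightarrow> (T + fst y) / 2" by (intro tendsto_intros T) auto
  ultimately have "(T + fst y) / 2 \<le> T" by (intro LIMSEQ_le_const2) auto
  with y(2) show False by simp
qed

lemma lift_chain:
  assumes "tgt.chain x y l" "\<pi> p = x"
  shows "\<exists>q. \<pi> q = y \<and> src.d p q \<le> l"
  using assms
proof (induction rule: curve_chain.induct)
  case refl
  then show ?case by (intro exI[of _ p]) (simp add: dS.zero)
next
  case (step \<gamma> a l b)
  then obtain q where q: "\<pi> q = \<gamma> a" "src.d p q \<le> l" by blast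
  obtain r where r: "\<pi> r = \<gamma> b" "src.d q r \<le> arc_length A gA \<gamma> a b"
    using lift_segment[OF step.hyps(2,3) q(1)] by blast
  have "src.d p r \<le> src.d p q + src.d q r" by (rule dS.triangle) auto
  with q r show ?case by (intro exI[of _ r]) simp
qed

lemma surjective: "\<exists>q. \<pi> q = y"
  using tgt.chain_exists[of "\<pi> undefined" y] lift_chain by blast

lemma lift_dist:
  assumes "tgt.d (\<pi> p) y < e"
  shows "\<exists>q. \<pi> q = y \<and> src.d p q < e"
proof -
  obtain l where "l < e" "tgt.chain (\<pi> p) y l" using assms tgt.dist_less_iff by blast
  with lift_chain[of "\<pi> p" y l p] show ?thesis by force
qed

text \<open>
  A Cauchy sequence has a subsequence whose consecutive distances are summable. It lifts step by step to a
  sequence with summable distances, whose limit projects to a limit of the given sequence.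
\<close>

lemma complete_target: "complete_metric A gA"
  unfolding complete_metric_def dM.mcomplete_def
proof (intro allI impI)
  fix \<sigma> assume "dM.MCauchy \<sigma>"
  then have Cau: "\<exists>N. \<forall>m n. N \<le> m \<longrightarrow> N \<le> n \<longrightarrow> tgt.d (\<sigma> m) (\<sigma> n) < \<epsilon>" if "\<epsilon> > 0" for \<epsilon>
    using that unfolding dM.MCauchy_def by blast
  \<comment> \<open>lift a rapidly converging subsequence step by step\<close>
  let ?P = "\<lambda>k x. \<pi> (snd x) = \<sigma> (fst x) \<and> k \<le> fst x \<and> (\<forall>m n. fst x \<le> m \<longrightarrow> fst x \<le> n \<longrightarrow> tgt.d (\<sigma> m) (\<sigma> n) < (1/2)^k)"
  have "\<exists>x. \<forall>k. ?P k (x k) \<and> src.d (snd (x k)) (snd (x (Suc k))) < (1/2)^k"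
  proof (rule dependent_nat_choice)
    obtain N where N: "\<forall>m n. N \<le> m \<longrightarrow> N \<le> n \<longrightarrow> tgt.d (\<sigma> m) (\<sigma> n) < (1/2)^0" using Cau[of "(1/2)^0"] by auto
    obtain q where "\<pi> q = \<sigma> N" using surjective by blast
    with N show "\<exists>x. ?P 0 x" by (intro exI[of _ "(N, q)"]) simp
  next
    fix x :: "nat \<times> 's" and k
    assume x: "?P k x"
    obtain N where N: "\<forall>m n. N \<le> m \<longrightarrow> N \<le> n \<longrightarrow> tgt.d (\<sigma> m) (\<sigma> n) < (1/2)^(Suc k)"
      using Cau[of "(1/2)^(Suc k)"] by auto
    define M where "M = max (Suc k) (max N (fst x))"
    have M: "Suc k \<le> M" "N \<le> M" "fst x \<le> M" by (auto simp: M_def)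
    have "tgt.d (\<pi> (snd x)) (\<sigma> M) < (1/2)^k" using x M(3) by auto
    then obtain q where q: "\<pi> q = \<sigma> M" "src.d (snd x) q < (1/2)^k" using lift_dist by blast
    show "\<exists>y. ?P (Suc k) y \<and> src.d (snd x) (snd y) < (1/2)^k"
      using q M(1,2) N by (intro exI[of _ "(M, q)"]) (auto intro: order_trans)
  qed
  then obtain x where x: "\<And>k. ?P k (x k)" and step: "\<And>k. src.d (snd (x k)) (snd (x (Suc k))) < (1/2)^k" by blast
  have tele: "src.d (snd (x m)) (snd (x n)) \<le> 2 * (1/2)^m - 2 * (1/2)^n" if "m \<le> n" for m n
    using that
  proof (induction rule: dec_induct)
    case base
    show ?case by (simp add: dS.zero)
  next
    case (step n)
    have "src.d (snd (x m)) (snd (x (Suc n))) \<le> src.d (snd (x m)) (snd (x n)) + src.d (snd (x n)) (snd (x (Suc n)))"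
      by (rule dS.triangle) auto
    also have "\<dots> \<le> (2 * (1/2)^m - 2 * (1/2)^n) + (1/2)^n"
      using step.IH \<open>\<And>k. src.d (snd (x k)) (snd (x (Suc k))) < (1/2)^k\<close>[of n] by linarith
    finally show ?case by simp
  qed
  have small: "\<exists>N. \<forall>n\<ge>N. 2 * (1/2)^n < \<epsilon>" if "\<epsilon> > 0" for \<epsilon> :: real
  proof -
    have "(1/2 :: real) < 1" by simp
    from real_arch_pow_inv[OF half_gt_zero[OF that] this] obtain N where N: "(1/2)^N < \<epsilon> / 2" by blast
    have "2 * (1/2)^n < \<epsilon>" if "n \<ge> N" for n
    proof -
      have "(1/2 :: real)^n \<le> (1/2)^N" by (rule power_decreasing[OF that]) simp_all
      with N show ?thesis by linarith
    qed
    then show ?thesis by blast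
  qed
  obtain q where q: "\<And>\<epsilon>. \<epsilon> > 0 \<Longrightarrow> \<exists>N. \<forall>n\<ge>N. src.d (snd (x n)) q < \<epsilon>"
  proof (rule Cauchy_limit[of "\<lambda>n. snd (x n)"])
    fix \<epsilon> :: real assume "\<epsilon> > 0"
    then obtain N where N: "\<And>n. n \<ge> N \<Longrightarrow> 2 * (1/2)^n < \<epsilon>" using small by blast
    have "src.d (snd (x m)) (snd (x n)) < \<epsilon>" if "N \<le> m" "m \<le> n" for m n
    proof -
      have "(0::real) < 2 * (1/2)^n" by simp
      with tele[OF that(2)] N[OF that(1)] show ?thesis by linarith
    qed
    then show "\<exists>N. \<forall>m n. N \<le> m \<longrightarrow> m \<le> n \<longrightarrow> src.d (snd (x m)) (snd (x n)) < \<epsilon>" by blast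
  qed blast
  have "limitin dM.mtopology \<sigma> (\<pi> q) sequentially"
    unfolding dM.limit_metric_sequentially
  proof (intro conjI allI impI)
    fix \<epsilon> :: real assume "\<epsilon> > 0"
    then obtain N1 N2 where N1: "\<And>n. n \<ge> N1 \<Longrightarrow> src.d (snd (x n)) q < \<epsilon> / 2" and N2: "\<And>n. n \<ge> N2 \<Longrightarrow> 2 * (1/2)^n < \<epsilon>"
      using q[of "\<epsilon> / 2"] small[of \<epsilon>] by auto
    define k where "k = max N1 N2"
    have "tgt.d (\<sigma> n) (\<pi> q) < \<epsilon>" if "n \<ge> fst (x k)" for n
    proof -
      have "tgt.d (\<sigma> n) (\<pi> q) \<le> tgt.d (\<sigma> n) (\<pi> (snd (x k))) + tgt.d (\<pi> (snd (x k))) (\<pi> q)" by (rule dM.triangle) auto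
      moreover have "tgt.d (\<sigma> n) (\<pi> (snd (x k))) < (1/2)^k" using x[of k] that by auto
      moreover have "tgt.d (\<pi> (snd (x k))) (\<pi> q) \<le> src.d (snd (x k)) q" by (rule dist_image_le)
      moreover have "src.d (snd (x k)) q < \<epsilon> / 2" "2 * (1/2)^k < \<epsilon>" using N1[of k] N2[of k] by (auto simp: k_def)
      ultimately show ?thesis by simp
    qed
    then show "\<exists>N. \<forall>n\<ge>N. \<sigma> n \<in> UNIV \<and> tgt.d (\<sigma> n) (\<pi> q) < \<epsilon>" by blast
  qed simp
  then show "\<exists>l. limitin dM.mtopology \<sigma> l sequentially" by blast
qed

end

lemma (in local_isometry) laplacian_image:
  assumes f: "smooth_scalar_on A UNIV f"
  shows "laplacian S gS (f \<circ> \<pi>) p = laplacian A gA f (\<pi> p)"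
proof -
  define c where "c = chart_at S p"
  define a where "a = chart_at A (\<pi> p)"
  have c: "c \<in> S" "p \<in> fst c" using chart_at_props[OF src.cover] by (auto simp: c_def)
  have a: "a \<in> A" "\<pi> p \<in> fst a" using chart_at_props[OF tgt.cover] by (auto simp: a_def)
  note chc = src.is_chart[OF c(1)] and cha = tgt.is_chart[OF a(1)]
  let ?U = "snd c ` (fst c \<inter> \<pi> -` fst a)" and ?\<Phi> = "snd a \<circ> \<pi> \<circ> chart_inv c"
  interpret iso: local_isometry_field ?U "metric_in_chart S gS c" "chart_image a" "metric_in_chart A gA a" ?\<Phi>
    by (rule isometry_in_charts[OF c(1) a(1)])
  have y: "snd c p \<in> ?U" using c a by blast
  have F: "smooth_on (chart_image a) (f \<circ> chart_inv a)"
    using f a(1) by (simp add: smooth_scalar_on_def chart_image_def)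
  have "smooth_on ?U (\<lambda>z. (f \<circ> chart_inv a) (?\<Phi> z))"
    by (rule smooth_on_compose[OF iso.src.open_U iso.smooth F]) (use iso.maps in blast)
  then have "divergence (metric_in_chart S gS c) (gradient (metric_in_chart S gS c) (\<lambda>z. (f \<circ> chart_inv a) (?\<Phi> z))) (snd c p)
      = divergence (metric_in_chart S gS c) (gradient (metric_in_chart S gS c) ((f \<circ> \<pi>) \<circ> chart_inv c)) (snd c p)"
  proof (rule iso.src.laplacian_cong[OF y])
    fix z assume "z \<in> ?U"
    then show "(f \<circ> chart_inv a) (?\<Phi> z) = (f \<circ> \<pi> \<circ> chart_inv c) z"
      using chart_inv_left[OF chc] chart_inv_left[OF cha] by auto
  qed
  moreover have "?\<Phi> (snd c p) = snd a (\<pi> p)" by (simp add: chart_inv_left[OF chc c(2)])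
  ultimately show ?thesis
    using iso.laplacian_pullback[OF y F] by (simp add: laplacian_def Let_def c_def[symmetric] a_def[symmetric])
qed

lemma (in local_isometry) parabolic_target:
  assumes "parabolic S gS"
  shows "parabolic A gA"
proof -
  interpret complete_local_isometry S gS A gA \<pi>
    by unfold_locales (use assms in \<open>simp add: parabolic_def\<close>)
  show ?thesis
    unfolding parabolic_def
  proof (intro conjI complete_target allI impI)
    fix f assume f: "superharmonic A gA f \<and> bdd_below (range f)"
    then have sm: "smooth_scalar_on A UNIV f" by (simp add: superharmonic_def)
    have "superharmonic S gS (f \<circ> \<pi>)"
      using f smooth_scalar_compose[OF src.cover tgt.cover smooth open_UNIV sm]
      by (simp add: superharmonic_def laplacian_image[OF sm])
    moreover have "bdd_below (range (f \<circ> \<pi>))"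
      by (rule bdd_below_mono[of "range f"]) (use f in auto)
    ultimately have "(f \<circ> \<pi>) constant_on UNIV" using assms by (simp add: parabolic_def)
    then obtain k where k: "\<And>p. f (\<pi> p) = k" unfolding constant_on_def by auto
    have "f x = k" for x using surjective[of x] k by metis
    then show "f constant_on UNIV" unfolding constant_on_def by blast
  qed
qed

section \<open>Wavefronts\<close>

lemma smooth_map_wavefront:
  assumes A: "smooth_atlas A"
  shows "smooth_map A (pfw_atlas A) (wavefront u0 v0)"
  unfolding smooth_map_def
proof (intro conjI ballI)
  show "continuous_on UNIV (wavefront u0 v0)" unfolding wavefront_def by (intro continuous_intros)
  fix c e assume c: "c \<in> A" and "e \<in> pfw_atlas A"
  then obtain a where a: "a \<in> A" "e = pfw_chart a" by (auto simp: pfw_atlas_eq)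
  note cov = smooth_atlas_chart_cover[OF A]
  note chc = chart_cover_is_chart[OF cov c] and cha = chart_cover_is_chart[OF cov a(1)]
  have X: "fst c \<inter> wavefront u0 v0 -` fst e = fst c \<inter> fst a" by (auto simp: a(2) pfw_chart_simps wavefront_def)
  have o: "open (snd c ` (fst c \<inter> fst a))" by (rule chart_dom_open[OF chc chart_open[OF cha]])
  have bl: "bounded_linear (\<lambda>z :: 'b. ((0 :: real, 0 :: real), z))"
    unfolding zero_prod_def[symmetric] by (rule bounded_linear_Pair[OF bounded_linear_zero bounded_linear_ident])
  have "smooth_on (snd c ` (fst c \<inter> fst a)) (snd a \<circ> chart_inv c)" using A a(1) c by (simp add: smooth_atlas_def)
  then have "smooth_on (snd c ` (fst c \<inter> fst a)) (\<lambda>y. ((0, 0), (snd a \<circ> chart_inv c) y) :: (real \<times> real) \<times> 'b)"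
    by (rule smooth_on_bounded_linear[OF bl o])
  from smooth_on_add[OF o smooth_on_const[of _ "((u0, v0), 0)"] this]
  show "smooth_on (snd c ` (fst c \<inter> wavefront u0 v0 -` fst e)) (snd e \<circ> wavefront u0 v0 \<circ> chart_inv c)"
    unfolding X by (rule smooth_on_cong[OF o]) (simp add: a(2) pfw_chart_simps wavefront_def)
qed

text \<open>
  Along a wavefront \<open>du\<close> and \<open>dv\<close> vanish and only \<open>g\<close> remains of the ambient metric.
\<close>

lemma metric_in_chart_wavefront:
  assumes A: "smooth_atlas A" and a: "a \<in> A" and y: "y \<in> chart_image a"
  shows "metric_in_chart A (pullback_metric (pfw_atlas A) (pfw_metric A g H) (wavefront u0 v0)) a y v w = metric_in_chart A g a y v w"
proof -
  note cov = smooth_atlas_chart_cover[OF A]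
  note cha = chart_cover_is_chart[OF cov a]
  let ?W = "snd (pfw_chart a) \<circ> wavefront u0 v0 \<circ> chart_inv a"
  have W: "?W z = ((u0, v0), z)" if "z \<in> chart_image a" for z
    by (simp add: pfw_chart_simps wavefront_def chart_inv_right[OF cha that])
  have "((\<lambda>z. ((u0, v0), z)) has_derivative (\<lambda>v. (0, v))) (at y)" by (auto intro!: derivative_eq_intros)
  then have "(?W has_derivative (\<lambda>v. (0, v))) (at y)"
    by (rule has_derivative_transform_within_open[OF _ chart_image_open[OF cha] y]) (simp only: W)
  then have D: "frechet_derivative ?W (at y) v = (0, v)" for v
    using frechet_derivative_at by metis
  have "y \<in> snd a ` (fst a \<inter> wavefront u0 v0 -` fst (pfw_chart a))"
    using y by (auto simp: chart_image_def pfw_chart_simps wavefront_def)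
  from metric_in_chart_pullback[OF cov chart_cover_pfw[OF cov] smooth_map_wavefront[OF A] a _ this]
  have "metric_in_chart A (pullback_metric (pfw_atlas A) (pfw_metric A g H) (wavefront u0 v0)) a y v w
     = metric_in_chart (pfw_atlas A) (pfw_metric A g H) (pfw_chart a) ((u0, v0), y) (0, v) (0, w)"
    using a by (simp only: D W[OF y] pfw_atlas_eq) blast
  also have "\<dots> = metric_in_chart A g a y v w"
    by (subst metric_in_chart_pfw[OF A a]) (simp_all add: y)
  finally show ?thesis .
qed

text \<open>
  The inclusion of a wavefront is an immersion because the projection to \<open>M\<close> is a left inverse: a tangent
  vector of \<open>M\<close> is recovered by testing its image on functions pulled back from \<open>M\<close>.
\<close>

lemma spacelike_wavefront:
  fixes A :: "('m::topological_space, 'e::euclidean_space) chart set"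
  assumes pfw: "plane_fronted_wave A g H"
  shows "spacelike_submanifold A (pfw_atlas A) (pfw_metric A g H) (wavefront u0 v0)"
proof -
  have A: "smooth_atlas A" and g: "riemannian_metric A g" and conn: "connected (UNIV :: 'm set)"
    using pfw by (auto simp: plane_fronted_wave_def riemannian_manifold_def)
  note cov = smooth_atlas_chart_cover[OF A]
  have eq: "metric_in_chart A (pullback_metric (pfw_atlas A) (pfw_metric A g H) (wavefront u0 v0)) a y v w = metric_in_chart A g a y v w"
    if "a \<in> A" "y \<in> chart_image a" for a y v w by (rule metric_in_chart_wavefront[OF A that])
  have "riemannian_metric A (pullback_metric (pfw_atlas A) (pfw_metric A g H) (wavefront u0 v0))"
    unfolding riemannian_metric_def
  proof (intro ballI conjI allI impI)
    fix a assume a: "a \<in> A"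
    interpret f: riemannian_field "chart_image a" "metric_in_chart A g a"
      by (rule riemannian_field_chart[OF g a chart_cover_is_chart[OF cov a] chart_image_open[OF chart_cover_is_chart[OF cov a]]]) simp
    let ?G = "metric_in_chart A (pullback_metric (pfw_atlas A) (pfw_metric A g H) (wavefront u0 v0)) a"
    show "smooth_on (chart_image a) (\<lambda>y. ?G y v w)" for v w
      by (rule smooth_on_cong[OF f.open_U, where f = "\<lambda>y. metric_in_chart A g a y v w"])
        (use g a in \<open>auto simp: riemannian_metric_def eq[OF a]\<close>)
    fix y assume y: "y \<in> chart_image a"
    have "?G y = metric_in_chart A g a y" by (intro ext eq[OF a y])
    then show "bilinear (?G y)" using f.bil[OF y] by simp
    show "?G y v w = ?G y w v" for v w using f.symm[OF y] by (simp only: eq[OF a y])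
    show "0 < ?G y v v" if "v \<noteq> 0" for v using f.pos[OF y that] by (simp only: eq[OF a y])
  qed
  moreover have "inj_on (differential (pfw_atlas A) (wavefront u0 v0) x) (tangent_space A x)" for x
  proof (rule inj_onI, rule ext)
    fix X Y h
    assume X: "X \<in> tangent_space A x" and Y: "Y \<in> tangent_space A x"
      and e: "differential (pfw_atlas A) (wavefront u0 v0) x X = differential (pfw_atlas A) (wavefront u0 v0) x Y"
    show "X h = Y h"
    proof (cases "smooth_near A x h")
      case True
      have "smooth_near A (snd (wavefront u0 v0 x)) h" using True by (simp add: wavefront_def)
      from smooth_near_compose[OF chart_cover_pfw[OF cov] cov smooth_map_pfw_snd[OF A] this]
      have near: "smooth_near (pfw_atlas A) (wavefront u0 v0 x) (h \<circ> snd)" .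
      have h: "(h \<circ> snd) \<circ> wavefront u0 v0 = h" by (auto simp: wavefront_def)
      from fun_cong[OF e, of "h \<circ> snd"] near show ?thesis by (simp add: differential_def h)
    next
      case False
      then show ?thesis using X Y by (auto simp: tangent_space_def tangent_vec_def)
    qed
  qed
  ultimately show ?thesis
    using A conn smooth_map_wavefront[OF A] by (simp add: spacelike_submanifold_def immersion_def)
qed

text \<open>
  Vectors tangent to a submanifold on which \<open>u\<close> is constant have no \<open>u\<close>-component, and on such vectors the
  ambient metric is the pullback of \<open>g\<close>.
\<close>

lemma projection_local_isometry:
  fixes S :: "('s::t2_space, 'f::euclidean_space) chart set"
    and A :: "('m::t2_space, 'e::euclidean_space) chart set"
  assumes pfw: "plane_fronted_wave A g H"
    and sub: "spacelike_submanifold S (pfw_atlas A) (pfw_metric A g H) \<psi>"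
    and u: "\<And>p. (coord_u \<circ> \<psi>) p = u0" and dims: "DIM('f) = DIM('e)"
  shows "local_isometry S (pullback_metric (pfw_atlas A) (pfw_metric A g H) \<psi>)
    A (pullback_metric (pfw_atlas A) (pfw_metric A g H) (wavefront u1 v1)) (snd \<circ> \<psi>)"
proof -
  have A: "smooth_atlas A" and g: "riemannian_metric A g" and conn: "connected (UNIV :: 'm set)"
    using pfw by (auto simp: plane_fronted_wave_def riemannian_manifold_def)
  have Sa: "smooth_atlas S" and \<psi>: "smooth_map S (pfw_atlas A) \<psi>" and connS: "connected (UNIV :: 's set)"
    and r: "riemannian_metric S (pullback_metric (pfw_atlas A) (pfw_metric A g H) \<psi>)"
    using sub by (auto simp: spacelike_submanifold_def immersion_def)
  have rw: "riemannian_metric A (pullback_metric (pfw_atlas A) (pfw_metric A g H) (wavefront u1 v1))"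
    using spacelike_wavefront[OF pfw] by (auto simp: spacelike_submanifold_def)
  note covA = smooth_atlas_chart_cover[OF A] and covS = smooth_atlas_chart_cover[OF Sa]
  note covP = chart_cover_pfw[OF covA]
  have dom: "fst c \<inter> (snd \<circ> \<psi>) -` fst a = fst c \<inter> \<psi> -` fst (pfw_chart a)" for c :: "('s, 'f) chart" and a :: "('m, 'e) chart"
    by (auto simp: pfw_chart_simps mem_Times_iff)
  have mapc: "snd a \<circ> (snd \<circ> \<psi>) \<circ> chart_inv c = (\<lambda>z. snd ((snd (pfw_chart a) \<circ> \<psi> \<circ> chart_inv c) z))"
    for c :: "('s, 'f) chart" and a :: "('m, 'e) chart"
    by (auto simp: pfw_chart_simps)
  have pa: "pfw_chart a \<in> pfw_atlas A" if "a \<in> A" for a using that by (simp add: pfw_atlas_eq)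
  have sm: "smooth_map S A (snd \<circ> \<psi>)"
    unfolding smooth_map_def
  proof (intro conjI ballI)
    show "continuous_on UNIV (snd \<circ> \<psi>)"
      using \<psi> unfolding smooth_map_def o_def by (intro continuous_on_snd) blast
    fix c a assume c: "c \<in> S" and a: "a \<in> A"
    show "smooth_on (snd c ` (fst c \<inter> (snd \<circ> \<psi>) -` fst a)) (snd a \<circ> (snd \<circ> \<psi>) \<circ> chart_inv c)"
      unfolding dom mapc
      by (rule smooth_on_bounded_linear[OF bounded_linear_snd smooth_map_chart[OF covS covP \<psi> c pa[OF a]]])
  qed
  show ?thesis
  proof
    show "smooth_map S A (snd \<circ> \<psi>)" by (rule sm)
    fix c a y v w
    assume c: "c \<in> S" and a: "a \<in> A" and y: "y \<in> snd c ` (fst c \<inter> (snd \<circ> \<psi>) -` fst a)"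
    let ?\<Psi> = "snd (pfw_chart a) \<circ> \<psi> \<circ> chart_inv c" and ?\<Phi> = "snd a \<circ> (snd \<circ> \<psi>) \<circ> chart_inv c"
    note ch = smooth_map_chart[OF covS covP \<psi> c pa[OF a]]
    note y' = y[unfolded dom]
    have \<Psi>: "(?\<Psi> has_derivative frechet_derivative ?\<Psi> (at y)) (at y)" by (rule smooth_on_has_derivative[OF ch(2) y'])
    have "(?\<Phi> has_derivative (\<lambda>v. snd (frechet_derivative ?\<Psi> (at y) v))) (at y)"
      unfolding mapc by (rule bounded_linear.has_derivative[OF bounded_linear_snd \<Psi>])
    then have D: "frechet_derivative ?\<Phi> (at y) v = snd (frechet_derivative ?\<Psi> (at y) v)" for v
      using frechet_derivative_at by metis
    have uD: "fst (fst (frechet_derivative ?\<Psi> (at y) v)) = 0" for v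
    proof -
      have "((\<lambda>z. fst (fst (?\<Psi> z))) has_derivative (\<lambda>v. fst (fst (frechet_derivative ?\<Psi> (at y) v)))) (at y)"
        by (rule bounded_linear.has_derivative[OF bounded_linear_compose[OF bounded_linear_fst bounded_linear_fst] \<Psi>])
      moreover have "(\<lambda>z. fst (fst (?\<Psi> z))) = (\<lambda>z. u0)"
        using u by (auto simp: pfw_chart_simps coord_u_def)
      ultimately have "((\<lambda>z. u0) has_derivative (\<lambda>v. fst (fst (frechet_derivative ?\<Psi> (at y) v)))) (at y)" by simp
      from has_derivative_unique[OF this has_derivative_const] show ?thesis by meson
    qed
    obtain p where p: "p \<in> fst c" "\<psi> p \<in> fst (pfw_chart a)" "y = snd c p" using y' by blast
    have im: "?\<Phi> y \<in> chart_image a"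
      using p chart_inv_left[OF chart_cover_is_chart[OF covS c] p(1)] by (auto simp: pfw_chart_simps intro: chart_image_mem)
    have im': "snd (?\<Psi> y) \<in> chart_image a" using im by (simp add: mapc)
    have \<Phi>y: "snd (?\<Psi> y) = ?\<Phi> y" by (simp add: mapc)
    have "metric_in_chart S (pullback_metric (pfw_atlas A) (pfw_metric A g H) \<psi>) c y v w
      = metric_in_chart (pfw_atlas A) (pfw_metric A g H) (pfw_chart a) (?\<Psi> y) (frechet_derivative ?\<Psi> (at y) v) (frechet_derivative ?\<Psi> (at y) w)"
      by (rule metric_in_chart_pullback[OF covS covP \<psi> c pa[OF a] y'])
    also have "\<dots> = metric_in_chart A g a (?\<Phi> y) (frechet_derivative ?\<Phi> (at y) v) (frechet_derivative ?\<Phi> (at y) w)"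
      unfolding metric_in_chart_pfw[OF A a im'] uD D \<Phi>y by simp
    also have "\<dots> = metric_in_chart A (pullback_metric (pfw_atlas A) (pfw_metric A g H) (wavefront u1 v1)) a (?\<Phi> y)
        (frechet_derivative ?\<Phi> (at y) v) (frechet_derivative ?\<Phi> (at y) w)"
      by (rule metric_in_chart_wavefront[OF A a im, symmetric])
    finally show "metric_in_chart S (pullback_metric (pfw_atlas A) (pfw_metric A g H) \<psi>) c y v w
      = metric_in_chart A (pullback_metric (pfw_atlas A) (pfw_metric A g H) (wavefront u1 v1)) a (?\<Phi> y)
        (frechet_derivative ?\<Phi> (at y) v) (frechet_derivative ?\<Phi> (at y) w)" .
  qed (fact Sa A r rw conn connS dims)+
qed

theorem theorem11:
  fixes A :: "('m::{t2_space, second_countable_topology}, 'e::euclidean_space) chart set"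
    and g :: "'m metric_tensor"
    and H :: "real \<Rightarrow> 'm \<Rightarrow> real"
    and S :: "('s::{t2_space, second_countable_topology}, 'f::euclidean_space) chart set"
    and \<psi> :: "'s \<Rightarrow> 'm pfw"
  assumes "plane_fronted_wave A g H"
    and "parabolic_spacelike_submanifold S (pfw_atlas A) (pfw_metric A g H) \<psi>"
    and "((\<forall>p. pfw_metric A g H (\<psi> p)
              (mean_curvature S (pfw_atlas A) (pfw_metric A g H) \<psi> p) (partial_v A (\<psi> p)) \<ge> 0) \<and>
          bdd_above (range (coord_u \<circ> \<psi>))) \<or>
         ((\<forall>p. pfw_metric A g H (\<psi> p)
              (mean_curvature S (pfw_atlas A) (pfw_metric A g H) \<psi> p) (partial_v A (\<psi> p)) \<le> 0) \<and>
          bdd_below (range (coord_u \<circ> \<psi>)))"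
  shows "\<exists>u0. (\<forall>p. (coord_u \<circ> \<psi>) p = u0) \<and>
           (simply_connected (UNIV :: 's set) \<and> DIM('f) = DIM('e) \<longrightarrow>
             (\<forall>v0. parabolic_spacelike_submanifold A (pfw_atlas A) (pfw_metric A g H)
                     (wavefront u0 v0)))"
proof -
  let ?g = "pullback_metric (pfw_atlas A) (pfw_metric A g H) \<psi>"
  let ?\<mu> = "coord_u \<circ> \<psi>"
  have sub: "spacelike_submanifold S (pfw_atlas A) (pfw_metric A g H) \<psi>" and par: "parabolic S ?g"
    using assms(2) by (auto simp: parabolic_spacelike_submanifold_def)
  have S: "smooth_atlas S" and r: "riemannian_metric S ?g"
    using sub by (auto simp: spacelike_submanifold_def)
  note lap = laplacian_u_eq_mean_curvature[OF assms(1) sub] and sm = smooth_coord_u[OF assms(1) sub]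
  have "\<exists>u0. \<forall>p. ?\<mu> p = u0"
    using assms(3)
  proof (elim disjE conjE)
    assume h: "\<forall>p. pfw_metric A g H (\<psi> p)
        (mean_curvature S (pfw_atlas A) (pfw_metric A g H) \<psi> p) (partial_v A (\<psi> p)) \<ge> 0"
      and "bdd_above (range ?\<mu>)"
    then obtain M where "\<And>p. ?\<mu> p \<le> M" unfolding bdd_above_def by blast
    then have "bdd_below (range (\<lambda>p. - ?\<mu> p))" by (intro bdd_belowI2[of _ "- M"]) auto
    moreover have "superharmonic S ?g (\<lambda>p. - ?\<mu> p)"
      by (rule superharmonic_uminus[OF S r sm]) (use h in \<open>simp add: lap\<close>)
    ultimately have "(\<lambda>p. - ?\<mu> p) constant_on UNIV" using par by (simp add: parabolic_def)
    then obtain k where "\<And>p. - ?\<mu> p = k" unfolding constant_on_def by blast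
    then have "\<forall>p. ?\<mu> p = - k" by (metis minus_minus)
    then show ?thesis by blast
  next
    assume h: "\<forall>p. pfw_metric A g H (\<psi> p)
        (mean_curvature S (pfw_atlas A) (pfw_metric A g H) \<psi> p) (partial_v A (\<psi> p)) \<le> 0"
      and bdd: "bdd_below (range ?\<mu>)"
    have "laplacian S ?g ?\<mu> p \<le> 0" for p
      unfolding lap using h by (intro mult_nonneg_nonpos) auto
    then have "superharmonic S ?g ?\<mu>" using sm by (simp add: superharmonic_def)
    then have "?\<mu> constant_on UNIV" using par bdd by (simp add: parabolic_def)
    then show ?thesis unfolding constant_on_def by blast
  qed
  then obtain u0 where u0: "\<And>p. ?\<mu> p = u0" by blast
  have "parabolic_spacelike_submanifold A (pfw_atlas A) (pfw_metric A g H) (wavefront u0 v0)"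
    if dims: "DIM('f) = DIM('e)" for v0
    using spacelike_wavefront[OF assms(1)]
      local_isometry.parabolic_target[OF projection_local_isometry[OF assms(1) sub u0 dims] par]
    by (simp add: parabolic_spacelike_submanifold_def)
  with u0 show ?thesis by blast
qed

end
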